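(* Let $\sigma,\tau\in\mathbb{R}$, $l\in\frac12\mathbb{Z}_+$ and $i,j\in\{-l,-l+1,\dots,l\}$. The generalised matrix element $a^l_{i,j}(\tau,\sigma)$ satisfies the relative bi-invariance property $$(X_\sigma A).a^l_{i,j}(\tau,\sigma)=\lambda_j(\sigma)\,a^l_{i,j}(\tau,\sigma)\quad\text{and}\quad a^l_{i,j}(\tau,\sigma).(X_\tau A)=\lambda_i(\tau)\,a^l_{i,j}(\tau,\sigma).$$
   Context: Fix $0<q<1$; $\mathbb{Z}_+=\{0,1,2,\dots\}$, $\frac12\mathbb{Z}_+=\{0,\frac12,1,\dots\}$. Notation: $(a;p)_k=\prod_{r=0}^{k-1}(1-ap^r)$ for any base $p$, $(a_1,\dots,a_s;p)_k=\prod_r(a_r;p)_k$, $\left[{n\atop k}\right]_{p}=(p^n;p^{-1})_k/(p;p)_k$, and ${}_3\varphi_2\left({a_1,a_2,a_3\atop b_1,b_2};p,z\right)=\sum_{k\ge0}\frac{(a_1,a_2,a_3;p)_k}{(b_1,b_2,p;p)_k}z^k$; if $p^{-N}$ is a lower parameter and $p^{-n}$, $0\le n\le N$, an upper one, the series is the terminating sum up to $k=n$. Quantum group. $\mathcal{A}=\mathcal{A}_q(SU(2))$ is the complex unital algebra generated by $\alpha,\beta,\gamma,\delta$ with relations $\alpha\beta=q\beta\alpha$, $\alpha\gamma=q\gamma\alpha$, $\beta\delta=q\delta\beta$, $\gamma\delta=q\delta\gamma$, $\beta\gamma=\gamma\beta$, $\alpha\delta-q\beta\gamma=\delta\alpha-q^{-1}\beta\gamma=1$;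 its comultiplication is $\Delta(\alpha)=\alpha\otimes\alpha+\beta\otimes\gamma$, $\Delta(\beta)=\alpha\otimes\beta+\beta\otimes\delta$, $\Delta(\gamma)=\gamma\otimes\alpha+\delta\otimes\gamma$, $\Delta(\delta)=\gamma\otimes\beta+\delta\otimes\delta$, and its counit is $\varepsilon(\alpha)=\varepsilon(\delta)=1$, $\varepsilon(\beta)=\varepsilon(\gamma)=0$. $\mathcal{U}=\mathcal{U}_q(\mathfrak{su}(2))$ is the complex unital algebra generated by $A,B,C,D$ with $AD=DA=1$, $AB=qBA$, $AC=q^{-1}CA$, $BC-CB=(A^2-D^2)/(q-q^{-1})$; $\Delta(A)=A\otimes A$, $\Delta(D)=D\otimes D$, $\Delta(B)=A\otimes B+B\otimes D$, $\Delta(C)=A\otimes C+C\otimes D$; $\varepsilon(A)=\varepsilon(D)=1$, $\varepsilon(B)=\varepsilon(C)=0$. They are in (doubly non-degenerate) duality by the pairing with $\langle XY,\xi\rangle=\langle X\otimes Y,\Delta(\xi)\rangle$, $\langle X,\xi\eta\rangle=\langle\Delta(X),\xi\otimes\eta\rangle$, $\langle 1,\xi\rangle=\varepsilon(\xi)$, $\langle X,1\rangle=\varepsilon(X)$, whose only nonzero values on pairs of generators are $\langle A,\alpha\rangle=\langle D,\delta\rangle=q^{1/2}$, $\langle A,\delta\rangle=\langle D,\alpha\rangle=q^{-1/2}$, $\langle B,\beta\rangle=\langle C,\gamma\rangle=1$. For $X\in\mathcal{U}$, $\xi\in\mathcal{A}$: $X.\xi=(\mathrm{id}\otimes X)\Delta(\xi)$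 and $\xi.X=(X\otimes\mathrm{id})\Delta(\xi)$ (pairing in the second, respectively first, factor). Representations. For $l\in\frac12\mathbb{Z}_+$, $t^l$ is the representation of $\mathcal{U}$ on a $(2l+1)$-dimensional space with orthonormal basis $e^l_n$, $n=-l,-l+1,\dots,l$: $t^l(A)e^l_n=q^{-n}e^l_n$, $t^l(D)e^l_n=q^ne^l_n$, $t^l(B)e^l_n=\frac{\sqrt{(q^{-l+n-1}-q^{l-n+1})(q^{-l-n}-q^{l+n})}}{q^{-1}-q}e^l_{n-1}$, $t^l(C)e^l_n=\frac{\sqrt{(q^{-l+n}-q^{l-n})(q^{-l-n-1}-q^{l+n+1})}}{q^{-1}-q}e^l_{n+1}$. The elements $t^l_{n,m}\in\mathcal{A}$ are determined by $\langle X,t^l_{n,m}\rangle=\langle t^l(X)e^l_m,e^l_n\rangle$ for all $X\in\mathcal{U}$ (inner products are linear in the first variable). For $\sigma\in\mathbb{R}$ and $\mathrm{i}=\sqrt{-1}$, $$X_\sigma=\mathrm{i}q^{1/2}B-\mathrm{i}q^{-1/2}C-\frac{q^\sigma-q^{-\sigma}}{q-q^{-1}}(A-D)\in\mathcal{U},\qquad \lambda_j(\sigma)=\frac{q^{-2j-\sigma}-q^{\sigma+2j}+q^\sigma-q^{-\sigma}}{q-q^{-1}}.$$ For $j,n\in\{-l,\dots,l\}$, $$C^{l,j}(\sigma)=q^{l+j}\left[{2l\atop l-j}\right]_{q^2}^{1/2}\Big(\frac{1+q^{-4j-2\sigma}}{1+q^{-2\sigma}}\Big)^{1/2}\Big((-q^{2-2\sigma};q^2)_{l-j}(-q^{2+2\sigma};q^2)_{l+j}\Big)^{-1/2},$$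 $$v^{l,j}_n(\sigma)=C^{l,j}(\sigma)\,\mathrm{i}^{\,n-l}q^{\sigma(l-n)}q^{\frac12(l-n)(l-n-1)}\Big(\frac{(q^{4l};q^{-2})_{l-n}}{(q^2;q^2)_{l-n}}\Big)^{1/2}{}_3\varphi_2\left({q^{-2(l-n)},q^{-2(l-j)},-q^{-2l-2j-2\sigma}\atop q^{-4l},0};q^2,q^2\right);$$ the vectors $v^{l,j}(\sigma)=\sum_nv^{l,j}_n(\sigma)e^l_n$, $j=-l,\dots,l$, form an orthonormal basis of eigenvectors of the self-adjoint operator $t^l(X_\sigma A)$, with eigenvalues $\lambda_j(\sigma)$. The generalised matrix elements are defined by $\langle X,a^l_{i,j}(\tau,\sigma)\rangle=\langle t^l(X)v^{l,j}(\sigma),v^{l,i}(\tau)\rangle$ for all $X\in\mathcal{U}$, i.e. $a^l_{i,j}(\tau,\sigma)=\sum_{n,m=-l}^lv^{l,j}_m(\sigma)\overline{v^{l,i}_n(\tau)}\,t^l_{n,m}\in\mathcal{A}$. *)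

theory Defs
  imports "HOL-Analysis.Analysis" "HOL-Library.Poly_Mapping"
begin

section \<open>Complex unital algebras\<close>

class complex_vector = ab_group_add +
  fixes scaleC :: "complex \<Rightarrow> 'a \<Rightarrow> 'a"  (infixr \<open>*\<^sub>C\<close> 75)
  assumes scaleC_add_right: "a *\<^sub>C (x + y) = a *\<^sub>C x + a *\<^sub>C y"
    and scaleC_add_left: "(a + b) *\<^sub>C x = a *\<^sub>C x + b *\<^sub>C x"
    and scaleC_scaleC: "a *\<^sub>C (b *\<^sub>C x) = (a * b) *\<^sub>C x"
    and scaleC_one: "1 *\<^sub>C x = x"

class complex_algebra_1 = complex_vector + ring_1 +
  assumes mult_scaleC_left: "(a *\<^sub>C x) * y = a *\<^sub>C (x * y)"
    and mult_scaleC_right: "x * (a *\<^sub>C y) = a *\<^sub>C (x * y)"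

global_interpretation cvec: vector_space "scaleC :: complex \<Rightarrow> 'a \<Rightarrow> 'a::complex_vector"
  by unfold_locales (rule scaleC_add_right scaleC_add_left scaleC_scaleC scaleC_one)+

instantiation complex :: complex_algebra_1
begin
definition scaleC_complex :: "complex \<Rightarrow> complex \<Rightarrow> complex"
  where "scaleC_complex a x = a * x"
instance by standard (auto simp: scaleC_complex_def algebra_simps)
end

instantiation poly_mapping :: (type, complex_vector) complex_vector
begin
definition scaleC_poly_mapping :: "complex \<Rightarrow> ('a \<Rightarrow>\<^sub>0 'b) \<Rightarrow> ('a \<Rightarrow>\<^sub>0 'b)"
  where "scaleC_poly_mapping a p = Poly_Mapping.map (scaleC a) p"

lemma lookup_scaleC [simp]: "Poly_Mapping.lookup (a *\<^sub>C p) k = a *\<^sub>C Poly_Mapping.lookup p k"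
  by (simp add: scaleC_poly_mapping_def Poly_Mapping.map.rep_eq when_def)

instance
  by standard (auto intro!: poly_mapping_eqI
      simp: lookup_add scaleC_add_right scaleC_add_left scaleC_scaleC scaleC_one)
end

lemma pm_induct [case_names zero single add]:
  assumes "P 0" and "\<And>k v. P (Poly_Mapping.single k v)"
    and "\<And>p r. P p \<Longrightarrow> P r \<Longrightarrow> P (p + r)"
  shows "P (p :: 'k \<Rightarrow>\<^sub>0 'b::comm_monoid_add)"
proof (induction p rule: update_induct)
  case const
  show ?case by (rule assms(1))
next
  case (update f a b)
  have "Poly_Mapping.update a b f = f + Poly_Mapping.single a b"
    using update.hyps
    by (intro poly_mapping_eqI)
       (auto simp: lookup_update lookup_add lookup_single when_def in_keys_iff)
  then show ?case using update.IH assms(2,3) by simp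
qed

lemma scaleC_single: "a *\<^sub>C Poly_Mapping.single k b = Poly_Mapping.single k (a *\<^sub>C b)"
  by (rule poly_mapping_eqI) (auto simp: lookup_single when_def)

lemma scaleC_eq_single_mult: "a *\<^sub>C p = Poly_Mapping.single 0 a * (p :: 'k::monoid_add \<Rightarrow>\<^sub>0 complex)"
  by (induction p rule: pm_induct)
     (simp_all add: scaleC_single scaleC_complex_def mult_single scaleC_add_right
        distrib_left distrib_right mult.commute)

lemma scaleC_eq_mult_single: "a *\<^sub>C p = (p :: 'k::monoid_add \<Rightarrow>\<^sub>0 complex) * Poly_Mapping.single 0 a"
  by (induction p rule: pm_induct)
     (simp_all add: scaleC_single scaleC_complex_def mult_single scaleC_add_right
        distrib_left distrib_right mult.commute)

lemma mult_scaleC_left_pm: "(a *\<^sub>C p) * q = a *\<^sub>C (p * (q :: 'k::monoid_add \<Rightarrow>\<^sub>0 complex))"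
  by (simp add: scaleC_eq_single_mult mult.assoc)

lemma mult_scaleC_right_pm: "p * (a *\<^sub>C q) = a *\<^sub>C (p * (q :: 'k::monoid_add \<Rightarrow>\<^sub>0 complex))"
  by (metis scaleC_eq_mult_single mult.assoc)

definition clinear_map :: "('a::complex_vector \<Rightarrow> 'b::complex_vector) \<Rightarrow> bool" where
  "clinear_map f \<longleftrightarrow> (\<forall>x y. f (x + y) = f x + f y) \<and> (\<forall>c x. f (c *\<^sub>C x) = c *\<^sub>C f x)"

definition cbilinear_map ::
    "('a::complex_vector \<Rightarrow> 'b::complex_vector \<Rightarrow> 'c::complex_vector) \<Rightarrow> bool" where
  "cbilinear_map f \<longleftrightarrow> (\<forall>x. clinear_map (f x)) \<and> (\<forall>y. clinear_map (\<lambda>x. f x y))"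

definition calg_hom :: "('a::complex_algebra_1 \<Rightarrow> 'b::complex_algebra_1) \<Rightarrow> bool" where
  "calg_hom f \<longleftrightarrow> clinear_map f \<and> f 1 = 1 \<and> (\<forall>x y. f (x * y) = f x * f y)"


section \<open>Presentations by generators and relations\<close>

datatype 'g word = Word (letters: "'g list")

instantiation word :: (type) monoid_add
begin
definition zero_word :: "'g word" where "zero_word = Word []"
definition plus_word :: "'g word \<Rightarrow> 'g word \<Rightarrow> 'g word"
  where "plus_word u v = Word (letters u @ letters v)"
instance by standard (auto simp: zero_word_def plus_word_def)
end

text \<open>The free algebra on \<open>'g\<close> is the monoid algebra of the free monoid of words.\<close>

type_synonym 'g free_alg = "'g word \<Rightarrow>\<^sub>0 complex"

definition var :: "'g \<Rightarrow> 'g free_alg" where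
  "var x = Poly_Mapping.single (Word [x]) 1"

definition free_eval :: "('g \<Rightarrow> 'a::complex_algebra_1) \<Rightarrow> 'g free_alg \<Rightarrow> 'a" where
  "free_eval h p =
     (\<Sum>w\<in>Poly_Mapping.keys p. Poly_Mapping.lookup p w *\<^sub>C prod_list (map h (letters w)))"

definition free_ideal :: "'g free_alg set \<Rightarrow> 'g free_alg set" where
  "free_ideal R = cvec.span {u * r * v | u r v. r \<in> R}"

text \<open>The algebra \<open>'a\<close> is generated by the family \<open>g\<close> with defining relations \<open>r = 0\<close>, \<open>r \<in> R\<close>:
  evaluation at \<open>g\<close> induces an isomorphism of \<open>'a\<close> with the free algebra modulo the two-sided ideal
  generated by \<open>R\<close>.\<close>

definition presented_by :: "('g \<Rightarrow> 'a::complex_algebra_1) \<Rightarrow> 'g free_alg set \<Rightarrow> bool" where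
  "presented_by g R \<longleftrightarrow> surj (free_eval g) \<and> {p. free_eval g p = 0} = free_ideal R"

definition hom_extending ::
    "('g \<Rightarrow> 'a::complex_algebra_1) \<Rightarrow> ('g \<Rightarrow> 'b::complex_algebra_1) \<Rightarrow> 'a \<Rightarrow> 'b" where
  "hom_extending g h = (THE f. calg_hom f \<and> (\<forall>x. f (g x) = h x))"


section \<open>Tensor products of algebras\<close>

text \<open>The tensor product is the free vector space on pairs modulo the bilinearity relations.
  Pairs are multiplied componentwise (written additively, as \<open>poly_mapping\<close> requires), so that
  the free vector space on pairs is already an algebra.\<close>

datatype ('a, 'b) pure_tensor = Pure 'a 'b

instantiation pure_tensor :: (monoid_mult, monoid_mult) monoid_add
begin
definition zero_pure_tensor :: "('a, 'b) pure_tensor" where "zero_pure_tensor = Pure 1 1"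
fun plus_pure_tensor ::
    "('a, 'b) pure_tensor \<Rightarrow> ('a, 'b) pure_tensor \<Rightarrow> ('a, 'b) pure_tensor" where
  "plus_pure_tensor (Pure a b) (Pure c d) = Pure (a * c) (b * d)"
instance
proof
  fix x y z :: "('a, 'b) pure_tensor"
  show "x + y + z = x + (y + z)" by (cases x; cases y; cases z) (simp add: mult.assoc)
  show "0 + x = x" "x + 0 = x" by (cases x; simp add: zero_pure_tensor_def)+
qed
end

abbreviation psingle :: "'a \<Rightarrow> 'b \<Rightarrow> ('a, 'b) pure_tensor \<Rightarrow>\<^sub>0 complex" where
  "psingle a b \<equiv> Poly_Mapping.single (Pure a b) 1"

definition bilin_rels ::
    "(('a::complex_algebra_1, 'b::complex_algebra_1) pure_tensor \<Rightarrow>\<^sub>0 complex) set" where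
  "bilin_rels =
     {psingle (a + a') b - psingle a b - psingle a' b | a a' b. True} \<union>
     {psingle a (b + b') - psingle a b - psingle a b' | a b b'. True} \<union>
     {psingle (c *\<^sub>C a) b - c *\<^sub>C psingle a b | c a b. True} \<union>
     {psingle a (c *\<^sub>C b) - c *\<^sub>C psingle a b | c a b. True}"

definition tensor_rel ::
    "(('a::complex_algebra_1, 'b::complex_algebra_1) pure_tensor \<Rightarrow>\<^sub>0 complex)
      \<Rightarrow> (('a, 'b) pure_tensor \<Rightarrow>\<^sub>0 complex) \<Rightarrow> bool" where
  "tensor_rel p q \<longleftrightarrow> p - q \<in> cvec.span bilin_rels"

lemma equivp_tensor_rel: "equivp tensor_rel"
proof (rule equivpI)
  show "reflp tensor_rel" by (simp add: reflp_def tensor_rel_def cvec.span_zero)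
  show "symp tensor_rel"
    unfolding symp_def tensor_rel_def by (metis cvec.span_neg minus_diff_eq)
  show "transp tensor_rel"
    unfolding transp_def tensor_rel_def
    by (metis (no_types, opaque_lifting) cvec.span_add diff_add_cancel add_diff_eq)
qed

quotient_type (overloaded) ('a, 'b) tensor =
  "('a::complex_algebra_1, 'b::complex_algebra_1) pure_tensor \<Rightarrow>\<^sub>0 complex" / tensor_rel
  by (rule equivp_tensor_rel)

lift_definition pure_tens ::
    "'a::complex_algebra_1 \<Rightarrow> 'b::complex_algebra_1 \<Rightarrow> ('a, 'b) tensor"  (infixr \<open>\<otimes>\<close> 72)
  is "\<lambda>a b. psingle a b" .

lemma bilin_rels_mult:
  fixes r :: "('a::complex_algebra_1, 'b::complex_algebra_1) pure_tensor \<Rightarrow>\<^sub>0 complex"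
  assumes "r \<in> bilin_rels"
  shows "psingle x y * r \<in> bilin_rels" "r * psingle x y \<in> bilin_rels"
proof -
  consider (1) a a' b where "r = psingle (a + a') b - psingle a b - psingle a' b"
    | (2) a b b' where "r = psingle a (b + b') - psingle a b - psingle a b'"
    | (3) c a b where "r = psingle (c *\<^sub>C a) b - c *\<^sub>C psingle a b"
    | (4) c a b where "r = psingle a (c *\<^sub>C b) - c *\<^sub>C psingle a b"
    using assms unfolding bilin_rels_def by blast
  then have "psingle x y * r \<in> bilin_rels \<and> r * psingle x y \<in> bilin_rels"
  proof cases
    case 1
    have "psingle x y * r = psingle (x * a + x * a') (y * b) - psingle (x * a) (y * b) - psingle (x * a') (y * b)"
      "r * psingle x y = psingle (a * x + a' * x) (b * y) - psingle (a * x) (b * y) - psingle (a' * x) (b * y)"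
      unfolding 1 by (simp_all add: algebra_simps mult_single)
    then show ?thesis unfolding bilin_rels_def by blast
  next
    case 2
    have "psingle x y * r = psingle (x * a) (y * b + y * b') - psingle (x * a) (y * b) - psingle (x * a) (y * b')"
      "r * psingle x y = psingle (a * x) (b * y + b' * y) - psingle (a * x) (b * y) - psingle (a * x) (b' * y)"
      unfolding 2 by (simp_all add: algebra_simps mult_single)
    then show ?thesis unfolding bilin_rels_def by blast
  next
    case 3
    have "psingle x y * r = psingle (c *\<^sub>C (x * a)) (y * b) - c *\<^sub>C psingle (x * a) (y * b)"
      "r * psingle x y = psingle (c *\<^sub>C (a * x)) (b * y) - c *\<^sub>C psingle (a * x) (b * y)"
      unfolding 3
      by (simp_all add: algebra_simps mult_single mult_scaleC_left_pm mult_scaleC_right_pm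
          mult_scaleC_left mult_scaleC_right)
    then show ?thesis unfolding bilin_rels_def by blast
  next
    case 4
    have "psingle x y * r = psingle (x * a) (c *\<^sub>C (y * b)) - c *\<^sub>C psingle (x * a) (y * b)"
      "r * psingle x y = psingle (a * x) (c *\<^sub>C (b * y)) - c *\<^sub>C psingle (a * x) (b * y)"
      unfolding 4
      by (simp_all add: algebra_simps mult_single mult_scaleC_left_pm mult_scaleC_right_pm
          mult_scaleC_left mult_scaleC_right)
    then show ?thesis unfolding bilin_rels_def by blast
  qed
  then show "psingle x y * r \<in> bilin_rels" "r * psingle x y \<in> bilin_rels" by auto
qed

lemma single_eq_scaleC_psingle: "Poly_Mapping.single (Pure a b) c = c *\<^sub>C psingle a b"
  by (rule poly_mapping_eqI) (auto simp: lookup_single when_def scaleC_complex_def)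

lemma span_bilin_rels_mult:
  fixes r p :: "('a::complex_algebra_1, 'b::complex_algebra_1) pure_tensor \<Rightarrow>\<^sub>0 complex"
  assumes "r \<in> cvec.span bilin_rels"
  shows "p * r \<in> cvec.span bilin_rels" "r * p \<in> cvec.span bilin_rels"
proof -
  have 1: "psingle x y * r \<in> cvec.span bilin_rels \<and> r * psingle x y \<in> cvec.span bilin_rels" for x y
    using assms
  proof (induction rule: cvec.span_induct_alt)
    case base
    show ?case by (simp add: cvec.span_zero)
  next
    case (step c z w)
    then show ?case
      using bilin_rels_mult[of z x y]
      by (simp add: distrib_left distrib_right mult_scaleC_left_pm mult_scaleC_right_pm
          cvec.span_add cvec.span_scale cvec.span_base)
  qed
  have "p * r \<in> cvec.span bilin_rels \<and> r * p \<in> cvec.span bilin_rels"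
  proof (induction p rule: pm_induct)
    case zero
    show ?case by (simp add: cvec.span_zero)
  next
    case (single k v)
    obtain x y where "k = Pure x y" by (cases k)
    then show ?case
      using 1 by (simp add: single_eq_scaleC_psingle[of x y v] mult_scaleC_left_pm
          mult_scaleC_right_pm cvec.span_scale)
  next
    case (add p q)
    then show ?case by (simp add: distrib_left distrib_right cvec.span_add)
  qed
  then show "p * r \<in> cvec.span bilin_rels" "r * p \<in> cvec.span bilin_rels" by auto
qed

lemma exists_unital_functional:
  "\<exists>f :: 'a::complex_algebra_1 \<Rightarrow> complex. clinear_map f \<and> f 1 = 1"
proof -
  interpret vector_space_pair "scaleC :: complex \<Rightarrow> 'a \<Rightarrow> 'a" "scaleC :: complex \<Rightarrow> complex \<Rightarrow> complex"
    by unfold_locales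
  have "cvec.independent {1::'a}"
    by (simp add: cvec.dependent_single)
  from linear_independent_extend[OF this, of "\<lambda>_. 1"]
  obtain f :: "'a \<Rightarrow> complex" where "Vector_Spaces.linear scaleC scaleC f" "f 1 = 1"
    by auto
  then show ?thesis
    unfolding clinear_map_def using linear_add linear_scale by blast
qed

lemma one_notin_span_bilin_rels:
  "(1 :: ('a::complex_algebra_1, 'b::complex_algebra_1) pure_tensor \<Rightarrow>\<^sub>0 complex) \<notin> cvec.span bilin_rels"
proof
  obtain f :: "'a \<Rightarrow> complex" and g :: "'b \<Rightarrow> complex"
    where f: "clinear_map f" "f 1 = 1" and g: "clinear_map g" "g 1 = 1"
    using exists_unital_functional by metis
  define h where "h = (\<lambda>k. case k of Pure a b \<Rightarrow> f a * g b)"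
  define F where "F = (\<lambda>p :: ('a, 'b) pure_tensor \<Rightarrow>\<^sub>0 complex.
      \<Sum>k\<in>Poly_Mapping.keys p. Poly_Mapping.lookup p k * h k)"
  have F: "F p = (\<Sum>k\<in>S. Poly_Mapping.lookup p k * h k)"
    if "finite S" "Poly_Mapping.keys p \<subseteq> S" for p S
    unfolding F_def using that by (intro sum.mono_neutral_left) (auto simp: in_keys_iff)
  have add: "F (p + q) = F p + F q" for p q
  proof -
    let ?S = "Poly_Mapping.keys p \<union> Poly_Mapping.keys q"
    have "Poly_Mapping.keys (p + q) \<subseteq> ?S" by (rule keys_add)
    then have "F (p + q) = (\<Sum>k\<in>?S. Poly_Mapping.lookup (p + q) k * h k)" by (intro F) auto
    also have "\<dots> = F p + F q"
      by (simp add: F[of ?S p] F[of ?S q] lookup_add distrib_right sum.distrib)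
    finally show ?thesis .
  qed
  have scale: "F (c *\<^sub>C p) = c * F p" for c p
  proof -
    have "Poly_Mapping.keys (c *\<^sub>C p) \<subseteq> Poly_Mapping.keys p"
      by (auto simp: in_keys_iff scaleC_complex_def)
    then have "F (c *\<^sub>C p) = (\<Sum>k\<in>Poly_Mapping.keys p. Poly_Mapping.lookup (c *\<^sub>C p) k * h k)"
      by (intro F) auto
    then show ?thesis by (simp add: F_def scaleC_complex_def sum_distrib_left mult.assoc)
  qed
  have diff: "F (p - q) = F p - F q" for p q
    using add[of "p - q" q] by simp
  have single: "F (psingle a b) = f a * g b" for a b
    by (simp add: F_def h_def)
  have zero: "F r = 0" if "r \<in> bilin_rels" for r
    using that f(1) g(1) unfolding bilin_rels_def clinear_map_def
    by (elim UnE CollectE exE conjE; simp only: diff scale single; simp add: distrib_left distrib_right scaleC_complex_def)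
  assume "(1 :: ('a, 'b) pure_tensor \<Rightarrow>\<^sub>0 complex) \<in> cvec.span bilin_rels"
  then have "F 1 = 0"
  proof (induction rule: cvec.span_induct_alt)
    case base
    show ?case by (simp add: F_def)
  next
    case (step c x y)
    then show ?case by (simp add: add scale zero)
  qed
  moreover have "F 1 = 1"
    using single[of 1 1] f(2) g(2) by (simp flip: single_one add: zero_pure_tensor_def)
  ultimately show False by simp
qed

instantiation tensor :: (complex_algebra_1, complex_algebra_1) complex_algebra_1
begin

lift_definition zero_tensor :: "('a, 'b) tensor" is 0 .
lift_definition one_tensor :: "('a, 'b) tensor" is 1 .

lift_definition plus_tensor :: "('a, 'b) tensor \<Rightarrow> ('a, 'b) tensor \<Rightarrow> ('a, 'b) tensor" is "(+)"
proof -
  fix p p' q q' :: "('a, 'b) pure_tensor \<Rightarrow>\<^sub>0 complex"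
  assume "tensor_rel p p'" "tensor_rel q q'"
  then show "tensor_rel (p + q) (p' + q')"
    unfolding tensor_rel_def using cvec.span_add by (fastforce simp: algebra_simps)
qed

lift_definition uminus_tensor :: "('a, 'b) tensor \<Rightarrow> ('a, 'b) tensor" is uminus
proof -
  fix p p' :: "('a, 'b) pure_tensor \<Rightarrow>\<^sub>0 complex"
  assume "tensor_rel p p'"
  then show "tensor_rel (- p) (- p')"
    unfolding tensor_rel_def using cvec.span_neg by fastforce
qed

definition minus_tensor :: "('a, 'b) tensor \<Rightarrow> ('a, 'b) tensor \<Rightarrow> ('a, 'b) tensor"
  where "minus_tensor s t = s + (- t)"

lift_definition times_tensor :: "('a, 'b) tensor \<Rightarrow> ('a, 'b) tensor \<Rightarrow> ('a, 'b) tensor" is "(*)"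
proof -
  fix p p' q q' :: "('a, 'b) pure_tensor \<Rightarrow>\<^sub>0 complex"
  assume "tensor_rel p p'" "tensor_rel q q'"
  then have "(p - p') * q + p' * (q - q') \<in> cvec.span bilin_rels"
    unfolding tensor_rel_def by (intro cvec.span_add span_bilin_rels_mult)
  then show "tensor_rel (p * q) (p' * q')"
    unfolding tensor_rel_def by (simp add: algebra_simps)
qed

lift_definition scaleC_tensor :: "complex \<Rightarrow> ('a, 'b) tensor \<Rightarrow> ('a, 'b) tensor" is scaleC
proof -
  fix c and p p' :: "('a, 'b) pure_tensor \<Rightarrow>\<^sub>0 complex"
  assume "tensor_rel p p'"
  then show "tensor_rel (c *\<^sub>C p) (c *\<^sub>C p')"
    unfolding tensor_rel_def using cvec.span_scale[of "p - p'" bilin_rels c]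
    by (simp add: cvec.scale_right_diff_distrib)
qed

instance
proof
  have eq: "tensor_rel p p" for p :: "('a, 'b) pure_tensor \<Rightarrow>\<^sub>0 complex"
    by (simp add: tensor_rel_def cvec.span_zero)
  fix x y z :: "('a, 'b) tensor" and c d :: complex
  show "x + y + z = x + (y + z)" by transfer (simp add: eq add.assoc)
  show "x + y = y + x" by transfer (simp add: eq add.commute)
  show "0 + x = x" by transfer (simp add: eq)
  show "- x + x = 0" by transfer (simp add: eq)
  show "x - y = x + - y" by (simp add: minus_tensor_def)
  show "x * y * z = x * (y * z)" by transfer (simp add: eq mult.assoc)
  show "1 * x = x" by transfer (simp add: eq)
  show "x * 1 = x" by transfer (simp add: eq)
  show "(x + y) * z = x * z + y * z" by transfer (simp add: eq distrib_right)
  show "x * (y + z) = x * y + x * z" by transfer (simp add: eq distrib_left)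
  show "(0 :: ('a, 'b) tensor) \<noteq> 1"
    by transfer
       (metis tensor_rel_def one_notin_span_bilin_rels cvec.span_neg diff_0 minus_minus)
  show "c *\<^sub>C (x + y) = c *\<^sub>C x + c *\<^sub>C y" by transfer (simp add: eq scaleC_add_right)
  show "(c + d) *\<^sub>C x = c *\<^sub>C x + d *\<^sub>C x" by transfer (simp add: eq scaleC_add_left)
  show "c *\<^sub>C d *\<^sub>C x = (c * d) *\<^sub>C x" by transfer (simp add: eq scaleC_scaleC)
  show "1 *\<^sub>C x = x" by transfer (simp add: eq scaleC_one)
  show "(c *\<^sub>C x) * y = c *\<^sub>C (x * y)" by transfer (simp add: eq mult_scaleC_left_pm)
  show "x * (c *\<^sub>C y) = c *\<^sub>C (x * y)" by transfer (simp add: eq mult_scaleC_right_pm)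
qed

end

definition tensor_lift :: "('a::complex_algebra_1 \<Rightarrow> 'b::complex_algebra_1 \<Rightarrow> 'c::complex_vector)
    \<Rightarrow> ('a, 'b) tensor \<Rightarrow> 'c" where
  "tensor_lift f = (THE F. clinear_map F \<and> (\<forall>a b. F (a \<otimes> b) = f a b))"


section \<open>The quantum group and the quantized universal enveloping algebra\<close>

datatype agen = Alpha | Beta | Gamma | Delta

definition A_relations :: "real \<Rightarrow> agen free_alg set" where
  "A_relations q =
     (let \<alpha> = var Alpha; \<beta> = var Beta; \<gamma> = var Gamma; \<delta> = var Delta; c = complex_of_real q in
      {\<alpha> * \<beta> - c *\<^sub>C (\<beta> * \<alpha>),
       \<alpha> * \<gamma> - c *\<^sub>C (\<gamma> * \<alpha>),
       \<beta> * \<delta> - c *\<^sub>C (\<delta> * \<beta>),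
       \<gamma> * \<delta> - c *\<^sub>C (\<delta> * \<gamma>),
       \<beta> * \<gamma> - \<gamma> * \<beta>,
       \<alpha> * \<delta> - c *\<^sub>C (\<beta> * \<gamma>) - 1,
       \<delta> * \<alpha> - inverse c *\<^sub>C (\<beta> * \<gamma>) - 1})"

definition is_Aq_SU2 :: "real \<Rightarrow> (agen \<Rightarrow> 'a::complex_algebra_1) \<Rightarrow> bool" where
  "is_Aq_SU2 q a \<longleftrightarrow> presented_by a (A_relations q)"

definition comult_A :: "(agen \<Rightarrow> 'a::complex_algebra_1) \<Rightarrow> 'a \<Rightarrow> ('a, 'a) tensor" where
  "comult_A a = hom_extending a (\<lambda>x. case x of
       Alpha \<Rightarrow> a Alpha \<otimes> a Alpha + a Beta \<otimes> a Gamma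
     | Beta  \<Rightarrow> a Alpha \<otimes> a Beta + a Beta \<otimes> a Delta
     | Gamma \<Rightarrow> a Gamma \<otimes> a Alpha + a Delta \<otimes> a Gamma
     | Delta \<Rightarrow> a Gamma \<otimes> a Beta + a Delta \<otimes> a Delta)"

definition counit_A :: "(agen \<Rightarrow> 'a::complex_algebra_1) \<Rightarrow> 'a \<Rightarrow> complex" where
  "counit_A a = hom_extending a (\<lambda>x. case x of Alpha \<Rightarrow> 1 | Beta \<Rightarrow> 0 | Gamma \<Rightarrow> 0 | Delta \<Rightarrow> 1)"

datatype ugen = UA | UB | UC | UD

definition U_relations :: "real \<Rightarrow> ugen free_alg set" where
  "U_relations q =
     (let A = var UA; B = var UB; C = var UC; D = var UD; c = complex_of_real q in
      {A * D - 1,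
       D * A - 1,
       A * B - c *\<^sub>C (B * A),
       A * C - inverse c *\<^sub>C (C * A),
       B * C - C * B - inverse (c - inverse c) *\<^sub>C (A ^ 2 - D ^ 2)})"

definition is_Uq_su2 :: "real \<Rightarrow> (ugen \<Rightarrow> 'u::complex_algebra_1) \<Rightarrow> bool" where
  "is_Uq_su2 q u \<longleftrightarrow> presented_by u (U_relations q)"

definition comult_U :: "(ugen \<Rightarrow> 'u::complex_algebra_1) \<Rightarrow> 'u \<Rightarrow> ('u, 'u) tensor" where
  "comult_U u = hom_extending u (\<lambda>x. case x of
       UA \<Rightarrow> u UA \<otimes> u UA
     | UB \<Rightarrow> u UA \<otimes> u UB + u UB \<otimes> u UD
     | UC \<Rightarrow> u UA \<otimes> u UC + u UC \<otimes> u UD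
     | UD \<Rightarrow> u UD \<otimes> u UD)"

definition counit_U :: "(ugen \<Rightarrow> 'u::complex_algebra_1) \<Rightarrow> 'u \<Rightarrow> complex" where
  "counit_U u = hom_extending u (\<lambda>x. case x of UA \<Rightarrow> 1 | UB \<Rightarrow> 0 | UC \<Rightarrow> 0 | UD \<Rightarrow> 1)"


section \<open>The duality pairing and the actions\<close>

fun gen_pairing :: "real \<Rightarrow> ugen \<Rightarrow> agen \<Rightarrow> complex" where
  "gen_pairing q UA Alpha = complex_of_real (q powr (1/2))"
| "gen_pairing q UA Delta = complex_of_real (q powr (-1/2))"
| "gen_pairing q UD Alpha = complex_of_real (q powr (-1/2))"
| "gen_pairing q UD Delta = complex_of_real (q powr (1/2))"
| "gen_pairing q UB Beta = 1"
| "gen_pairing q UC Gamma = 1"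
| "gen_pairing q _ _ = 0"

definition tensor_pairing :: "('u::complex_algebra_1 \<Rightarrow> 'a::complex_algebra_1 \<Rightarrow> complex)
    \<Rightarrow> ('u, 'u) tensor \<Rightarrow> ('a, 'a) tensor \<Rightarrow> complex" where
  "tensor_pairing p S T =
     tensor_lift (\<lambda>X Y. tensor_lift (\<lambda>\<xi> \<eta>. p X \<xi> * p Y \<eta>) T) S"

definition is_pairing :: "real \<Rightarrow> (ugen \<Rightarrow> 'u::complex_algebra_1) \<Rightarrow> (agen \<Rightarrow> 'a::complex_algebra_1)
    \<Rightarrow> ('u \<Rightarrow> 'a \<Rightarrow> complex) \<Rightarrow> bool" where
  "is_pairing q u a p \<longleftrightarrow>
     cbilinear_map p \<and>
     (\<forall>X Y \<xi>. p (X * Y) \<xi> = tensor_pairing p (X \<otimes> Y) (comult_A a \<xi>)) \<and>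
     (\<forall>X \<xi> \<eta>. p X (\<xi> * \<eta>) = tensor_pairing p (comult_U u X) (\<xi> \<otimes> \<eta>)) \<and>
     (\<forall>\<xi>. p 1 \<xi> = counit_A a \<xi>) \<and>
     (\<forall>X. p X 1 = counit_U u X) \<and>
     (\<forall>x y. p (u x) (a y) = gen_pairing q x y)"

definition pairing :: "real \<Rightarrow> (ugen \<Rightarrow> 'u::complex_algebra_1) \<Rightarrow> (agen \<Rightarrow> 'a::complex_algebra_1)
    \<Rightarrow> 'u \<Rightarrow> 'a \<Rightarrow> complex" where
  "pairing q u a = (THE p. is_pairing q u a p)"

text \<open>\<open>act_left q u a X \<xi>\<close> is $X.\xi$ and \<open>act_right q u a \<xi> X\<close> is $\xi.X$.\<close>

definition act_left :: "real \<Rightarrow> (ugen \<Rightarrow> 'u::complex_algebra_1) \<Rightarrow> (agen \<Rightarrow> 'a::complex_algebra_1)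
    \<Rightarrow> 'u \<Rightarrow> 'a \<Rightarrow> 'a" where
  "act_left q u a X \<xi> = tensor_lift (\<lambda>\<eta> \<zeta>. pairing q u a X \<zeta> *\<^sub>C \<eta>) (comult_A a \<xi>)"

definition act_right :: "real \<Rightarrow> (ugen \<Rightarrow> 'u::complex_algebra_1) \<Rightarrow> (agen \<Rightarrow> 'a::complex_algebra_1)
    \<Rightarrow> 'a \<Rightarrow> 'u \<Rightarrow> 'a" where
  "act_right q u a \<xi> X = tensor_lift (\<lambda>\<eta> \<zeta>. pairing q u a X \<eta> *\<^sub>C \<zeta>) (comult_A a \<xi>)"


section \<open>Spin representations\<close>

definition spins :: "real set" where
  "spins = {l. \<exists>N::nat. l = real N / 2}"

definition weights :: "real \<Rightarrow> real set" where
  "weights l = {n. \<exists>k::nat. n = - l + real k \<and> n \<le> l}"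

text \<open>A vector of the spin \<open>l\<close> space is its coordinate function \<open>real \<Rightarrow> complex\<close> on \<open>weights l\<close>, and
  an operator is its matrix: \<open>T n m\<close> is the coefficient of $e_n$ in $T e_m$, taken to be 0 off
  \<open>weights l\<close>.\<close>

definition mat_vec :: "real \<Rightarrow> (real \<Rightarrow> real \<Rightarrow> complex) \<Rightarrow> (real \<Rightarrow> complex) \<Rightarrow> real \<Rightarrow> complex" where
  "mat_vec l T v = (\<lambda>n. \<Sum>m\<in>weights l. T n m * v m)"

definition spin_inner :: "real \<Rightarrow> (real \<Rightarrow> complex) \<Rightarrow> (real \<Rightarrow> complex) \<Rightarrow> complex" where
  "spin_inner l v w = (\<Sum>n\<in>weights l. v n * cnj (w n))"

fun spin_gen :: "real \<Rightarrow> real \<Rightarrow> ugen \<Rightarrow> real \<Rightarrow> real \<Rightarrow> real" where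
  "spin_gen q l UA n m = (if n = m then q powr (-m) else 0)"
| "spin_gen q l UD n m = (if n = m then q powr m else 0)"
| "spin_gen q l UB n m = (if n = m - 1 then
     sqrt ((q powr (-l+m-1) - q powr (l-m+1)) * (q powr (-l-m) - q powr (l+m))) / (inverse q - q)
     else 0)"
| "spin_gen q l UC n m = (if n = m + 1 then
     sqrt ((q powr (-l+m) - q powr (l-m)) * (q powr (-l-m-1) - q powr (l+m+1))) / (inverse q - q)
     else 0)"

definition is_spin_rep :: "real \<Rightarrow> (ugen \<Rightarrow> 'u::complex_algebra_1) \<Rightarrow> real
    \<Rightarrow> ('u \<Rightarrow> real \<Rightarrow> real \<Rightarrow> complex) \<Rightarrow> bool" where
  "is_spin_rep q u l t \<longleftrightarrow>
     (\<forall>n m. clinear_map (\<lambda>X. t X n m)) \<and>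
     (\<forall>X n m. n \<notin> weights l \<or> m \<notin> weights l \<longrightarrow> t X n m = 0) \<and>
     (\<forall>n\<in>weights l. \<forall>m\<in>weights l.
        t 1 n m = (if n = m then 1 else 0) \<and>
        (\<forall>X Y. t (X * Y) n m = (\<Sum>k\<in>weights l. t X n k * t Y k m)) \<and>
        (\<forall>x. t (u x) n m = complex_of_real (spin_gen q l x n m)))"

definition spin_rep :: "real \<Rightarrow> (ugen \<Rightarrow> 'u::complex_algebra_1) \<Rightarrow> real
    \<Rightarrow> 'u \<Rightarrow> real \<Rightarrow> real \<Rightarrow> complex" where
  "spin_rep q u l = (THE t. is_spin_rep q u l t)"

text \<open>\<open>matrix_elt q u a l v w\<close> is the element whose pairing with each \<open>X\<close> is the inner product of
  $t^l(X) v$ with \<open>w\<close>; for basis vectors $v = e^l_m$, $w = e^l_n$ this is $t^l_{n,m}$.  It is unique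
  because the pairing is non-degenerate.\<close>

definition matrix_elt :: "real \<Rightarrow> (ugen \<Rightarrow> 'u::complex_algebra_1) \<Rightarrow> (agen \<Rightarrow> 'a::complex_algebra_1)
    \<Rightarrow> real \<Rightarrow> (real \<Rightarrow> complex) \<Rightarrow> (real \<Rightarrow> complex) \<Rightarrow> 'a" where
  "matrix_elt q u a l v w =
     (THE \<xi>. \<forall>X. pairing q u a X \<xi> = spin_inner l (mat_vec l (spin_rep q u l X) v) w)"


section \<open>Basic hypergeometric series and the eigenvectors\<close>

definition qpoch :: "real \<Rightarrow> real \<Rightarrow> nat \<Rightarrow> real" where
  "qpoch x p k = (\<Prod>r<k. 1 - x * p ^ r)"

definition qbinom :: "real \<Rightarrow> real \<Rightarrow> nat \<Rightarrow> real" where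
  "qbinom p n k = qpoch (p powr n) (inverse p) k / qpoch p p k"

text \<open>When a lower parameter is \<open>p\<close> to the power \<open>-N\<close> and an upper one \<open>p\<close> to the power \<open>-n\<close> with
  \<open>n \<le> N\<close>, the numerator vanishes for \<open>n < k\<close>; for \<open>N < k\<close> the summand is \<open>0 / 0 = 0\<close>.  So the sum
  below is the terminating one.\<close>

definition phi32 :: "real \<Rightarrow> real \<Rightarrow> real \<Rightarrow> real \<Rightarrow> real \<Rightarrow> real \<Rightarrow> real \<Rightarrow> real" where
  "phi32 a1 a2 a3 b1 b2 p z =
     suminf (\<lambda>k. (qpoch a1 p k * qpoch a2 p k * qpoch a3 p k) /
                  (qpoch b1 p k * qpoch b2 p k * qpoch p p k) * z ^ k)"

definition nat_of :: "real \<Rightarrow> nat" where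
  "nat_of x = nat \<lfloor>x\<rfloor>"

definition eig_const :: "real \<Rightarrow> real \<Rightarrow> real \<Rightarrow> real \<Rightarrow> real" where
  "eig_const q l j \<sigma> =
     q powr (l + j) * sqrt (qbinom (q\<^sup>2) (2 * l) (nat_of (l - j))) *
     sqrt ((1 + q powr (-4 * j - 2 * \<sigma>)) / (1 + q powr (-2 * \<sigma>))) /
     sqrt (qpoch (- (q powr (2 - 2 * \<sigma>))) (q\<^sup>2) (nat_of (l - j)) *
           qpoch (- (q powr (2 + 2 * \<sigma>))) (q\<^sup>2) (nat_of (l + j)))"

definition eig_vec :: "real \<Rightarrow> real \<Rightarrow> real \<Rightarrow> real \<Rightarrow> real \<Rightarrow> complex" where
  "eig_vec q l j \<sigma> n =
     complex_of_real (eig_const q l j \<sigma>) * \<i> powi \<lfloor>n - l\<rfloor> *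
     complex_of_real
       (q powr (\<sigma> * (l - n)) * q powr (1/2 * (l - n) * (l - n - 1)) *
        sqrt (qpoch (q powr (4 * l)) (q powr (-2)) (nat_of (l - n)) /
              qpoch (q\<^sup>2) (q\<^sup>2) (nat_of (l - n))) *
        phi32 (q powr (-2 * (l - n))) (q powr (-2 * (l - j))) (- (q powr (-2 * l - 2 * j - 2 * \<sigma>)))
              (q powr (-4 * l)) 0 (q\<^sup>2) (q\<^sup>2))"

definition X_elt :: "real \<Rightarrow> (ugen \<Rightarrow> 'u::complex_algebra_1) \<Rightarrow> real \<Rightarrow> 'u" where
  "X_elt q u \<sigma> =
     (\<i> * complex_of_real (q powr (1/2))) *\<^sub>C u UB - (\<i> * complex_of_real (q powr (-1/2))) *\<^sub>C u UC
     - complex_of_real ((q powr \<sigma> - q powr (-\<sigma>)) / (q - inverse q)) *\<^sub>C (u UA - u UD)"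

definition eig_val :: "real \<Rightarrow> real \<Rightarrow> real \<Rightarrow> real" where
  "eig_val q j \<sigma> =
     (q powr (-2 * j - \<sigma>) - q powr (\<sigma> + 2 * j) + q powr \<sigma> - q powr (-\<sigma>)) / (q - inverse q)"

definition gen_matrix_elt :: "real \<Rightarrow> (ugen \<Rightarrow> 'u::complex_algebra_1) \<Rightarrow>
    (agen \<Rightarrow> 'a::complex_algebra_1) \<Rightarrow> real \<Rightarrow> real \<Rightarrow> real \<Rightarrow> real \<Rightarrow> real \<Rightarrow> 'a" where
  "gen_matrix_elt q u a l i j \<tau> \<sigma> =
     matrix_elt q u a l (eig_vec q l j \<sigma>) (eig_vec q l i \<tau>)"

end

theory Submission
  imports Defs
begin

text \<open>
  The pairing is constructed from the left action: the generators of \<open>\<U>\<close> act on \<open>\<A>\<close> by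
  automorphisms (\<open>A\<close>, \<open>D\<close>) and skew derivations (\<open>B\<close>, \<open>C\<close>), these operators satisfy the relations of
  \<open>\<U>\<close> and commute with right translations, and composing the resulting action with the counit gives
  the pairing.  Non-degeneracy follows because \<open>B\<close> acting from the left lowers the \<open>\<beta>\<close>-degree, \<open>C\<close>
  acting from the right lowers the \<open>\<gamma>\<close>-degree, and the powers of \<open>A\<close> then separate the remaining
  powers of \<open>\<alpha>\<close> and \<open>\<delta>\<close>; so \<open>C\<^sup>c A\<^sup>r B\<^sup>b\<close> detects the lowest term of an element.  The spin \<open>l\<close>
  representation is realised on the normalised monomials \<open>\<alpha>\<^sup>m \<beta>\<^sup>k\<close> with \<open>m + k = 2 l\<close>, whose
  comultiplication yields the matrix elements.  Pairing both sides with an arbitrary \<open>Y\<close> turns the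
  two claims into the eigenvector equation for the self-adjoint matrix of \<open>X\<^sub>\<sigma> A\<close>, which is the
  recurrence of the dual \<open>q\<close>-Krawtchouk polynomials.
\<close>

subsection \<open>Linear maps and presentations\<close>

text \<open>The hypotheses provide only presentations, while \<open>pairing\<close>,
  \<open>spin_rep\<close> and \<open>matrix_elt\<close> are definite descriptions: nothing can be
  said about them before existence and uniqueness are proved, and this shapes the development.
  Starting from the left action avoids checking a pairing on two presented algebras at once: an
  action is a homomorphism out of \<U> alone, and the pairing axioms follow from its compatibility
  with products and comultiplication. Non-degeneracy makes \<open>matrix_elt\<close> well defined
  and allows equalities in \<A> to be tested by pairing. The monomials in \<alpha> and \<beta> occur
  because the first legs of \<Delta>(\<alpha>) and \<Delta>(\<beta>) lie in the span of \<alpha> and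
  \<beta>: homogeneous polynomials form a comodule, and its coefficients, paired with \<U>, are
  representation matrices without any check of relations between matrices. The right-hand claim
  rests on the same recurrence as the left-hand one: self-adjointness moves the operator to the
  other vector, and the real eigenvalue survives conjugation.\<close>

lemma clinear_mapI:
  assumes "\<And>x y. f (x + y) = f x + f y" "\<And>c x. f (c *\<^sub>C x) = c *\<^sub>C f x"
  shows "clinear_map f"
  using assms by (simp add: clinear_map_def)

lemma clinear_map_add: "clinear_map f \<Longrightarrow> f (x + y) = f x + f y"
  and clinear_map_scaleC: "clinear_map f \<Longrightarrow> f (c *\<^sub>C x) = c *\<^sub>C f x"
  by (simp_all add: clinear_map_def)

lemma scaleC_minus_one: "(-1) *\<^sub>C (x :: 'a::complex_vector) = - x"
  using cvec.scale_minus_left[of 1 x] by (simp add: scaleC_one)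

lemma clinear_map_zero: "clinear_map f \<Longrightarrow> f 0 = 0"
  using clinear_map_scaleC[of f 0 0] by simp

lemma clinear_map_minus: "clinear_map f \<Longrightarrow> f (- x) = - f x"
  by (metis clinear_map_scaleC scaleC_minus_one)

lemma clinear_map_diff: "clinear_map f \<Longrightarrow> f (x - y) = f x - f y"
  using clinear_map_add[of f x "- y"] by (simp add: clinear_map_minus)

lemma clinear_map_sum: "clinear_map f \<Longrightarrow> f (sum g S) = (\<Sum>x\<in>S. f (g x))"
  by (induction S rule: infinite_finite_induct) (simp_all add: clinear_map_zero clinear_map_add)

lemmas clinear_simps = clinear_map_add clinear_map_scaleC clinear_map_zero clinear_map_minus
  clinear_map_diff clinear_map_sum

lemma clinear_map_compose: "clinear_map f \<Longrightarrow> clinear_map g \<Longrightarrow> clinear_map (\<lambda>x. f (g x))"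
  by (simp add: clinear_map_def)

lemma clinear_map_scaleC_const: "clinear_map f \<Longrightarrow> clinear_map (\<lambda>x. c *\<^sub>C f x)"
  by (simp add: clinear_map_def scaleC_add_right scaleC_scaleC mult.commute)

lemma clinear_map_plus: "clinear_map f \<Longrightarrow> clinear_map g \<Longrightarrow> clinear_map (\<lambda>x. f x + g x)"
  by (simp add: clinear_map_def scaleC_add_right algebra_simps)

lemma cbilinear_mapI:
  assumes "\<And>x. clinear_map (f x)" "\<And>y. clinear_map (\<lambda>x. f x y)"
  shows "cbilinear_map f"
  using assms by (simp add: cbilinear_map_def)

lemma calg_homD:
  assumes "calg_hom f"
  shows "clinear_map f" "f 1 = 1" "f (x * y) = f x * f y"
  using assms by (auto simp: calg_hom_def)

lemmas calg_hom_simps = calg_homD(2,3) clinear_simps[OF calg_homD(1)]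

lemma free_eval_eq_sum:
  assumes "finite S" "Poly_Mapping.keys p \<subseteq> S"
  shows "free_eval h p = (\<Sum>w\<in>S. Poly_Mapping.lookup p w *\<^sub>C prod_list (map h (letters w)))"
  unfolding free_eval_def using assms by (intro sum.mono_neutral_left) (auto simp: in_keys_iff)

lemma free_eval_single: "free_eval h (Poly_Mapping.single w c) = c *\<^sub>C prod_list (map h (letters w))"
  by (subst free_eval_eq_sum[of "{w}"]) auto

lemma clinear_free_eval: "clinear_map (free_eval (h :: 'g \<Rightarrow> 'a::complex_algebra_1))"
proof (rule clinear_mapI)
  fix p q :: "'g free_alg" and c
  let ?S = "Poly_Mapping.keys p \<union> Poly_Mapping.keys q"
  have "Poly_Mapping.keys (p + q) \<subseteq> ?S" by (rule keys_add)
  then show "free_eval h (p + q) = free_eval h p + free_eval h q"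
    by (simp add: free_eval_eq_sum[of ?S] lookup_add scaleC_add_left sum.distrib)
  have "Poly_Mapping.keys (c *\<^sub>C p) \<subseteq> Poly_Mapping.keys p"
    by (auto simp: in_keys_iff scaleC_complex_def)
  then show "free_eval h (c *\<^sub>C p) = c *\<^sub>C free_eval h p"
    by (simp add: free_eval_eq_sum[of "Poly_Mapping.keys p"] scaleC_complex_def
        cvec.scale_sum_right scaleC_scaleC)
qed

lemma free_eval_var: "free_eval h (var x) = h x"
  by (simp add: var_def free_eval_single scaleC_one)

lemma free_eval_one: "free_eval h 1 = 1"
  by (simp flip: single_one add: free_eval_single scaleC_one zero_word_def)

lemma free_eval_mult: "free_eval h (p * q) = free_eval h p * free_eval h q"
proof (induction p rule: pm_induct)
  case zero
  show ?case by (simp add: clinear_simps[OF clinear_free_eval])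
next
  case (single w c)
  show ?case
    by (induction q rule: pm_induct)
      (simp_all add: clinear_simps[OF clinear_free_eval] mult_single free_eval_single plus_word_def
        mult_scaleC_left mult_scaleC_right scaleC_scaleC distrib_left)
next
  case (add p1 p2)
  then show ?case by (simp add: clinear_simps[OF clinear_free_eval] distrib_right)
qed

lemma free_eval_power: "free_eval h (p ^ n) = free_eval h p ^ n"
  by (induction n) (simp_all add: free_eval_one free_eval_mult)

lemmas free_eval_simps = clinear_simps[OF clinear_free_eval] free_eval_one free_eval_mult
  free_eval_var free_eval_power

lemma calg_hom_comp_free_eval:
  assumes "calg_hom f"
  shows "f (free_eval g p) = free_eval (\<lambda>x. f (g x)) p"
proof -
  have "f (prod_list xs) = prod_list (map f xs)" for xs
    using assms by (induction xs) (simp_all add: calg_hom_simps)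
  then show ?thesis
    using assms by (simp add: free_eval_def calg_hom_simps comp_def)
qed

text \<open>Left multiplication by generators suffices because every element is the value of a
  linear combination of words, and a word is built letter by letter from 1. Zero is reached by
  scaling 1 by 0.\<close>

lemma presented_induct [consumes 1, case_names one gen add scale]:
  assumes "presented_by (g :: 'g \<Rightarrow> 'a::complex_algebra_1) R"
    and "P 1" and "\<And>x \<xi>. P \<xi> \<Longrightarrow> P (g x * \<xi>)"
    and "\<And>\<xi> \<eta>. P \<xi> \<Longrightarrow> P \<eta> \<Longrightarrow> P (\<xi> + \<eta>)" and "\<And>c \<xi>. P \<xi> \<Longrightarrow> P (c *\<^sub>C \<xi>)"
  shows "P \<xi>"
proof -
  obtain p where p: "\<xi> = free_eval g p"
    using assms(1) unfolding presented_by_def by (metis surjD)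
  have prod: "P (prod_list (map g ws))" for ws
    by (induction ws) (simp_all add: assms)
  show ?thesis unfolding p
  proof (induction p rule: pm_induct)
    case zero
    show ?case using assms(5)[OF assms(2), of 0] by (simp add: free_eval_simps)
  next
    case (single k v)
    show ?case by (simp add: free_eval_single assms(5) prod)
  next
    case (add p r)
    then show ?case by (simp add: free_eval_simps assms(4))
  qed
qed

text \<open>Universal property of a presentation, which gives the description in
  \<open>hom_extending\<close> a meaning: evaluation at \<open>h\<close> kills the ideal of
  relations, so it depends only on the value at \<open>g\<close>, and a homomorphism is determined
  on words.\<close>

lemma hom_extending_ex1:
  assumes pres: "presented_by (g :: 'g \<Rightarrow> 'a::complex_algebra_1) R"
    and rel: "\<And>r. r \<in> R \<Longrightarrow> free_eval (h :: 'g \<Rightarrow> 'b::complex_algebra_1) r = 0"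
  shows "\<exists>!f. calg_hom f \<and> (\<forall>x. f (g x) = h x)"
proof -
  have surj: "surj (free_eval g)" and ker: "{p. free_eval g p = 0} = free_ideal R"
    using pres by (auto simp: presented_by_def)
  have zero: "free_eval h p = 0" if "free_eval g p = 0" for p
  proof -
    have "p \<in> free_ideal R" using that ker by auto
    then show ?thesis unfolding free_ideal_def
    proof (induction rule: cvec.span_induct_alt)
      case base
      show ?case by (simp add: free_eval_simps)
    next
      case (step c x y)
      then show ?case by (auto simp: free_eval_simps rel)
    qed
  qed
  have eq: "free_eval h p = free_eval h p'" if "free_eval g p = free_eval g p'" for p p'
    using zero[of "p - p'"] that by (simp add: free_eval_simps)
  define f where "f = (\<lambda>\<xi>. free_eval h (SOME p. free_eval g p = \<xi>))"
  have f: "f (free_eval g p) = free_eval h p" for p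
    unfolding f_def by (rule eq) (rule someI[of _ p], rule refl)
  have "calg_hom f"
    unfolding calg_hom_def clinear_map_def
  proof (intro conjI allI)
    show "f 1 = 1" using f[of 1] by (simp add: free_eval_simps)
    fix x y c
    obtain p r where [simp]: "x = free_eval g p" "y = free_eval g r"
      using surj by (metis surjD)
    show "f (x + y) = f x + f y" using f[of "p + r"] by (simp add: free_eval_simps f)
    show "f (x * y) = f x * f y" using f[of "p * r"] by (simp add: free_eval_simps f)
    show "f (c *\<^sub>C x) = c *\<^sub>C f x" using f[of "c *\<^sub>C p"] by (simp add: free_eval_simps f)
  qed
  moreover have "f (g x) = h x" for x using f[of "var x"] by (simp add: free_eval_simps)
  moreover have "k = f" if "calg_hom k" "\<And>x. k (g x) = h x" for k
  proof
    fix \<xi>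
    obtain p where "\<xi> = free_eval g p" using surj by (metis surjD)
    then show "k \<xi> = f \<xi>" using calg_hom_comp_free_eval[OF that(1), of g p] that(2) f by simp
  qed
  ultimately show ?thesis by blast
qed

lemma hom_extending:
  assumes "presented_by (g :: 'g \<Rightarrow> 'a::complex_algebra_1) R"
    and "\<And>r. r \<in> R \<Longrightarrow> free_eval (h :: 'g \<Rightarrow> 'b::complex_algebra_1) r = 0"
  shows "calg_hom (hom_extending g h)" "hom_extending g h (g x) = h x"
  using theI'[OF hom_extending_ex1[of g R h]] assms unfolding hom_extending_def by auto

subsection \<open>Tensor products\<close>

lemma bilin_rels_mem:
  fixes a a' :: "'a::complex_algebra_1" and b b' :: "'b::complex_algebra_1"
  shows "psingle (a + a') b - psingle a b - psingle a' b \<in> bilin_rels"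
    and "psingle a (b + b') - psingle a b - psingle a b' \<in> bilin_rels"
    and "psingle (c *\<^sub>C a) b - c *\<^sub>C psingle a b \<in> bilin_rels"
    and "psingle a (c *\<^sub>C b) - c *\<^sub>C psingle a b \<in> bilin_rels"
  unfolding bilin_rels_def by blast+

lemma tens_bilinear:
  fixes a a' :: "'a::complex_algebra_1" and b b' :: "'b::complex_algebra_1"
  shows tens_add_left: "(a + a') \<otimes> b = a \<otimes> b + a' \<otimes> b"
    and tens_add_right: "a \<otimes> (b + b') = a \<otimes> b + a \<otimes> b'"
    and tens_scaleC_left: "(c *\<^sub>C a) \<otimes> b = c *\<^sub>C (a \<otimes> b)"
    and tens_scaleC_right: "a \<otimes> (c *\<^sub>C b) = c *\<^sub>C (a \<otimes> b)"
  by (transfer, simp only: tensor_rel_def diff_diff_eq[symmetric], rule cvec.span_base,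
      rule bilin_rels_mem)+

lemma tens_mult: "(a \<otimes> b) * (c \<otimes> d) = (a * c) \<otimes> (b * d)"
  for a c :: "'a::complex_algebra_1" and b d :: "'b::complex_algebra_1"
  by transfer (simp add: mult_single tensor_rel_def cvec.span_zero)

lemma tens_one: "1 \<otimes> 1 = (1 :: ('a::complex_algebra_1, 'b::complex_algebra_1) tensor)"
  by transfer (simp flip: single_one add: zero_pure_tensor_def tensor_rel_def cvec.span_zero)

lemma tens_zero_left [simp]: "0 \<otimes> b = (0 :: ('a::complex_algebra_1, 'b::complex_algebra_1) tensor)"
  using tens_scaleC_left[of 0 0 b] by simp

lemma tens_zero_right [simp]: "a \<otimes> 0 = (0 :: ('a::complex_algebra_1, 'b::complex_algebra_1) tensor)"
  using tens_scaleC_right[of a 0 0] by simp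

lemma pure_tens_abs: "a \<otimes> b = abs_tensor (psingle a b)"
  by (simp add: pure_tens.abs_eq)

text \<open>A scalar is absorbed into the left factor, so pure tensors and sums reach everything.
  Below, this is the standard way to compare two linear maps on a tensor product.\<close>

lemma tensor_induct [case_names pure add]:
  fixes T :: "('a::complex_algebra_1, 'b::complex_algebra_1) tensor"
  assumes "\<And>a b. P (a \<otimes> b)" and "\<And>S T. P S \<Longrightarrow> P T \<Longrightarrow> P (S + T)"
  shows "P T"
proof -
  have "P (abs_tensor p)" for p :: "('a, 'b) pure_tensor \<Rightarrow>\<^sub>0 complex"
  proof (induction p rule: pm_induct)
    case zero
    show ?case using assms(1)[of 0 0] by (simp add: zero_tensor.abs_eq)
  next
    case (single k v)
    obtain a b where "k = Pure a b" by (cases k)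
    then show ?case using assms(1)[of "v *\<^sub>C a" b]
      by (simp add: single_eq_scaleC_psingle[of a b v] scaleC_tensor.abs_eq[symmetric]
          pure_tens_abs[symmetric] tens_scaleC_left)
  next
    case (add p r)
    then show ?case using assms(2) by (simp add: plus_tensor.abs_eq[symmetric])
  qed
  then show ?thesis by (metis Quotient_tensor Quotient_def)
qed

text \<open>Universal property of the tensor product, which gives the description in
  \<open>tensor_lift\<close> a meaning: the linear extension of \<open>f\<close> to the free space
  on pairs kills the bilinearity relations and therefore descends.\<close>

lemma tensor_lift_ex1:
  fixes f :: "'a::complex_algebra_1 \<Rightarrow> 'b::complex_algebra_1 \<Rightarrow> 'c::complex_vector"
  assumes f: "cbilinear_map f"
  shows "\<exists>!F. clinear_map F \<and> (\<forall>a b. F (a \<otimes> b) = f a b)"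
proof -
  define h where "h = (\<lambda>k. case k of Pure a b \<Rightarrow> f a b)"
  define F where "F = (\<lambda>p :: ('a, 'b) pure_tensor \<Rightarrow>\<^sub>0 complex.
      \<Sum>k\<in>Poly_Mapping.keys p. Poly_Mapping.lookup p k *\<^sub>C h k)"
  have F: "F p = (\<Sum>k\<in>S. Poly_Mapping.lookup p k *\<^sub>C h k)"
    if "finite S" "Poly_Mapping.keys p \<subseteq> S" for p S
    unfolding F_def using that by (intro sum.mono_neutral_left) (auto simp: in_keys_iff)
  have lin: "clinear_map F"
  proof (rule clinear_mapI)
    fix p q :: "('a, 'b) pure_tensor \<Rightarrow>\<^sub>0 complex" and c
    let ?S = "Poly_Mapping.keys p \<union> Poly_Mapping.keys q"
    have "Poly_Mapping.keys (p + q) \<subseteq> ?S" by (rule keys_add)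
    then show "F (p + q) = F p + F q"
      by (simp add: F[of ?S] lookup_add scaleC_add_left sum.distrib)
    have "Poly_Mapping.keys (c *\<^sub>C p) \<subseteq> Poly_Mapping.keys p"
      by (auto simp: in_keys_iff scaleC_complex_def)
    then show "F (c *\<^sub>C p) = c *\<^sub>C F p"
      by (simp add: F[of "Poly_Mapping.keys p"] scaleC_complex_def cvec.scale_sum_right
          scaleC_scaleC)
  qed
  have single: "F (psingle a b) = f a b" for a b
    by (simp add: F_def h_def scaleC_one)
  have f1: "clinear_map (f x)" and f2: "clinear_map (\<lambda>x. f x y)" for x y
    using f by (auto simp: cbilinear_map_def)
  have zero: "F r = 0" if "r \<in> cvec.span bilin_rels" for r
    using that
  proof (induction rule: cvec.span_induct_alt)
    case base
    show ?case by (simp add: clinear_simps[OF lin])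
  next
    case (step c x y)
    have "F x = 0"
      using step(1) unfolding bilin_rels_def
      by (elim UnE CollectE exE conjE)
        (simp_all add: clinear_simps[OF lin] single clinear_simps[OF f1] clinear_simps[OF f2])
    then show ?case using step by (simp add: clinear_simps[OF lin])
  qed
  define G where "G = (\<lambda>T. F (rep_tensor T))"
  have G: "G (abs_tensor p) = F p" for p
  proof -
    have "tensor_rel (rep_tensor (abs_tensor p)) p"
      by (metis Quotient3_tensor rep_abs_rsp_left equivp_reflp equivp_tensor_rel)
    then show ?thesis
      using zero[of "rep_tensor (abs_tensor p) - p"]
      by (simp add: G_def tensor_rel_def clinear_simps[OF lin])
  qed
  have abs: "\<exists>p. T = abs_tensor p" for T :: "('a, 'b) tensor"
    by (metis Quotient3_tensor Quotient3_abs_rep)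
  have "clinear_map G"
  proof (rule clinear_mapI)
    fix S T :: "('a, 'b) tensor" and c
    obtain p r where [simp]: "S = abs_tensor p" "T = abs_tensor r" using abs by metis
    show "G (S + T) = G S + G T" by (simp add: plus_tensor.abs_eq G clinear_simps[OF lin])
    show "G (c *\<^sub>C S) = c *\<^sub>C G S" by (simp add: scaleC_tensor.abs_eq G clinear_simps[OF lin])
  qed
  moreover have "G (a \<otimes> b) = f a b" for a b
    by (simp add: pure_tens_abs G single)
  moreover have "H = G" if "clinear_map H" "\<And>a b. H (a \<otimes> b) = f a b" for H
  proof
    fix T
    show "H T = G T"
      by (induction T rule: tensor_induct)
        (simp_all add: that calculation clinear_simps[OF that(1)] clinear_simps[OF calculation(1)])
  qed
  ultimately show ?thesis by blast
qed

lemma clinear_tensor_lift: "cbilinear_map f \<Longrightarrow> clinear_map (tensor_lift f)"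
  and tensor_lift_tens: "cbilinear_map f \<Longrightarrow> tensor_lift f (a \<otimes> b) = f a b"
  using theI'[OF tensor_lift_ex1[of f]] unfolding tensor_lift_def by auto

lemmas tensor_lift_simps = tensor_lift_tens clinear_simps[OF clinear_tensor_lift]

subsection \<open>Auxiliary algebras\<close>

text \<open>A skew derivation \<open>d (x * y) = f x * d y + d x * g y\<close> is the off-diagonal entry of a
  homomorphism into upper triangular matrices, so skew derivations can be prescribed on
  generators.\<close>

datatype 'a utri = UT (ut11: 'a) (ut12: 'a) (ut22: 'a)

instantiation utri :: (complex_algebra_1) complex_algebra_1
begin

definition "0 = UT 0 0 0"
definition "1 = UT 1 0 1"
definition "x + y = UT (ut11 x + ut11 y) (ut12 x + ut12 y) (ut22 x + ut22 y)"
definition "x - y = UT (ut11 x - ut11 y) (ut12 x - ut12 y) (ut22 x - ut22 y)"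
definition "- x = UT (- ut11 x) (- ut12 x) (- ut22 x)"
definition "x * y = UT (ut11 x * ut11 y) (ut11 x * ut12 y + ut12 x * ut22 y) (ut22 x * ut22 y)"
definition "c *\<^sub>C x = UT (c *\<^sub>C ut11 x) (c *\<^sub>C ut12 x) (c *\<^sub>C ut22 x)"

lemmas utri_defs = zero_utri_def one_utri_def plus_utri_def minus_utri_def uminus_utri_def
  times_utri_def scaleC_utri_def

instance
  by standard
    (auto simp: utri_defs algebra_simps scaleC_add_right scaleC_add_left scaleC_scaleC scaleC_one
      mult_scaleC_left mult_scaleC_right)

end

text \<open>Endomorphisms as an algebra, so that an action of \<U> is a homomorphism that can be
  prescribed on generators. The underlying space is itself a unital algebra because the class
  demands that 0 and 1 differ.\<close>

typedef (overloaded) 'v endo = "{f :: 'v::complex_algebra_1 \<Rightarrow> 'v. clinear_map f}"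
  morphisms app Endo
  by (rule exI[of _ "\<lambda>_. 0"]) (simp add: clinear_map_def)

setup_lifting type_definition_endo

instantiation endo :: (complex_algebra_1) complex_algebra_1
begin

lift_definition zero_endo :: "'a endo" is "\<lambda>_. 0" by (simp add: clinear_map_def)
lift_definition one_endo :: "'a endo" is "\<lambda>x. x" by (simp add: clinear_map_def)
lift_definition plus_endo :: "'a endo \<Rightarrow> 'a endo \<Rightarrow> 'a endo" is "\<lambda>f g x. f x + g x"
  by (simp add: clinear_map_plus)
lift_definition minus_endo :: "'a endo \<Rightarrow> 'a endo \<Rightarrow> 'a endo" is "\<lambda>f g x. f x - g x"
  by (simp add: clinear_map_def cvec.scale_right_diff_distrib)
lift_definition uminus_endo :: "'a endo \<Rightarrow> 'a endo" is "\<lambda>f x. - f x"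
  by (simp add: clinear_map_def)
lift_definition times_endo :: "'a endo \<Rightarrow> 'a endo \<Rightarrow> 'a endo" is "\<lambda>f g x. f (g x)"
  by (simp add: clinear_map_compose)
lift_definition scaleC_endo :: "complex \<Rightarrow> 'a endo \<Rightarrow> 'a endo" is "\<lambda>c f x. c *\<^sub>C f x"
  by (simp add: clinear_map_scaleC_const)

instance
proof
  show "(0 :: 'a endo) \<noteq> 1"
    by transfer (metis zero_neq_one)
qed (transfer; simp add: fun_eq_iff algebra_simps scaleC_add_right scaleC_add_left scaleC_scaleC
      scaleC_one clinear_simps)+

end

lemma clinear_app: "clinear_map (app T)"
  using app[of T] by simp

lemmas app_simps = zero_endo.rep_eq one_endo.rep_eq plus_endo.rep_eq minus_endo.rep_eq
  uminus_endo.rep_eq times_endo.rep_eq scaleC_endo.rep_eq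

lemma presented_rel:
  assumes "presented_by g R" "r \<in> R"
  shows "free_eval g r = 0"
proof -
  have "r = 1 * r * 1" by simp
  then have "r \<in> free_ideal R"
    unfolding free_ideal_def using assms(2) by (intro cvec.span_base) blast
  then show ?thesis using assms(1) by (auto simp: presented_by_def)
qed

text \<open>Makes a two-letter rewrite rule applicable inside right-associated products.\<close>

lemma mult_left_eq: "x * y = z \<Longrightarrow> x * (y * w) = z * w" for x y z w :: "'b::semigroup_mult"
  by (simp add: mult.assoc[symmetric])

subsection \<open>The quantum group\<close>

locale quantum_SU2 =
  fixes q :: real and a :: "agen \<Rightarrow> 'a::complex_algebra_1"
  assumes q_pos: "0 < q" and q_less_1: "q < 1" and pres_A: "presented_by a (A_relations q)"
begin

abbreviation "\<alpha> \<equiv> a Alpha"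
abbreviation "\<beta> \<equiv> a Beta"
abbreviation "\<gamma> \<equiv> a Gamma"
abbreviation "\<delta> \<equiv> a Delta"

definition E :: "real \<Rightarrow> complex" where "E x = complex_of_real (q powr x)"

lemma E_0 [simp]: "E 0 = 1"
  using q_pos by (simp add: E_def)

lemma E_mult: "E x * E y = E (x + y)"
  by (simp add: E_def powr_add)

lemma E_mult_left: "E x * (E y * z) = E (x + y) * z"
  by (simp add: E_mult mult.assoc[symmetric])

lemma E_nonzero [simp]: "E x \<noteq> 0"
  using q_pos by (simp add: E_def)

lemma E_power: "E x ^ n = E (real n * x)"
  using q_pos by (simp add: E_def powr_power mult.commute flip: of_real_power)

lemma inverse_E: "inverse (E x) = E (- x)"
  by (simp add: E_def powr_minus)

lemma of_real_q: "complex_of_real q = E 1"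
  using q_pos by (simp add: E_def)

text \<open>Oriented as rewrite rules: letters are sorted into the order \<alpha>, \<beta>,
  \<gamma>, \<delta>, and adjacent \<alpha> and \<delta> are eliminated, so that \<open>A_nf\<close>
  brings short words to a common form.\<close>

lemma A_rels:
  "\<beta> * \<alpha> = E (-1) *\<^sub>C (\<alpha> * \<beta>)" "\<gamma> * \<alpha> = E (-1) *\<^sub>C (\<alpha> * \<gamma>)"
  "\<delta> * \<beta> = E (-1) *\<^sub>C (\<beta> * \<delta>)" "\<delta> * \<gamma> = E (-1) *\<^sub>C (\<gamma> * \<delta>)"
  "\<gamma> * \<beta> = \<beta> * \<gamma>" "\<alpha> * \<delta> = 1 + E 1 *\<^sub>C (\<beta> * \<gamma>)" "\<delta> * \<alpha> = 1 + E (-1) *\<^sub>C (\<beta> * \<gamma>)"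
proof -
  have "\<forall>r\<in>A_relations q. free_eval a r = 0"
    using presented_rel[OF pres_A] by blast
  then show "\<beta> * \<alpha> = E (-1) *\<^sub>C (\<alpha> * \<beta>)" "\<gamma> * \<alpha> = E (-1) *\<^sub>C (\<alpha> * \<gamma>)"
    "\<delta> * \<beta> = E (-1) *\<^sub>C (\<beta> * \<delta>)" "\<delta> * \<gamma> = E (-1) *\<^sub>C (\<gamma> * \<delta>)" "\<gamma> * \<beta> = \<beta> * \<gamma>"
    "\<alpha> * \<delta> = 1 + E 1 *\<^sub>C (\<beta> * \<gamma>)" "\<delta> * \<alpha> = 1 + E (-1) *\<^sub>C (\<beta> * \<gamma>)"
    by (simp_all add: A_relations_def Let_def free_eval_simps of_real_q inverse_E scaleC_scaleC
        E_mult scaleC_one algebra_simps)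
qed

lemmas A_nf = A_rels A_rels[THEN mult_left_eq]

lemmas lin_nf = mult_scaleC_left mult_scaleC_right scaleC_scaleC E_mult E_mult_left
  scaleC_add_right scaleC_one
  distrib_left distrib_right mult.assoc cvec.scale_right_diff_distrib

lemmas tens_nf = tens_mult tens_bilinear

lemma A_hom:
  fixes h :: "agen \<Rightarrow> 'b::complex_algebra_1"
  assumes "h Alpha * h Beta = E 1 *\<^sub>C (h Beta * h Alpha)"
    "h Alpha * h Gamma = E 1 *\<^sub>C (h Gamma * h Alpha)"
    "h Beta * h Delta = E 1 *\<^sub>C (h Delta * h Beta)"
    "h Gamma * h Delta = E 1 *\<^sub>C (h Delta * h Gamma)"
    "h Beta * h Gamma = h Gamma * h Beta"
    "h Alpha * h Delta = 1 + E 1 *\<^sub>C (h Beta * h Gamma)"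
    "h Delta * h Alpha = 1 + E (-1) *\<^sub>C (h Beta * h Gamma)"
  shows "calg_hom (hom_extending a h)" "hom_extending a h (a x) = h x"
  using assms
  by (auto intro!: hom_extending[OF pres_A]
      simp: A_relations_def Let_def free_eval_simps of_real_q inverse_E)

lemma A_induct [case_names one gen mult add scale]:
  assumes "P 1" "\<And>x. P (a x)" "\<And>\<xi> \<eta>. P \<xi> \<Longrightarrow> P \<eta> \<Longrightarrow> P (\<xi> * \<eta>)"
    "\<And>\<xi> \<eta>. P \<xi> \<Longrightarrow> P \<eta> \<Longrightarrow> P (\<xi> + \<eta>)" "\<And>c \<xi>. P \<xi> \<Longrightarrow> P (c *\<^sub>C \<xi>)"
  shows "P \<xi>"
  using pres_A by (rule presented_induct) (use assms in auto)

definition cop :: "'a \<Rightarrow> ('a, 'a) tensor" where "cop = comult_A a"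
definition cou :: "'a \<Rightarrow> complex" where "cou = counit_A a"

lemma cop_hom: "calg_hom cop"
  and cop_gen: "cop \<alpha> = \<alpha> \<otimes> \<alpha> + \<beta> \<otimes> \<gamma>" "cop \<beta> = \<alpha> \<otimes> \<beta> + \<beta> \<otimes> \<delta>"
    "cop \<gamma> = \<gamma> \<otimes> \<alpha> + \<delta> \<otimes> \<gamma>" "cop \<delta> = \<gamma> \<otimes> \<beta> + \<delta> \<otimes> \<delta>"
proof -
  define h where "h = (\<lambda>x. case x of
       Alpha \<Rightarrow> \<alpha> \<otimes> \<alpha> + \<beta> \<otimes> \<gamma>
     | Beta  \<Rightarrow> \<alpha> \<otimes> \<beta> + \<beta> \<otimes> \<delta>
     | Gamma \<Rightarrow> \<gamma> \<otimes> \<alpha> + \<delta> \<otimes> \<gamma>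
     | Delta \<Rightarrow> \<gamma> \<otimes> \<beta> + \<delta> \<otimes> \<delta>)"
  have "calg_hom (hom_extending a h)" "\<And>x. hom_extending a h (a x) = h x"
    by (rule A_hom; simp add: h_def lin_nf tens_nf A_nf tens_one ac_simps)+
  then show "calg_hom cop" "cop \<alpha> = \<alpha> \<otimes> \<alpha> + \<beta> \<otimes> \<gamma>" "cop \<beta> = \<alpha> \<otimes> \<beta> + \<beta> \<otimes> \<delta>"
    "cop \<gamma> = \<gamma> \<otimes> \<alpha> + \<delta> \<otimes> \<gamma>" "cop \<delta> = \<gamma> \<otimes> \<beta> + \<delta> \<otimes> \<delta>"
    unfolding cop_def comult_A_def h_def by simp_all
qed

lemma cou_hom: "calg_hom cou"
  and cou_gen: "cou \<alpha> = 1" "cou \<beta> = 0" "cou \<gamma> = 0" "cou \<delta> = 1"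
proof -
  define h :: "agen \<Rightarrow> complex" where "h = (\<lambda>x. case x of Alpha \<Rightarrow> 1 | Beta \<Rightarrow> 0 | Gamma \<Rightarrow> 0 | Delta \<Rightarrow> 1)"
  have "calg_hom (hom_extending a h)" "\<And>x. hom_extending a h (a x) = h x"
    by (rule A_hom; simp add: h_def)+
  then show "calg_hom cou" "cou \<alpha> = 1" "cou \<beta> = 0" "cou \<gamma> = 0" "cou \<delta> = 1"
    unfolding cou_def counit_A_def h_def by simp_all
qed

text \<open>\<open>lop x\<close> below is the left action of the generator \<open>x\<close>; it multiplies \<open>a y\<close> by \<open>q\<close> to the power
  \<open>wt y\<close> for \<open>x = A\<close> and \<open>- wt y\<close> for \<open>x = D\<close>.\<close>

definition wt :: "agen \<Rightarrow> real" where
  "wt x = (case x of Alpha \<Rightarrow> 1/2 | Beta \<Rightarrow> -1/2 | Gamma \<Rightarrow> 1/2 | Delta \<Rightarrow> -1/2)"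

text \<open>Read off from the comultiplication: among the generators B pairs nontrivially only with
  \<beta>, so B.\<beta> = \<alpha> and B.\<delta> = \<gamma>; likewise \<open>skew_C\<close> comes
  from C pairing with \<gamma> alone.\<close>

fun skew_B :: "agen \<Rightarrow> 'a" where
  "skew_B Alpha = 0" | "skew_B Beta = \<alpha>" | "skew_B Gamma = 0" | "skew_B Delta = \<gamma>"

fun skew_C :: "agen \<Rightarrow> 'a" where
  "skew_C Alpha = \<beta>" | "skew_C Beta = 0" | "skew_C Gamma = \<delta>" | "skew_C Delta = 0"

text \<open>The diagonal carries the actions of A and D, because \<Delta>(B) = A \<otimes> B + B
  \<otimes> D makes B a derivation twisted by A on one factor and by D on the other; \<Delta>(C) has
  the same shape.\<close>

definition skew_ext :: "(agen \<Rightarrow> 'a) \<Rightarrow> 'a \<Rightarrow> 'a utri" where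
  "skew_ext d = hom_extending a (\<lambda>x. UT (E (wt x) *\<^sub>C a x) (d x) (E (- wt x) *\<^sub>C a x))"

fun lop :: "ugen \<Rightarrow> 'a \<Rightarrow> 'a" where
  "lop UA \<xi> = ut11 (skew_ext skew_B \<xi>)"
| "lop UD \<xi> = ut22 (skew_ext skew_B \<xi>)"
| "lop UB \<xi> = ut12 (skew_ext skew_B \<xi>)"
| "lop UC \<xi> = ut12 (skew_ext skew_C \<xi>)"

declare lop.simps [simp del]

lemma skew_ext_B:
  "calg_hom (skew_ext skew_B)" "skew_ext skew_B (a x)
      = UT (E (wt x) *\<^sub>C a x) (skew_B x) (E (- wt x) *\<^sub>C a x)"
  unfolding skew_ext_def
  by (rule A_hom; simp add: wt_def utri_defs lin_nf A_nf ac_simps)+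

lemma skew_ext_C:
  "calg_hom (skew_ext skew_C)" "skew_ext skew_C (a x)
      = UT (E (wt x) *\<^sub>C a x) (skew_C x) (E (- wt x) *\<^sub>C a x)"
  unfolding skew_ext_def
  by (rule A_hom; simp add: wt_def utri_defs lin_nf A_nf ac_simps)+

end

section \<open>The left action of the generators of \<U> and its relations\<close>

context quantum_SU2 begin

lemma clinear_lop: "clinear_map (lop x)"
  by (cases x)
    (auto intro!: clinear_mapI simp: lop.simps calg_hom_simps[OF skew_ext_B(1)]
      calg_hom_simps[OF skew_ext_C(1)] utri_defs)

lemmas lop_linear = clinear_simps[OF clinear_lop]

text \<open>Diagonal entries multiply among themselves, whatever stands off the diagonal. Hence C is
  twisted by the very operators \<open>lop UA\<close> and \<open>lop UD\<close> that were defined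
  through B.\<close>

lemma skew_ext_C_diag:
  "ut11 (skew_ext skew_C \<xi>) = ut11 (skew_ext skew_B \<xi>)"
  "ut22 (skew_ext skew_C \<xi>) = ut22 (skew_ext skew_B \<xi>)"
  by (induction \<xi> rule: A_induct)
    (simp_all add: skew_ext_B(2) skew_ext_C(2) calg_hom_simps[OF skew_ext_B(1)]
      calg_hom_simps[OF skew_ext_C(1)] utri_defs)

lemma lop_mult:
  "lop UA (\<xi> * \<eta>) = lop UA \<xi> * lop UA \<eta>"
  "lop UD (\<xi> * \<eta>) = lop UD \<xi> * lop UD \<eta>"
  "lop UB (\<xi> * \<eta>) = lop UA \<xi> * lop UB \<eta> + lop UB \<xi> * lop UD \<eta>"
  "lop UC (\<xi> * \<eta>) = lop UA \<xi> * lop UC \<eta> + lop UC \<xi> * lop UD \<eta>"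
  by (simp_all add: lop.simps calg_hom_simps[OF skew_ext_B(1)] calg_hom_simps[OF skew_ext_C(1)]
      skew_ext_C_diag) (simp_all add: utri_defs skew_ext_C_diag)

lemma lop_one: "lop UA 1 = 1" "lop UD 1 = 1" "lop UB 1 = 0" "lop UC 1 = 0"
  by (simp_all add: lop.simps calg_hom_simps[OF skew_ext_B(1)] calg_hom_simps[OF skew_ext_C(1)]
      one_utri_def)

lemma lop_gen:
  "lop UA (a x) = E (wt x) *\<^sub>C a x" "lop UD (a x) = E (- wt x) *\<^sub>C a x"
  "lop UB (a x) = skew_B x" "lop UC (a x) = skew_C x"
  by (simp_all add: lop.simps skew_ext_B skew_ext_C)

lemmas lop_simps = lop_linear lop_mult lop_one lop_gen

lemma lop_AD: "lop UA (lop UD \<xi>) = \<xi>" and lop_DA: "lop UD (lop UA \<xi>) = \<xi>"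
  by (induction \<xi> rule: A_induct) (simp_all add: lop_simps lin_nf)

lemma lop_AB: "lop UB (lop UA \<xi>) = E (-1) *\<^sub>C lop UA (lop UB \<xi>)"
proof (induction \<xi> rule: A_induct)
  case (gen x)
  then show ?case by (cases x) (simp_all add: lop_simps lin_nf wt_def)
qed (simp_all add: lop_simps lin_nf lop_AD lop_DA mult.commute)

lemma lop_AC: "lop UC (lop UA \<xi>) = E 1 *\<^sub>C lop UA (lop UC \<xi>)"
proof (induction \<xi> rule: A_induct)
  case (gen x)
  then show ?case by (cases x) (simp_all add: lop_simps lin_nf wt_def)
qed (simp_all add: lop_simps lin_nf lop_AD lop_DA mult.commute)

lemma lop_BD: "lop UB (lop UD \<xi>) = E 1 *\<^sub>C lop UD (lop UB \<xi>)"
  using lop_AB[of "lop UD \<xi>", THEN arg_cong, of "lop UD"]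
  by (simp add: lop_AD lop_DA lop_simps scaleC_scaleC E_mult scaleC_one)

lemma lop_CD: "lop UC (lop UD \<xi>) = E (-1) *\<^sub>C lop UD (lop UC \<xi>)"
  using lop_AC[of "lop UD \<xi>", THEN arg_cong, of "lop UD"]
  by (simp add: lop_AD lop_DA lop_simps scaleC_scaleC E_mult scaleC_one)

lemma E_1_neq: "E 1 \<noteq> E (-1)"
proof -
  have "q * q < 1" using q_pos q_less_1 mult_strict_mono[of q 1 q 1] by simp
  moreover have "q * q = 1" if "E 1 = E (-1)"
  proof -
    have "q = 1 / q" using that q_pos unfolding E_def of_real_eq_iff by (simp add: powr_minus_divide)
    then show ?thesis using q_pos by (simp add: field_simps)
  qed
  ultimately show ?thesis by auto
qed

text \<open>The commutator of B and C obeys the product rule twisted by A^2 and D^2, and so does A^2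
  - D^2; the cross terms of the two orders of composition cancel by the commutation rules with A and
  D. This leaves the generators, on which A^2 - D^2 acts by q - 1/q or its negative.\<close>

lemma lop_BC:
  "lop UC (lop UB \<xi>) = lop UB (lop UC \<xi>)
     - inverse (E 1 - E (-1)) *\<^sub>C (lop UA (lop UA \<xi>) - lop UD (lop UD \<xi>))"
proof -
  define k where "k = inverse (E 1 - E (-1))"
  have "k * (E 1 - E (-1)) = 1"
    using E_1_neq unfolding k_def by simp
  then have k: "k * (E 1 - E (-1)) = 1" "k * (E (-1) - E 1) = -1"
    by (simp_all add: algebra_simps)
  show ?thesis unfolding k_def[symmetric]
  proof (induction \<xi> rule: A_induct)
    case one
    show ?case by (simp add: lop_simps)
  next
    case (gen x)
    show ?case using k
      by (cases x) (simp_all add: lop_simps lin_nf wt_def cvec.scale_left_diff_distrib[symmetric])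
  next
    case (mult \<xi> \<eta>)
    show ?case
      by (simp add: lop_simps lin_nf lop_AB lop_AC lop_BD lop_CD mult)
        (simp add: mult_scaleC_left mult_scaleC_right left_diff_distrib right_diff_distrib)
  next
    case (add \<xi> \<eta>)
    then show ?case by (simp add: lop_simps lin_nf)
  next
    case (scale c \<xi>)
    then show ?case by (simp add: lop_simps lin_nf mult.commute)
  qed
qed

section \<open>Compatibility of the left action with comultiplication and counit\<close>

definition idl :: "ugen \<Rightarrow> ('a, 'a) tensor \<Rightarrow> ('a, 'a) tensor" where
  "idl x = tensor_lift (\<lambda>\<xi> \<eta>. \<xi> \<otimes> lop x \<eta>)"

lemma cbilinear_tens: "clinear_map f \<Longrightarrow> cbilinear_map (\<lambda>\<xi> \<eta>. \<xi> \<otimes> f \<eta>)"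
  for f :: "'c::complex_algebra_1 \<Rightarrow> 'b::complex_algebra_1"
  by (auto intro!: cbilinear_mapI clinear_mapI simp: clinear_simps tens_bilinear)

lemma clinear_idl: "clinear_map (idl x)"
  and idl_tens: "idl x (\<xi> \<otimes> \<eta>) = \<xi> \<otimes> lop x \<eta>"
  unfolding idl_def
  by (simp_all add: clinear_tensor_lift tensor_lift_tens cbilinear_tens clinear_lop)

lemmas idl_simps = clinear_simps[OF clinear_idl] idl_tens

lemma idl_mult:
  "idl UA (S * T) = idl UA S * idl UA T"
  "idl UD (S * T) = idl UD S * idl UD T"
  "idl UB (S * T) = idl UA S * idl UB T + idl UB S * idl UD T"
  "idl UC (S * T) = idl UA S * idl UC T + idl UC S * idl UD T"
proof -
  have "idl UA (S * T) = idl UA S * idl UA T \<and> idl UD (S * T) = idl UD S * idl UD T \<and>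
    idl UB (S * T) = idl UA S * idl UB T + idl UB S * idl UD T \<and>
    idl UC (S * T) = idl UA S * idl UC T + idl UC S * idl UD T"
  proof (induction S rule: tensor_induct)
    case (pure x y)
    show ?case
    proof (induction T rule: tensor_induct)
      case (pure z w)
      show ?case by (simp add: idl_simps tens_mult lop_mult tens_bilinear)
    next
      case (add S T)
      then show ?case by (simp add: idl_simps distrib_left)
    qed
  next
    case (add S T)
    then show ?case by (simp add: idl_simps distrib_right)
  qed
  then show "idl UA (S * T) = idl UA S * idl UA T" "idl UD (S * T) = idl UD S * idl UD T"
    "idl UB (S * T) = idl UA S * idl UB T + idl UB S * idl UD T"
    "idl UC (S * T) = idl UA S * idl UC T + idl UC S * idl UD T" by blast+
qed

lemmas cop_simps = calg_hom_simps[OF cop_hom] cop_gen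
lemmas cou_simps = calg_hom_simps[OF cou_hom] cou_gen

lemma idl_one: "idl UA 1 = 1" "idl UD 1 = 1" "idl UB 1 = 0" "idl UC 1 = 0"
  by (simp_all add: tens_one[symmetric] idl_simps lop_one)

text \<open>Plays the role of coassociativity: both sides follow the same product rules, so
  generators decide. The induction treats all \<open>x\<close> at once since the rules for B and C
  involve A and D.\<close>

lemma cop_lop: "cop (lop x \<xi>) = idl x (cop \<xi>)"
proof -
  have "\<forall>x. cop (lop x \<xi>) = idl x (cop \<xi>)"
  proof (induction \<xi> rule: A_induct)
    case one
    show ?case
    proof
      show "cop (lop x 1) = idl x (cop 1)" for x
        by (cases x) (simp_all add: lop_simps cop_simps idl_one)
    qed
  next
    case (gen y)
    show ?case
    proof
      show "cop (lop x (a y)) = idl x (cop (a y))" for x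
        by (cases x; cases y)
          (simp_all add: lop_simps cop_simps idl_simps tens_bilinear wt_def scaleC_add_right)
    qed
  next
    case (mult \<xi> \<eta>)
    show ?case
    proof
      show "cop (lop x (\<xi> * \<eta>)) = idl x (cop (\<xi> * \<eta>))" for x
        by (cases x) (simp_all add: lop_mult cop_simps idl_mult mult)
    qed
  qed (simp_all add: lop_linear cop_simps idl_simps)
  then show ?thesis by blast
qed

lemma cbilinear_scaleC: "clinear_map f \<Longrightarrow> cbilinear_map (\<lambda>\<xi> \<eta>. f \<eta> *\<^sub>C \<xi>)"
  "clinear_map f \<Longrightarrow> cbilinear_map (\<lambda>\<xi> \<eta>. f \<xi> *\<^sub>C \<eta>)"
  for f :: "'b::complex_vector \<Rightarrow> complex"
  by (auto intro!: cbilinear_mapI clinear_mapI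
      simp: clinear_simps scaleC_add_left scaleC_add_right scaleC_scaleC scaleC_complex_def
          mult.commute)

lemmas cou_tensor_simps = tensor_lift_simps[OF cbilinear_scaleC(1)[OF calg_homD(1)[OF cou_hom]]]

lemma counit_right: "tensor_lift (\<lambda>\<xi> \<eta>. cou \<eta> *\<^sub>C \<xi>) (cop \<xi>) = \<xi>"
proof -
  let ?F = "tensor_lift (\<lambda>\<xi> \<eta>. cou \<eta> *\<^sub>C \<xi>)"
  have mult: "?F (S * T) = ?F S * ?F T" for S T :: "('a, 'a) tensor"
  proof (induction S rule: tensor_induct)
    case (pure x y)
    show ?case
      by (induction T rule: tensor_induct)
        (simp_all add: cou_tensor_simps tens_mult cou_simps lin_nf mult.commute)
  next
    case (add S T)
    then show ?case by (simp add: cou_tensor_simps distrib_right)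
  qed
  show ?thesis
  proof (induction \<xi> rule: A_induct)
    case one
    show ?case by (simp add: cop_simps tens_one[symmetric] cou_tensor_simps cou_simps scaleC_one)
  next
    case (gen x)
    show ?case by (cases x) (simp_all add: cop_simps cou_tensor_simps cou_simps scaleC_one)
  qed (simp_all add: cop_simps mult cou_tensor_simps)
qed

end

subsection \<open>The duality pairing\<close>

locale quantum_pair = quantum_SU2 q a
  for q :: real and a :: "agen \<Rightarrow> 'a::complex_algebra_1" +
  fixes u :: "ugen \<Rightarrow> 'u::complex_algebra_1"
  assumes pres_U: "presented_by u (U_relations q)"
begin

lemma U_rels:
  "u UA * u UD = 1" "u UD * u UA = 1"
  "u UB * u UA = E (-1) *\<^sub>C (u UA * u UB)" "u UC * u UA = E 1 *\<^sub>C (u UA * u UC)"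
  "u UC * u UB = u UB * u UC - inverse (E 1 - E (-1)) *\<^sub>C (u UA * u UA - u UD * u UD)"
proof -
  have "\<forall>r\<in>U_relations q. free_eval u r = 0"
    using presented_rel[OF pres_U] by blast
  then show "u UA * u UD = 1" "u UD * u UA = 1"
    "u UB * u UA = E (-1) *\<^sub>C (u UA * u UB)" "u UC * u UA = E 1 *\<^sub>C (u UA * u UC)"
    "u UC * u UB = u UB * u UC - inverse (E 1 - E (-1)) *\<^sub>C (u UA * u UA - u UD * u UD)"
    by (simp_all add: U_relations_def Let_def free_eval_simps of_real_q inverse_E scaleC_scaleC
        E_mult scaleC_one power2_eq_square algebra_simps)
qed

text \<open>Conjugate the relations with A by D, the inverse of A.\<close>

lemma U_rels_D:
  "u UB * u UD = E 1 *\<^sub>C (u UD * u UB)" "u UC * u UD = E (-1) *\<^sub>C (u UD * u UC)"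
proof -
  have "u UB = u UD * (u UA * u UB)" "u UC = u UD * (u UA * u UC)"
    by (simp_all add: U_rels(2)[THEN mult_left_eq])
  moreover have "u UA * u UB = E 1 *\<^sub>C (u UB * u UA)" "u UA * u UC = E (-1) *\<^sub>C (u UC * u UA)"
    by (simp_all add: U_rels lin_nf)
  ultimately have "u UB * u UD = u UD * (E 1 *\<^sub>C (u UB * u UA)) * u UD"
    "u UC * u UD = u UD * (E (-1) *\<^sub>C (u UC * u UA)) * u UD"
    by metis+
  then show "u UB * u UD = E 1 *\<^sub>C (u UD * u UB)" "u UC * u UD = E (-1) *\<^sub>C (u UD * u UC)"
    by (simp_all add: mult_scaleC_left mult_scaleC_right mult.assoc U_rels(1))
qed

lemmas U_nf = U_rels U_rels_D U_rels[THEN mult_left_eq] U_rels_D[THEN mult_left_eq]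

lemma U_hom:
  fixes h :: "ugen \<Rightarrow> 'b::complex_algebra_1"
  assumes "h UA * h UD = 1" "h UD * h UA = 1"
    "h UA * h UB = E 1 *\<^sub>C (h UB * h UA)" "h UA * h UC = E (-1) *\<^sub>C (h UC * h UA)"
    "h UB * h UC - h UC * h UB = inverse (E 1 - E (-1)) *\<^sub>C (h UA * h UA - h UD * h UD)"
  shows "calg_hom (hom_extending u h)" "hom_extending u h (u x) = h x"
  using assms
  by (auto intro!: hom_extending[OF pres_U]
      simp: U_relations_def Let_def free_eval_simps of_real_q inverse_E power2_eq_square)

lemmas U_induct [case_names one gen add scale] = presented_induct[OF pres_U]

definition copU :: "'u \<Rightarrow> ('u, 'u) tensor" where "copU = comult_U u"
definition couU :: "'u \<Rightarrow> complex" where "couU = counit_U u"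

lemma copU_hom: "calg_hom copU"
  and copU_gen: "copU (u UA) = u UA \<otimes> u UA" "copU (u UB) = u UA \<otimes> u UB + u UB \<otimes> u UD"
    "copU (u UC) = u UA \<otimes> u UC + u UC \<otimes> u UD" "copU (u UD) = u UD \<otimes> u UD"
proof -
  define h where "h = (\<lambda>x. case x of
       UA \<Rightarrow> u UA \<otimes> u UA
     | UB \<Rightarrow> u UA \<otimes> u UB + u UB \<otimes> u UD
     | UC \<Rightarrow> u UA \<otimes> u UC + u UC \<otimes> u UD
     | UD \<Rightarrow> u UD \<otimes> u UD)"
  have diff: "x \<otimes> (y - z) = x \<otimes> y - x \<otimes> z" "(y - z) \<otimes> x = y \<otimes> x - z \<otimes> x" for x y z :: 'u
    using tens_add_right[of x "y - z" z] tens_add_left[of "y - z" z x] by (simp_all add: algebra_simps)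
  have "calg_hom (hom_extending u h)" "\<And>x. hom_extending u h (u x) = h x"
    by (rule U_hom; simp add: h_def lin_nf tens_nf U_nf tens_one diff ac_simps)+
  then show "calg_hom copU" "copU (u UA) = u UA \<otimes> u UA"
    "copU (u UB) = u UA \<otimes> u UB + u UB \<otimes> u UD"
    "copU (u UC) = u UA \<otimes> u UC + u UC \<otimes> u UD" "copU (u UD) = u UD \<otimes> u UD"
    unfolding copU_def comult_U_def h_def by simp_all
qed

lemma couU_hom: "calg_hom couU"
  and couU_gen: "couU (u UA) = 1" "couU (u UB) = 0" "couU (u UC) = 0" "couU (u UD) = 1"
proof -
  define h :: "ugen \<Rightarrow> complex" where "h = (\<lambda>x. case x of UA \<Rightarrow> 1 | UB \<Rightarrow> 0 | UC \<Rightarrow> 0 | UD \<Rightarrow> 1)"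
  have "calg_hom (hom_extending u h)" "\<And>x. hom_extending u h (u x) = h x"
    by (rule U_hom; simp add: h_def scaleC_complex_def)+
  then show "calg_hom couU" "couU (u UA) = 1" "couU (u UB) = 0" "couU (u UC) = 0" "couU (u UD) = 1"
    unfolding couU_def counit_U_def h_def by simp_all
qed

section \<open>The action of \<U> on \<A> and the existence of the pairing\<close>

definition rho :: "'u \<Rightarrow> 'a endo" where "rho = hom_extending u (\<lambda>x. Endo (lop x))"

lemma app_Endo_lop: "app (Endo (lop x)) = lop x"
  by (simp add: Endo_inverse clinear_lop)

text \<open>Multiplication in \<open>endo\<close> is composition, so the relations to be checked are
  exactly the commutation rules of the operators \<open>lop\<close>.\<close>

lemma rho_hom: "calg_hom rho" and rho_gen: "rho (u x) = Endo (lop x)"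
proof -
  have eqI: "(\<And>\<xi>. app S \<xi> = app T \<xi>) \<Longrightarrow> S = T" for S T :: "'a endo"
    by (metis app_inject ext)
  show "calg_hom rho" "rho (u x) = Endo (lop x)"
    unfolding rho_def
    by (rule U_hom; rule eqI; simp add: app_simps app_Endo_lop lop_AD lop_DA lop_AB lop_AC lop_BC
        scaleC_scaleC E_mult scaleC_one)+
qed

text \<open>The left action \<open>X.\<xi>\<close>, available before the pairing is known to exist.\<close>

definition Lop :: "'u \<Rightarrow> 'a \<Rightarrow> 'a" where "Lop X = app (rho X)"

lemma Lop_simps:
  "Lop 1 \<xi> = \<xi>" "Lop (u x) \<xi> = lop x \<xi>" "Lop (X * Y) \<xi> = Lop X (Lop Y \<xi>)"
  "Lop (X + Y) \<xi> = Lop X \<xi> + Lop Y \<xi>" "Lop (c *\<^sub>C X) \<xi> = c *\<^sub>C Lop X \<xi>"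
  by (simp_all add: Lop_def calg_hom_simps[OF rho_hom] app_simps rho_gen app_Endo_lop)

lemma clinear_Lop: "clinear_map (Lop X)"
  unfolding Lop_def by (rule clinear_app)

lemmas Lop_linear = clinear_simps[OF clinear_Lop]

definition pr :: "'u \<Rightarrow> 'a \<Rightarrow> complex" where "pr X \<xi> = cou (Lop X \<xi>)"

lemma clinear_pr: "clinear_map (pr X)" "clinear_map (\<lambda>X. pr X \<xi>)"
  by (auto intro!: clinear_mapI simp: pr_def Lop_linear Lop_simps cou_simps)

lemmas pr_linear = clinear_simps[OF clinear_pr(1)] clinear_simps[OF clinear_pr(2)]

lemma cop_Lop: "cop (Lop X \<xi>) = tensor_lift (\<lambda>\<xi> \<eta>. \<xi> \<otimes> Lop X \<eta>) (cop \<xi>)"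
proof -
  note simps = tensor_lift_simps[OF cbilinear_tens[OF clinear_Lop]]
  show ?thesis
  proof (induction X arbitrary: \<xi> rule: U_induct)
    case one
    have "tensor_lift (\<lambda>\<xi> \<eta>. \<xi> \<otimes> Lop 1 \<eta>) T = T" for T :: "('a, 'a) tensor"
      by (induction T rule: tensor_induct; simp only: simps; simp only: Lop_simps)
    then show ?case by (simp only: Lop_simps)
  next
    case (gen x X)
    have "idl x (tensor_lift (\<lambda>\<xi> \<eta>. \<xi> \<otimes> Lop X \<eta>) T) = tensor_lift (\<lambda>\<xi> \<eta>. \<xi> \<otimes> Lop (u x * X) \<eta>) T"
      for T
      by (induction T rule: tensor_induct) (simp_all only: simps idl_simps, simp_all only: Lop_simps)
    then show ?case using gen by (simp add: Lop_simps cop_lop)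
  next
    case (add X Y)
    have "tensor_lift (\<lambda>\<xi> \<eta>. \<xi> \<otimes> Lop (X + Y) \<eta>) T =
      tensor_lift (\<lambda>\<xi> \<eta>. \<xi> \<otimes> Lop X \<eta>) T + tensor_lift (\<lambda>\<xi> \<eta>. \<xi> \<otimes> Lop Y \<eta>) T" for T :: "('a, 'a) tensor"
      by (induction T rule: tensor_induct)
          (simp_all only: simps, simp_all add: Lop_simps tens_bilinear ac_simps)
    then show ?case using add by (simp add: Lop_simps cop_simps)
  next
    case (scale c X)
    have "tensor_lift (\<lambda>\<xi> \<eta>. \<xi> \<otimes> Lop (c *\<^sub>C X) \<eta>) T =
      c *\<^sub>C tensor_lift (\<lambda>\<xi> \<eta>. \<xi> \<otimes> Lop X \<eta>) T" for T :: "('a, 'a) tensor"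
      by (induction T rule: tensor_induct)
          (simp_all only: simps, simp_all add: Lop_simps tens_bilinear scaleC_add_right)
    then show ?case using scale by (simp add: Lop_simps cop_simps)
  qed
qed

text \<open>Apply id \<otimes> \<epsilon> to \<Delta>(X.\<xi>) = (id \<otimes> X.)\<Delta>(\<xi>):
  the counit axiom restores X.\<xi> on the left, and on the right the counit after the action of X
  is \<open>pr X\<close>.\<close>

lemma Lop_eq: "Lop X \<xi> = tensor_lift (\<lambda>\<xi> \<eta>. pr X \<eta> *\<^sub>C \<xi>) (cop \<xi>)"
proof -
  have "tensor_lift (\<lambda>\<xi> \<eta>. cou \<eta> *\<^sub>C \<xi>) (tensor_lift (\<lambda>\<xi> \<eta>. \<xi> \<otimes> Lop X \<eta>) T) =
    tensor_lift (\<lambda>\<xi> \<eta>. pr X \<eta> *\<^sub>C \<xi>) T" for T :: "('a, 'a) tensor"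
    by (induction T rule: tensor_induct)
      (simp_all add: tensor_lift_simps[OF cbilinear_tens[OF clinear_Lop]] cou_tensor_simps
        tensor_lift_simps[OF cbilinear_scaleC(1)[OF clinear_pr(1)]], simp add: pr_def)
  then show ?thesis using counit_right[of "Lop X \<xi>"] by (simp add: cop_Lop)
qed

text \<open>Module algebra property: the product rules of the generators mirror their
  comultiplications, and they compose because \<open>copU\<close> is multiplicative. Its counit is
  the pairing axiom for products in \<A>.\<close>

lemma Lop_mult: "Lop X (\<xi> * \<eta>) = tensor_lift (\<lambda>X Y. Lop X \<xi> * Lop Y \<eta>) (copU X)"
proof -
  have bil: "cbilinear_map (\<lambda>X Y. Lop X \<xi> * Lop Y \<eta>)"
    by (auto intro!: cbilinear_mapI clinear_mapI simp: Lop_simps lin_nf)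
  note simps = tensor_lift_simps[OF bil] Lop_simps calg_hom_simps[OF copU_hom] Lop_linear
  show ?thesis
  proof (induction X rule: U_induct)
    case one
    show ?case by (simp add: simps tens_one[symmetric])
  next
    case (gen x X)
    let ?F = "tensor_lift (\<lambda>X Y. Lop X \<xi> * Lop Y \<eta>)"
    have "lop x (?F S) = ?F (copU (u x) * S)" for S
    proof (induction S rule: tensor_induct)
      case (pure X Y)
      show ?case
        by (cases x) (simp_all add: simps copU_gen lop_mult tens_mult distrib_right)
    next
      case (add S T)
      then show ?case by (simp add: simps lop_linear distrib_left)
    qed
    then show ?case using gen by (simp add: simps)
  qed (simp_all add: simps)
qed

lemma cbilinear_pr_pr:
  assumes "cbilinear_map p"
  shows "cbilinear_map (\<lambda>\<xi> \<eta>. p X \<xi> * p Y \<eta> :: complex)"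
    and "cbilinear_map (\<lambda>X Y. tensor_lift (\<lambda>\<xi> \<eta>. p X \<xi> * p Y \<eta>) T :: complex)"
proof -
  have p: "clinear_map (p X)" "clinear_map (\<lambda>X. p X \<xi>)" for X \<xi>
    using assms by (auto simp: cbilinear_map_def)
  note p_simps = clinear_simps[OF p(1)] clinear_simps[OF p(2)] scaleC_complex_def
  show 1: "cbilinear_map (\<lambda>\<xi> \<eta>. p X \<xi> * p Y \<eta>)" for X Y
    by (auto intro!: cbilinear_mapI clinear_mapI simp: p_simps algebra_simps)
  note simps = tensor_lift_simps[OF 1]
  have "tensor_lift (\<lambda>\<xi> \<eta>. p X \<xi> * p (Y + Z) \<eta>) T =
      tensor_lift (\<lambda>\<xi> \<eta>. p X \<xi> * p Y \<eta>) T + tensor_lift (\<lambda>\<xi> \<eta>. p X \<xi> * p Z \<eta>) T"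
    "tensor_lift (\<lambda>\<xi> \<eta>. p (Y + Z) \<xi> * p X \<eta>) T =
      tensor_lift (\<lambda>\<xi> \<eta>. p Y \<xi> * p X \<eta>) T + tensor_lift (\<lambda>\<xi> \<eta>. p Z \<xi> * p X \<eta>) T"
    "tensor_lift (\<lambda>\<xi> \<eta>. p X \<xi> * p (c *\<^sub>C Y) \<eta>) T = c *\<^sub>C tensor_lift (\<lambda>\<xi> \<eta>. p X \<xi> * p Y \<eta>) T"
    "tensor_lift (\<lambda>\<xi> \<eta>. p (c *\<^sub>C X) \<xi> * p Y \<eta>) T = c *\<^sub>C tensor_lift (\<lambda>\<xi> \<eta>. p X \<xi> * p Y \<eta>) T"
    for X Y Z c
    by (induction T rule: tensor_induct; simp add: simps; simp add: p_simps algebra_simps)+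
  then show "cbilinear_map (\<lambda>X Y. tensor_lift (\<lambda>\<xi> \<eta>. p X \<xi> * p Y \<eta>) T)"
    by (auto intro!: cbilinear_mapI clinear_mapI)
qed

lemma
  assumes "cbilinear_map p"
  shows tensor_pairing_tens: "tensor_pairing p (X \<otimes> Y) T = tensor_lift (\<lambda>\<xi> \<eta>. p X \<xi> * p Y \<eta>) T"
    and tensor_pairing_tens_tens: "tensor_pairing p (X \<otimes> Y) (\<xi> \<otimes> \<eta>) = p X \<xi> * p Y \<eta>"
    and tensor_pairing_add: "tensor_pairing p (R + S) T = tensor_pairing p R T + tensor_pairing p S T"
proof -
  show 1: "tensor_pairing p (X \<otimes> Y) T = tensor_lift (\<lambda>\<xi> \<eta>. p X \<xi> * p Y \<eta>) T" for X Y T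
    unfolding tensor_pairing_def by (rule tensor_lift_tens[OF cbilinear_pr_pr(2)[OF assms]])
  show "tensor_pairing p (X \<otimes> Y) (\<xi> \<otimes> \<eta>) = p X \<xi> * p Y \<eta>"
    by (simp add: 1 tensor_lift_tens cbilinear_pr_pr(1)[OF assms])
  show "tensor_pairing p (R + S) T = tensor_pairing p R T + tensor_pairing p S T"
    unfolding tensor_pairing_def
    by (rule clinear_map_add[OF clinear_tensor_lift[OF cbilinear_pr_pr(2)[OF assms]]])
qed

text \<open>Since XY acts as X after Y, the value at XY is that of X on Y.\<xi>, which
  \<open>Lop_eq\<close> expands.\<close>

lemma pr_mult_left: "pr (X * Y) \<xi> = tensor_lift (\<lambda>\<xi> \<eta>. pr X \<xi> * pr Y \<eta>) (cop \<xi>)"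
proof -
  have bil: "cbilinear_map pr" by (simp add: cbilinear_map_def clinear_pr)
  have "pr X (tensor_lift (\<lambda>\<xi> \<eta>. pr Y \<eta> *\<^sub>C \<xi>) T) = tensor_lift (\<lambda>\<xi> \<eta>. pr X \<xi> * pr Y \<eta>) T" for T
    by (induction T rule: tensor_induct)
      (simp_all add: tensor_lift_simps[OF cbilinear_pr_pr(1)[OF bil]]
        tensor_lift_simps[OF cbilinear_scaleC(1)[OF clinear_pr(1)]] pr_linear scaleC_complex_def)
  moreover have "pr (X * Y) \<xi> = pr X (Lop Y \<xi>)" by (simp add: pr_def Lop_simps)
  ultimately show ?thesis by (simp add: Lop_eq)
qed

lemma is_pairing_pr: "is_pairing q u a pr"
  unfolding is_pairing_def cop_def[symmetric] cou_def[symmetric] copU_def[symmetric]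
    couU_def[symmetric]
proof (intro conjI allI)
  show bil: "cbilinear_map pr" by (simp add: cbilinear_map_def clinear_pr)
  show "pr (X * Y) \<xi> = tensor_pairing pr (X \<otimes> Y) (cop \<xi>)" for X Y \<xi>
    by (simp add: tensor_pairing_tens[OF bil] pr_mult_left)
  show "pr X (\<xi> * \<eta>) = tensor_pairing pr (copU X) (\<xi> \<otimes> \<eta>)" for X \<xi> \<eta>
  proof -
    have bil2: "cbilinear_map (\<lambda>X Y. Lop X \<xi> * Lop Y \<eta>)"
      by (auto intro!: cbilinear_mapI clinear_mapI simp: Lop_simps lin_nf)
    have "cou (tensor_lift (\<lambda>X Y. Lop X \<xi> * Lop Y \<eta>) S) = tensor_pairing pr S (\<xi> \<otimes> \<eta>)" for S
    proof (induction S rule: tensor_induct)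
      case (pure X Y)
      then show ?case
        by (simp add: tensor_lift_simps[OF bil2] tensor_pairing_tens_tens[OF bil] cou_simps)
          (simp add: pr_def)
    next
      case (add S T)
      then show ?case
        by (simp add: tensor_lift_simps[OF bil2] tensor_pairing_add[OF bil] cou_simps)
    qed
    then show ?thesis by (simp add: pr_def Lop_mult)
  qed
  show "pr 1 \<xi> = cou \<xi>" for \<xi> by (simp add: pr_def Lop_simps)
  show "pr X 1 = couU X" for X
  proof -
    have "Lop X 1 = couU X *\<^sub>C 1"
    proof (induction X rule: U_induct)
      case (gen x X)
      then show ?case
        by (cases x) (simp_all add: Lop_simps lop_simps couU_gen calg_hom_simps[OF couU_hom])
    qed (simp_all add: Lop_simps calg_hom_simps[OF couU_hom] scaleC_one scaleC_add_left
        scaleC_scaleC scaleC_complex_def)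
    then show ?thesis by (simp add: pr_def cou_simps scaleC_complex_def)
  qed
  show "pr (u x) (a y) = gen_pairing q x y" for x y
    by (cases x; cases y)
      (simp_all add: pr_def Lop_simps lop_simps cou_simps wt_def scaleC_complex_def E_def)
qed

section \<open>Uniqueness of the pairing; the actions as transposes of multiplication\<close>

lemma is_pairing_unique:
  assumes "is_pairing q u a p" "is_pairing q u a p'"
  shows "p X \<xi> = p' X \<xi>"
proof -
  have facts: "cbilinear_map r" "r (X * Y) \<xi> = tensor_pairing r (X \<otimes> Y) (cop \<xi>)"
    "r X (\<xi> * \<eta>) = tensor_pairing r (copU X) (\<xi> \<otimes> \<eta>)" "r 1 \<xi> = cou \<xi>" "r X 1 = couU X"
    "r (u x) (a y) = gen_pairing q x y"
    "r (X + Y) \<xi> = r X \<xi> + r Y \<xi>" "r (c *\<^sub>C X) \<xi> = c *\<^sub>C r X \<xi>"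
    "r X (\<xi> + \<eta>) = r X \<xi> + r X \<eta>" "r X (c *\<^sub>C \<xi>) = c *\<^sub>C r X \<xi>"
    if "is_pairing q u a r" for r X Y \<xi> \<eta> x y c
    using that unfolding is_pairing_def cop_def copU_def cou_def couU_def cbilinear_map_def
        clinear_map_def
    by blast+
  note f = facts[OF assms(1)] and f' = facts[OF assms(2)]
  \<comment> \<open>Values on generators are prescribed, and the comultiplication of a generator of
    \<U> involves generators only, so the induction over \<A> closes when all \<open>x\<close> are
    treated together. The other product axiom then carries the equality to all of \<U>.\<close>
  have gen: "\<forall>x. p (u x) \<xi> = p' (u x) \<xi>" for \<xi>
  proof (induction \<xi> rule: A_induct)
    case (mult \<xi> \<eta>)
    show ?case
    proof
      show "p (u x) (\<xi> * \<eta>) = p' (u x) (\<xi> * \<eta>)" for x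
        by (cases x) (simp_all add: f(3) f'(3) copU_gen mult
            tensor_pairing_tens_tens[OF f(1)] tensor_pairing_tens_tens[OF f'(1)]
            tensor_pairing_add[OF f(1)] tensor_pairing_add[OF f'(1)])
    qed
  qed (simp_all add: f(5,6,9,10) f'(5,6,9,10))
  show ?thesis
  proof (induction X arbitrary: \<xi> rule: U_induct)
    case (gen x X)
    have "tensor_lift (\<lambda>\<xi> \<eta>. p (u x) \<xi> * p X \<eta>) T = tensor_lift (\<lambda>\<xi> \<eta>. p' (u x) \<xi> * p' X \<eta>) T" for T
      using \<open>\<And>\<xi>. p X \<xi> = p' X \<xi>\<close> \<open>\<And>\<xi>. \<forall>x. p (u x) \<xi> = p' (u x) \<xi>\<close> by simp
    then show ?case
      by (simp add: f(2) f'(2) tensor_pairing_tens[OF f(1)] tensor_pairing_tens[OF f'(1)])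
  qed (simp_all add: f(4,7,8) f'(4,7,8))
qed

lemma pairing_eq: "pairing q u a = pr"
  unfolding pairing_def
proof (rule the_equality)
  show "is_pairing q u a pr" by (rule is_pairing_pr)
  show "p = pr" if "is_pairing q u a p" for p
    using is_pairing_unique[OF that is_pairing_pr] by blast
qed

lemma pr_mult_right: "pr X (\<xi> * \<eta>) = tensor_pairing pr (copU X) (\<xi> \<otimes> \<eta>)"
  using is_pairing_pr by (simp add: is_pairing_def copU_def)

lemma act_left_eq: "act_left q u a X \<xi> = Lop X \<xi>"
  by (simp add: act_left_def pairing_eq Lop_eq cop_def)

definition Rop :: "'u \<Rightarrow> 'a \<Rightarrow> 'a" where "Rop X \<xi> = act_right q u a \<xi> X"

lemma Rop_eq: "Rop X \<xi> = tensor_lift (\<lambda>\<xi> \<eta>. pr X \<xi> *\<^sub>C \<eta>) (cop \<xi>)"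
  by (simp add: Rop_def act_right_def pairing_eq cop_def)

lemmas Rop_tensor_simps = tensor_lift_simps[OF cbilinear_scaleC(2)[OF clinear_pr(1)]]

lemma clinear_Rop: "clinear_map (Rop X)"
  by (auto intro!: clinear_mapI simp: Rop_eq cop_simps Rop_tensor_simps)

lemmas Rop_linear = clinear_simps[OF clinear_Rop]

text \<open>With \<open>pr_Rop\<close>: the left and right actions are the transposes of right and
  left multiplication in \<U>. This turns both claims of the theorem into statements about
  matrices.\<close>

lemma pr_Lop: "pr Y (Lop X \<xi>) = pr (Y * X) \<xi>"
  by (simp add: pr_def Lop_simps)

lemma pr_Rop: "pr Y (Rop X \<xi>) = pr (X * Y) \<xi>"
proof -
  have bil: "cbilinear_map pr" by (simp add: cbilinear_map_def clinear_pr)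
  have "pr Y (tensor_lift (\<lambda>\<xi> \<eta>. pr X \<xi> *\<^sub>C \<eta>) T) = tensor_lift (\<lambda>\<xi> \<eta>. pr X \<xi> * pr Y \<eta>) T" for T
    by (induction T rule: tensor_induct)
      (simp_all add: tensor_lift_simps[OF cbilinear_pr_pr(1)[OF bil]] Rop_tensor_simps pr_linear
        scaleC_complex_def)
  then show ?thesis by (simp add: Rop_eq pr_mult_left)
qed

end

subsection \<open>Non-degeneracy\<close>

text \<open>Vandermonde argument by induction: subtracting \<open>z t\<close> times the relation for
  r from the one for r + 1 removes the node \<open>t\<close> and multiplies every other coefficient
  by the nonzero \<open>z s - z t\<close>.\<close>

lemma power_sums_zero:
  fixes c z :: "'s \<Rightarrow> complex"
  assumes "finite T" "inj_on z T" "\<And>r. (\<Sum>s\<in>T. c s * z s ^ r) = 0" "s \<in> T"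
  shows "c s = 0"
  using assms
proof (induction T arbitrary: c s rule: finite_induct)
  case (insert t T)
  have T: "c s = 0" if "s \<in> T" for s
  proof -
    have "(\<Sum>s\<in>T. (c s * (z s - z t)) * z s ^ r) = 0" for r
    proof -
      have "(\<Sum>s\<in>T. (c s * (z s - z t)) * z s ^ r)
        = (\<Sum>s\<in>insert t T. (c s * (z s - z t)) * z s ^ r)"
        using insert.hyps by simp
      also have "\<dots> = (\<Sum>s\<in>insert t T. c s * z s ^ Suc r) - z t * (\<Sum>s\<in>insert t T. c s * z s ^ r)"
        by (simp only: sum_distrib_left flip: sum_subtractf) (simp add: algebra_simps)
      finally show ?thesis by (simp only: insert.prems(2)) simp
    qed
    then have "c s * (z s - z t) = 0"
      using insert.IH[of "\<lambda>s. c s * (z s - z t)"] insert.prems(1) that by auto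
    then show ?thesis using insert.prems(1) insert.hyps that by (auto simp: inj_on_def)
  qed
  then have "c t = 0" using insert.prems(2)[of 0] insert.hyps by simp
  then show ?case using T insert.prems by auto
qed simp

lemma power_mult_left: "x ^ Suc n * y = x ^ n * (x * y)" for x y :: "'a::monoid_mult"
  by (simp only: power_Suc2 mult.assoc)

section \<open>Iterated skew derivations on powers\<close>

context quantum_SU2 begin

text \<open>The q-integer in base q^(-2), as a geometric sum. With the power of q in
  \<open>kap\<close> it is the factor produced when B acts on \<beta>^n or C on \<alpha>^n; its
  positivity keeps leading coefficients from vanishing.\<close>

definition qs :: "nat \<Rightarrow> real" where "qs n = (\<Sum>i<n. q powr (- 2 * real i))"

definition kap :: "nat \<Rightarrow> real" where "kap n = q powr ((real n - 1) / 2) * qs n"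

lemma qs_pos: "n > 0 \<Longrightarrow> qs n > 0"
  unfolding qs_def using q_pos by (intro sum_pos) auto

lemma kap_pos: "n > 0 \<Longrightarrow> kap n > 0"
  using q_pos by (simp add: kap_def qs_pos)

end

text \<open>The common features of the left action of \<open>A, B, D\<close> with \<open>b = \<beta>\<close> and of the right action of
  \<open>A, C, D\<close> with \<open>b = \<gamma>\<close>.\<close>

locale skew_triple = quantum_SU2 +
  fixes LA LB LD :: "'a \<Rightarrow> 'a" and b :: 'a
  assumes lin: "clinear_map LA" "clinear_map LB" "clinear_map LD"
    and mult: "LA (\<xi> * \<eta>) = LA \<xi> * LA \<eta>" "LD (\<xi> * \<eta>) = LD \<xi> * LD \<eta>"
      "LB (\<xi> * \<eta>) = LA \<xi> * LB \<eta> + LB \<xi> * LD \<eta>"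
    and one: "LA 1 = 1" "LD 1 = 1" "LB 1 = 0"
    and b: "LA b = E (-1/2) *\<^sub>C b" "LD b = E (1/2) *\<^sub>C b" "LB b = \<alpha>"
    and LD_\<alpha>: "LD \<alpha> = E (-1/2) *\<^sub>C \<alpha>"
    and \<alpha>_b: "\<alpha> * b = E 1 *\<^sub>C (b * \<alpha>)"
begin

lemmas simps = clinear_simps[OF lin(1)] clinear_simps[OF lin(2)] clinear_simps[OF lin(3)] mult one b
    LD_\<alpha>

lemma kap_Suc: "complex_of_real (kap (Suc n)) = E (-3/2) * complex_of_real (kap n) + E (real n / 2)"
proof -
  \<comment> \<open>The lowest term of the geometric sum is split off; this is the form that peeling
    one \<open>b\<close> from the left produces in \<open>LB_b_power\<close>.\<close>
  have "(\<Sum>i<Suc n. q powr (- 2 * real i)) = 1 + q powr (-2) * (\<Sum>i<n. q powr (- 2 * real i))"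
    using q_pos unfolding sum.lessThan_Suc_shift sum_distrib_left
    by (auto simp flip: powr_add intro!: sum.cong arg_cong[of _ _ "\<lambda>x. q powr x"])
  then have "kap (Suc n) = q powr (real n / 2) * q powr (-2) * qs n
      + q powr (real n / 2)"
    by (simp add: kap_def qs_def algebra_simps)
  also have "q powr (real n / 2) * q powr (-2) = q powr (-3/2) * q powr ((real n - 1) / 2)"
  proof -
    have "real n / 2 + (-2) = -3/2 + (real n - 1) / 2" by (simp add: field_simps)
    then show ?thesis by (simp only: powr_add[symmetric])
  qed
  finally show ?thesis by (simp add: kap_def E_def)
qed

lemma LA_b_power: "LA (b ^ n) = E (- (real n / 2)) *\<^sub>C b ^ n"
  and LD_b_power: "LD (b ^ n) = E (real n / 2) *\<^sub>C b ^ n"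
  by (induction n) (simp_all add: simps lin_nf add_divide_distrib, auto intro!: arg_cong[of _ _ E])

lemma \<alpha>_b_power: "\<alpha> * b ^ n = E (real n) *\<^sub>C (b ^ n * \<alpha>)"
proof (induction n)
  case (Suc n)
  have "\<alpha> * b ^ Suc n = (\<alpha> * b) * b ^ n" by (simp add: mult.assoc)
  also have "\<dots> = E 1 *\<^sub>C (b * (\<alpha> * b ^ n))" by (simp add: \<alpha>_b lin_nf)
  also have "\<dots> = E (real (Suc n)) *\<^sub>C (b ^ Suc n * \<alpha>)" by (simp add: Suc lin_nf add.commute)
  finally show ?case .
qed (simp add: scaleC_one)

text \<open>Peel off one \<open>b\<close> with the product rule: \<open>LA\<close> contributes
  q^(-1/2) and moving \<open>b\<close> past \<alpha> another q^(-1), which together are the q^(-3/2)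
  of \<open>kap_Suc\<close>.\<close>

lemma LB_b_power: "LB (b ^ Suc n) = complex_of_real (kap (Suc n)) *\<^sub>C (\<alpha> * b ^ n)"
proof (induction n)
  case 0
  show ?case using q_pos by (simp add: kap_def qs_def simps scaleC_one)
next
  case (Suc n)
  have "b * (\<alpha> * b ^ n) = E (-1) *\<^sub>C (\<alpha> * b ^ Suc n)"
    by (simp add: lin_nf \<alpha>_b[THEN mult_left_eq])
  moreover have "LB (b ^ Suc (Suc n)) = LA b * LB (b ^ Suc n) + LB b * LD (b ^ Suc n)"
    by (subst power_Suc, subst mult(3)) simp
  ultimately have "LB (b ^ Suc (Suc n)) =
    (complex_of_real (kap (Suc n)) * (E (-1/2) * E (-1))) *\<^sub>C (\<alpha> * b ^ Suc n)
      + E (real (Suc n) / 2) *\<^sub>C (\<alpha> * b ^ Suc n)"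
    unfolding Suc b LD_b_power by (simp only: mult_scaleC_left mult_scaleC_right scaleC_scaleC
        mult.commute mult.left_commute)
  moreover have "E (-1/2) * E (-1) = E (-3/2)" by (simp add: E_mult)
  ultimately show ?case by (simp only: kap_Suc[of "Suc n"] scaleC_add_left mult.commute)
qed

text \<open>Modulo multiples of the same power of \<open>b\<close>, the operator replaces one factor
  \<open>b\<close> by \<alpha>. This single step drives both iterated statements.\<close>

lemma LB_b_power_mult:
  "\<exists>x. LB (b ^ Suc n * \<eta>) = b ^ Suc n * x
      + (complex_of_real (kap (Suc n)) * E (real n)) *\<^sub>C (b ^ n * (\<alpha> * LD \<eta>))"
proof
  have "LB (b ^ Suc n * \<eta>) = LA (b ^ Suc n) * LB \<eta> + LB (b ^ Suc n) * LD \<eta>" by (rule mult)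
  also have "\<dots> = b ^ Suc n * (E (- (real (Suc n) / 2)) *\<^sub>C LB \<eta>)
      + (complex_of_real (kap (Suc n)) * E (real n)) *\<^sub>C (b ^ n * (\<alpha> * LD \<eta>))"
    unfolding LA_b_power LB_b_power
    by (simp only: mult_scaleC_left mult_scaleC_right \<alpha>_b_power scaleC_scaleC mult.assoc)
  finally show "LB (b ^ Suc n * \<eta>) = b ^ Suc n * (E (- (real (Suc n) / 2)) *\<^sub>C LB \<eta>)
      + (complex_of_real (kap (Suc n)) * E (real n)) *\<^sub>C (b ^ n * (\<alpha> * LD \<eta>))" .
qed

lemma clinear_funpow: "clinear_map f \<Longrightarrow> clinear_map (f ^^ n)" for f :: "'c::complex_vector \<Rightarrow> 'c"
  by (induction n) (simp_all add: clinear_map_def)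

lemma LB_funpow_divisible: "\<exists>x. (LB ^^ n) (b ^ (n + m) * \<eta>) = b ^ m * x"
proof (induction n arbitrary: \<eta>)
  case (Suc n)
  obtain x where x: "LB (b ^ Suc (n + m) * \<eta>) = b ^ Suc (n + m) * x
      + (complex_of_real (kap (Suc (n + m))) * E (real (n + m))) *\<^sub>C (b ^ (n + m) * (\<alpha> * LD \<eta>))"
    using LB_b_power_mult by blast
  have "LB (b ^ Suc (n + m) * \<eta>) = b ^ (n + m) * (b * x
      + (complex_of_real (kap (Suc (n + m))) * E (real (n + m))) *\<^sub>C (\<alpha> * LD \<eta>))"
    unfolding x by (simp add: distrib_left mult_scaleC_right power_mult_left del: power_Suc)
  then show ?case using Suc by (simp add: funpow_Suc_right del: funpow.simps)
qed auto

lemma LD_funpow_\<alpha>: "(LD ^^ n) (\<alpha> * \<eta>) = E (- (real n / 2)) *\<^sub>C (\<alpha> * (LD ^^ n) \<eta>)"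
  by (induction n) (simp_all add: simps lin_nf add_divide_distrib scaleC_one, auto intro!: arg_cong[of _
      _ E])

text \<open>After \<open>n\<close> steps the part free of \<open>b\<close> is a nonzero multiple of
  \<alpha>^n times a transformed \<eta>. The constant is fixed before \<eta>, so that the induction
  hypothesis can be used at \<open>\<alpha> * LD \<eta>\<close>.\<close>

lemma LB_funpow_leading:
  "\<exists>c. c \<noteq> 0 \<and> (\<forall>\<eta>. \<exists>x. (LB ^^ n) (b ^ n * \<eta>) = c *\<^sub>C (\<alpha> ^ n * (LD ^^ n) \<eta>) + b * x)"
proof (induction n)
  case 0
  show ?case by (rule exI[of _ 1]) (auto simp: scaleC_one intro: exI[of _ 0])
next
  case (Suc n)
  then obtain c where c: "c \<noteq> 0"
    "\<And>\<eta>. \<exists>x. (LB ^^ n) (b ^ n * \<eta>) = c *\<^sub>C (\<alpha> ^ n * (LD ^^ n) \<eta>) + b * x" by blast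
  define k where "k = complex_of_real (kap (Suc n)) * E (real n)"
  have k: "k \<noteq> 0" using kap_pos[of "Suc n"] by (simp add: k_def)
  show ?case
  \<comment> \<open>\<open>k\<close> comes from the first application, \<open>c\<close> from the
    remaining \<open>n\<close>, and the power of q from moving \<alpha> out of
    \<open>LD ^^ n\<close>.\<close>
  proof (intro exI[of _ "k * c * E (- (real n / 2))"] conjI allI)
    show "k * c * E (- (real n / 2)) \<noteq> 0" using k c by simp
    fix \<eta>
    obtain x where x: "LB (b ^ Suc n * \<eta>) = b ^ Suc n * x + k *\<^sub>C (b ^ n * (\<alpha> * LD \<eta>))"
      unfolding k_def using LB_b_power_mult by blast
    obtain y where y: "(LB ^^ n) (b ^ (n + 1) * x) = b ^ 1 * y"
      using LB_funpow_divisible by blast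
    obtain z where z: "(LB ^^ n) (b ^ n * (\<alpha> * LD \<eta>)) = c *\<^sub>C (\<alpha> ^ n * (LD ^^ n) (\<alpha> * LD \<eta>)) + b * z"
      using c(2) by blast
    have "(LB ^^ Suc n) (b ^ Suc n * \<eta>) = (LB ^^ n) (LB (b ^ Suc n * \<eta>))"
      by (simp add: funpow_Suc_right del: funpow.simps)
    also have "\<dots> = b * y + k *\<^sub>C (c *\<^sub>C (\<alpha> ^ n * (LD ^^ n) (\<alpha> * LD \<eta>)) + b * z)"
      unfolding x using y z by (simp add: clinear_simps[OF clinear_funpow[OF lin(2)]])
    also have "\<dots> = (k * c * E (- (real n / 2))) *\<^sub>C (\<alpha> ^ Suc n * (LD ^^ Suc n) \<eta>)
        + b * (y + k *\<^sub>C z)"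
      by (simp add: LD_funpow_\<alpha> funpow_swap1 distrib_left scaleC_add_right mult_scaleC_right
          scaleC_scaleC power_mult_left del: power_Suc)
    finally show "\<exists>x. (LB ^^ Suc n) (b ^ Suc n * \<eta>) =
      (k * c * E (- (real n / 2))) *\<^sub>C (\<alpha> ^ Suc n * (LD ^^ Suc n) \<eta>) + b * x" by blast
  qed
qed

end

section \<open>The right action of the generators and ordered monomials\<close>

context quantum_pair begin

lemma pr_gen: "pr (u x) (a y) = cou (lop x (a y))"
  by (simp add: pr_def Lop_simps)

lemma Rop_mult:
  "Rop (u UA) (\<xi> * \<eta>) = Rop (u UA) \<xi> * Rop (u UA) \<eta>"
  "Rop (u UD) (\<xi> * \<eta>) = Rop (u UD) \<xi> * Rop (u UD) \<eta>"
  "Rop (u UC) (\<xi> * \<eta>) = Rop (u UA) \<xi> * Rop (u UC) \<eta> + Rop (u UC) \<xi> * Rop (u UD) \<eta>"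
proof -
  have bil: "cbilinear_map pr" by (simp add: cbilinear_map_def clinear_pr)
  have pr: "pr (u UA) (\<xi> * \<eta>) = pr (u UA) \<xi> * pr (u UA) \<eta>"
    "pr (u UD) (\<xi> * \<eta>) = pr (u UD) \<xi> * pr (u UD) \<eta>"
    "pr (u UC) (\<xi> * \<eta>) = pr (u UA) \<xi> * pr (u UC) \<eta> + pr (u UC) \<xi> * pr (u UD) \<eta>" for \<xi> \<eta>
    by (simp_all add: pr_mult_right copU_gen tensor_pairing_tens_tens[OF bil]
        tensor_pairing_add[OF bil])
  define F :: "'u \<Rightarrow> ('a, 'a) tensor \<Rightarrow> 'a" where
    "F X = tensor_lift (\<lambda>\<xi> \<eta>. pr X \<xi> *\<^sub>C \<eta>)" for X
  have F: "F X (\<xi> \<otimes> \<eta>) = pr X \<xi> *\<^sub>C \<eta>" "F X (S + T) = F X S + F X T" for X \<xi> \<eta> S T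
    unfolding F_def by (rule Rop_tensor_simps)+
  have R: "Rop X \<xi> = F X (cop \<xi>)" for X \<xi>
    by (simp add: Rop_eq F_def)
  have "F (u UA) (S * T) = F (u UA) S * F (u UA) T \<and> F (u UD) (S * T) = F (u UD) S * F (u UD) T \<and>
    F (u UC) (S * T) = F (u UA) S * F (u UC) T + F (u UC) S * F (u UD) T" for S T
  proof (induction S rule: tensor_induct)
    case (pure x y)
    show ?case
    proof (induction T rule: tensor_induct)
      case (pure z w)
      show ?case by (simp add: F tens_mult pr scaleC_add_left lin_nf mult.commute)
    next
      case (add S T)
      then show ?case by (simp add: F distrib_left)
    qed
  next
    case (add S T)
    then show ?case by (simp add: F distrib_right)
  qed
  then show "Rop (u UA) (\<xi> * \<eta>) = Rop (u UA) \<xi> * Rop (u UA) \<eta>"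
    "Rop (u UD) (\<xi> * \<eta>) = Rop (u UD) \<xi> * Rop (u UD) \<eta>"
    "Rop (u UC) (\<xi> * \<eta>) = Rop (u UA) \<xi> * Rop (u UC) \<eta> + Rop (u UC) \<xi> * Rop (u UD) \<eta>"
    by (simp_all add: R cop_simps)
qed

lemma Rop_gen:
  "Rop (u UA) \<alpha> = E (1/2) *\<^sub>C \<alpha>" "Rop (u UA) \<beta> = E (1/2) *\<^sub>C \<beta>"
  "Rop (u UA) \<gamma> = E (-1/2) *\<^sub>C \<gamma>" "Rop (u UA) \<delta> = E (-1/2) *\<^sub>C \<delta>"
  "Rop (u UD) \<alpha> = E (-1/2) *\<^sub>C \<alpha>" "Rop (u UD) \<beta> = E (-1/2) *\<^sub>C \<beta>"
  "Rop (u UD) \<gamma> = E (1/2) *\<^sub>C \<gamma>" "Rop (u UD) \<delta> = E (1/2) *\<^sub>C \<delta>"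
  "Rop (u UC) \<alpha> = 0" "Rop (u UC) \<beta> = 0" "Rop (u UC) \<gamma> = \<alpha>" "Rop (u UC) \<delta> = \<beta>"
  by (simp_all add: Rop_eq cop_gen Rop_tensor_simps pr_gen lop_gen wt_def cou_simps scaleC_one
      scaleC_complex_def)

lemma Rop_one: "Rop (u UA) 1 = 1" "Rop (u UD) 1 = 1" "Rop (u UC) 1 = 0"
  by (simp_all add: Rop_eq cop_simps tens_one[symmetric] Rop_tensor_simps)
    (simp_all add: pr_def Lop_simps lop_one cou_simps scaleC_one)

lemmas Rop_simps = Rop_linear Rop_mult Rop_gen Rop_one

lemma skew_left: "skew_triple q a (lop UA) (lop UB) (lop UD) \<beta>"
  by unfold_locales
    (simp_all add: clinear_lop lop_mult lop_one lop_gen wt_def A_rels lin_nf)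

lemma skew_right: "skew_triple q a (Rop (u UA)) (Rop (u UC)) (Rop (u UD)) \<gamma>"
  by unfold_locales
    (simp_all add: clinear_Rop Rop_simps A_rels lin_nf)

text \<open>Adjacent \<alpha> and \<delta> reduce to polynomials in \<beta>\<gamma>, so one integer
  exponent records both: negative values stand for powers of \<delta>. A triple in
  \<open>mon\<close> lists the degree in \<beta>, the degree in \<gamma> and this exponent.\<close>

definition alz :: "int \<Rightarrow> 'a" where
  "alz s = (if 0 \<le> s then \<alpha> ^ nat s else \<delta> ^ nat (- s))"

definition mon :: "nat \<times> nat \<times> int \<Rightarrow> 'a" where
  "mon t = (case t of (b, c, s) \<Rightarrow> \<beta> ^ b * (\<gamma> ^ c * alz s))"

lemma alz_cases:
  obtains k where "s = int k" "alz s = \<alpha> ^ k" | k where "s = - int (Suc k)" "alz s = \<delta> ^ Suc k"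
proof (cases "0 \<le> s")
  case True
  then show ?thesis using that(1)[of "nat s"] by (simp add: alz_def)
next
  case False
  then show ?thesis using that(2)[of "nat (- s) - 1"]
      by (simp add: alz_def Suc_nat_eq_nat_zadd1 Suc_diff_Suc)
qed

text \<open>The second alternative arises when \<alpha> meets a power of \<delta>; its extra term
  only gains one \<beta> and one \<gamma>, so it is again of ordered form.\<close>

lemma \<alpha>_alz: "\<alpha> * alz s = alz (s + 1) \<or> \<alpha> * alz s = alz (s + 1) + E 1 *\<^sub>C (\<beta> * (\<gamma> * alz (s + 1)))"
proof (cases rule: alz_cases[of s])
  case (1 k)
  then show ?thesis by (simp add: alz_def nat_add_distrib)
next
  case (2 k)
  have "alz (s + 1) = \<delta> ^ k" using 2(1) by (auto simp: alz_def)
  then show ?thesis using 2 by (simp add: A_nf distrib_right mult_scaleC_left mult.assoc)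
qed

lemma \<delta>_alz: "\<delta> * alz s = alz (s - 1) \<or> \<delta> * alz s = alz (s - 1) + E (-1) *\<^sub>C (\<beta> * (\<gamma> * alz (s - 1)))"
proof (cases rule: alz_cases[of s])
  case (1 k)
  show ?thesis
  proof (cases k)
    case 0
    then show ?thesis using 1 by (simp add: alz_def)
  next
    case (Suc m)
    then have "alz (s - 1) = \<alpha> ^ m" "alz s = \<alpha> * \<alpha> ^ m" using 1 by (auto simp: alz_def)
    then show ?thesis by (simp add: A_nf distrib_right mult_scaleC_left mult.assoc)
  qed
next
  case (2 k)
  then have "alz (s - 1) = \<delta> ^ Suc (Suc k)" by (auto simp: alz_def nat_add_distrib)
  then show ?thesis using 2 by simp
qed

lemma commute_power: "x * y = z *\<^sub>C (y * x) \<Longrightarrow> x * y ^ n = (z ^ n) *\<^sub>C (y ^ n * x)" for x y :: 'a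
proof (induction n)
  case (Suc n)
  have "x * y ^ Suc n = (x * y) * y ^ n" by (simp add: mult.assoc)
  also have "\<dots> = z *\<^sub>C (y * (x * y ^ n))" by (simp add: Suc.prems mult_scaleC_left mult.assoc)
  also have "\<dots> = (z ^ Suc n) *\<^sub>C (y ^ Suc n * x)"
    by (simp add: Suc mult_scaleC_right scaleC_scaleC mult.assoc)
  finally show ?case .
qed (simp add: scaleC_one)

text \<open>The span contains 1 and is stable under left multiplication by generators: \<alpha> and
  \<delta> pass \<beta>^b \<gamma>^c at the cost of a scalar and are then absorbed by
  \<open>\<alpha>_alz\<close> and \<open>\<delta>_alz\<close>.\<close>

lemma mon_span: "\<xi> \<in> cvec.span (range mon)"
proof -
  have mon: "\<beta> ^ b * (\<gamma> ^ c * alz s) \<in> cvec.span (range mon)" for b c s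
    by (rule cvec.span_base) (auto simp: mon_def image_iff intro!: exI[of _ "(b, c, s)"])
  have \<alpha>: "\<alpha> * (\<beta> ^ b * (\<gamma> ^ c * x)) = (E 1 ^ b * E 1 ^ c) *\<^sub>C (\<beta> ^ b * (\<gamma> ^ c * (\<alpha> * x)))" for b c x
  proof -
    have "\<alpha> * \<beta> ^ b = E 1 ^ b *\<^sub>C (\<beta> ^ b * \<alpha>)" "\<alpha> * \<gamma> ^ c = E 1 ^ c *\<^sub>C (\<gamma> ^ c * \<alpha>)"
      by (rule commute_power; simp add: A_rels lin_nf)+
    from this[THEN mult_left_eq] show ?thesis
      by (simp add: mult_scaleC_left mult_scaleC_right scaleC_scaleC mult.assoc)
  qed
  have \<delta>: "\<delta> * (\<beta> ^ b * (\<gamma> ^ c * x)) = (E (-1) ^ b * E (-1) ^ c) *\<^sub>C (\<beta> ^ b * (\<gamma> ^ c * (\<delta> * x)))"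
      for b c x
  proof -
    have "\<delta> * \<beta> ^ b = E (-1) ^ b *\<^sub>C (\<beta> ^ b * \<delta>)" "\<delta> * \<gamma> ^ c = E (-1) ^ c *\<^sub>C (\<gamma> ^ c * \<delta>)"
      by (rule commute_power; simp add: A_rels lin_nf)+
    from this[THEN mult_left_eq] show ?thesis
      by (simp add: mult_scaleC_left mult_scaleC_right scaleC_scaleC mult.assoc)
  qed
  have \<gamma>\<beta>: "\<gamma> * (\<beta> ^ b * x) = \<beta> ^ b * (\<gamma> * x)" for b x
    using commute_power[of \<gamma> \<beta> 1 b] by (simp add: A_rels scaleC_one mult.assoc[symmetric])
  have \<gamma>\<beta>': "\<gamma> ^ c * (\<beta> * x) = \<beta> * (\<gamma> ^ c * x)" for c x
    using commute_power[of \<beta> \<gamma> 1 c] by (simp add: A_rels scaleC_one mult.assoc[symmetric])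
  have gen: "a x * (\<beta> ^ b * (\<gamma> ^ c * alz s)) \<in> cvec.span (range mon)" for x b c s
  proof -
    have bg: "\<beta> ^ b * (\<gamma> ^ c * (\<beta> * (\<gamma> * alz s))) \<in> cvec.span (range mon)" for s
      using mon[of "Suc b" "Suc c" s] by (simp add: \<gamma>\<beta>' power_mult_left del: power_Suc)
    show ?thesis
    proof (cases x)
      case Alpha
      show ?thesis using \<alpha>_alz[of s] bg mon unfolding Alpha \<alpha>
        by (auto simp: distrib_left mult_scaleC_right intro!: cvec.span_scale cvec.span_add)
    next
      case Beta
      show ?thesis using mon[of "Suc b" c s] by (simp add: Beta mult.assoc)
    next
      case Gamma
      show ?thesis using mon[of b "Suc c" s] by (simp add: Gamma \<gamma>\<beta> mult.assoc)
    next
      case Delta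
      show ?thesis using \<delta>_alz[of s] bg mon unfolding Delta \<delta>
        by (auto simp: distrib_left mult_scaleC_right intro!: cvec.span_scale cvec.span_add)
    qed
  qed
  have closed: "a x * \<xi> \<in> cvec.span (range mon)" if "\<xi> \<in> cvec.span (range mon)" for x \<xi>
    using that
  proof (induction rule: cvec.span_induct_alt)
    case base
    show ?case by (simp add: cvec.span_zero)
  next
    case (step c y z)
    then show ?case using gen
      by (auto simp: mon_def distrib_left mult_scaleC_right intro!: cvec.span_scale cvec.span_add
          split: prod.splits)
  qed
  show ?thesis
  proof (rule presented_induct[OF pres_A, of "\<lambda>\<xi>. \<xi> \<in> cvec.span (range mon)"])
    show "1 \<in> cvec.span (range mon)" using mon[of 0 0 0] by (simp add: alz_def)
  qed (simp_all add: closed cvec.span_add cvec.span_scale)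
qed

end

text \<open>Eigenvectors with nonzero eigenvalue. What matters below is that leading coefficients do
  not vanish, so the exact powers of q produced by D stay hidden.\<close>

definition scales :: "('c::complex_vector \<Rightarrow> 'c) \<Rightarrow> 'c \<Rightarrow> bool" where
  "scales f \<xi> \<longleftrightarrow> (\<exists>z. z \<noteq> 0 \<and> f \<xi> = z *\<^sub>C \<xi>)"

lemma scales_mult:
  fixes f :: "'c::complex_algebra_1 \<Rightarrow> 'c"
  assumes "\<And>\<xi> \<eta>. f (\<xi> * \<eta>) = f \<xi> * f \<eta>" "scales f \<xi>" "scales f \<eta>"
  shows "scales f (\<xi> * \<eta>)"
  using assms unfolding scales_def
  by (metis mult_scaleC_left mult_scaleC_right scaleC_scaleC mult_eq_0_iff)

lemma scales_power:
  fixes f :: "'c::complex_algebra_1 \<Rightarrow> 'c"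
  assumes "\<And>\<xi> \<eta>. f (\<xi> * \<eta>) = f \<xi> * f \<eta>" "f 1 = 1" "scales f \<xi>"
  shows "scales f (\<xi> ^ n)"
proof (induction n)
  case 0
  show ?case using assms(2) by (auto simp: scales_def scaleC_one intro!: exI[of _ 1])
next
  case (Suc n)
  then show ?case using scales_mult[of f, OF assms(1,3)] by simp
qed

lemma scales_funpow: "clinear_map f \<Longrightarrow> scales f \<xi> \<Longrightarrow> scales (f ^^ n) \<xi>"
proof (induction n)
  case 0
  show ?case by (auto simp: scales_def scaleC_one intro!: exI[of _ 1])
next
  case (Suc n)
  then obtain z y where "z \<noteq> 0" "y \<noteq> 0" "f \<xi> = z *\<^sub>C \<xi>" "(f ^^ n) \<xi> = y *\<^sub>C \<xi>"
    by (auto simp: scales_def)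
  then have "(f ^^ Suc n) \<xi> = (y * z) *\<^sub>C \<xi>"
    using Suc.prems(1) by (simp add: clinear_map_scaleC scaleC_scaleC)
  then show ?case using \<open>z \<noteq> 0\<close> \<open>y \<noteq> 0\<close> unfolding scales_def by (intro exI[of _ "y * z"]) simp
qed

section \<open>Functionals detecting monomials, and non-degeneracy\<close>

context quantum_pair begin

lemma lop_scales: "scales (lop UD) (a x)"
  unfolding scales_def by (intro exI[of _ "E (- wt x)"]) (simp add: lop_gen)

lemma Rop_scales: "scales (Rop (u UD)) (a x)"
proof (cases x)
  case Alpha then show ?thesis by (auto simp: scales_def Rop_gen intro!: exI[of _ "E (-1/2)"])
next
  case Beta then show ?thesis by (auto simp: scales_def Rop_gen intro!: exI[of _ "E (-1/2)"])
next
  case Gamma then show ?thesis by (auto simp: scales_def Rop_gen intro!: exI[of _ "E (1/2)"])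
next
  case Delta then show ?thesis by (auto simp: scales_def Rop_gen intro!: exI[of _ "E (1/2)"])
qed

lemma scales_alz: "scales (lop UD) (alz s)" "scales (Rop (u UD)) (alz s)"
  by (auto simp: alz_def intro!: scales_power lop_mult lop_one lop_scales Rop_mult Rop_one Rop_scales)

lemma Lop_power: "Lop (u x ^ n) \<xi> = (lop x ^^ n) \<xi>"
  by (induction n) (simp_all add: Lop_simps)

lemma pr_lop_funpow: "pr Y ((lop x ^^ n) \<xi>) = pr (Y * u x ^ n) \<xi>"
proof (induction n arbitrary: Y)
  case (Suc n)
  have "pr Y ((lop x ^^ Suc n) \<xi>) = pr (Y * u x) ((lop x ^^ n) \<xi>)"
    by (simp add: pr_Lop[of Y "u x", unfolded Lop_simps])
  then show ?case by (simp add: Suc mult.assoc)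
qed simp

lemma pr_Rop_funpow: "pr Y ((Rop (u x) ^^ n) \<xi>) = pr (u x ^ n * Y) \<xi>"
proof (induction n arbitrary: Y)
  case (Suc n)
  have "pr Y ((Rop (u x) ^^ Suc n) \<xi>) = pr (u x * Y) ((Rop (u x) ^^ n) \<xi>)"
    by (simp add: pr_Rop)
  then show ?case by (simp only: Suc power_mult_left)
qed simp

lemma pr_A_power_mult: "pr (u UA ^ r) (\<xi> * \<eta>) = pr (u UA ^ r) \<xi> * pr (u UA ^ r) \<eta>"
proof -
  have "(lop UA ^^ r) (\<xi> * \<eta>) = (lop UA ^^ r) \<xi> * (lop UA ^^ r) \<eta>"
    by (induction r) (simp_all add: lop_mult)
  then show ?thesis
    by (simp add: pr_def Lop_power cou_simps)
qed

lemma pr_A_power_gen: "pr (u UA ^ r) (a x) = E (wt x) ^ r * cou (a x)"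
proof -
  have "(lop UA ^^ r) (a x) = E (wt x) ^ r *\<^sub>C a x"
    by (induction r) (simp_all add: lop_gen lop_linear scaleC_one scaleC_scaleC mult.commute)
  then show ?thesis
    by (simp add: pr_def Lop_power cou_simps scaleC_complex_def)
qed

lemma pr_A_power_power: "pr (u UA ^ r) (\<xi> ^ n) = pr (u UA ^ r) \<xi> ^ n"
proof (induction n)
  case 0
  have "(lop UA ^^ r) 1 = 1" by (induction r) (simp_all add: lop_one)
  then show ?case by (simp add: pr_def Lop_power cou_simps)
qed (simp add: pr_A_power_mult)

lemma pr_A_power_vanish: "pr (u UA ^ r) (\<beta> * \<xi>) = 0" "pr (u UA ^ r) (\<gamma> * \<xi>) = 0"
  by (simp_all add: pr_A_power_mult pr_A_power_gen cou_gen)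

lemma pr_A_power_alz: "pr (u UA ^ r) (alz s) = E (real_of_int s / 2) ^ r"
proof (cases rule: alz_cases[of s])
  case (1 k)
  then show ?thesis
    by (simp add: pr_A_power_power pr_A_power_gen wt_def cou_gen E_power power_mult_distrib flip:
        power_mult)
      (simp add: mult.commute)
next
  case (2 k)
  have s: "real_of_int s = - (real k + 1)" using 2(1) by simp
  show ?thesis
    unfolding 2(2) s by (simp add: pr_A_power_power pr_A_power_gen wt_def cou_gen E_power field_simps
       del: power_Suc flip: power_mult) (auto intro!: arg_cong[of _ _ E] simp: field_simps)
qed

text \<open>Written through the two actions rather than as one pairing value, so that \<beta> can be
  lowered first and \<gamma> afterwards; \<open>detect_eq\<close> gives the element of \<U> behind
  it.\<close>

definition detect :: "nat \<Rightarrow> nat \<Rightarrow> nat \<Rightarrow> 'a \<Rightarrow> complex" where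
  "detect b c r \<xi> = pr (u UA ^ r) ((Rop (u UC) ^^ c) ((lop UB ^^ b) \<xi>))"

lemma detect_eq: "detect b c r \<xi> = pr (u UC ^ c * u UA ^ r * u UB ^ b) \<xi>"
  by (simp add: detect_def pr_Rop_funpow pr_lop_funpow)

text \<open>C acting from the right annihilates \<beta>, and A only scales it. Remainders divisible
  by \<beta> therefore stay so through the second stage and die under the powers of A.\<close>

lemma Rop_C_funpow_\<beta>: "\<exists>y. (Rop (u UC) ^^ c) (\<beta> * x) = \<beta> * y"
proof (induction c)
  case (Suc c)
  then obtain y where "(Rop (u UC) ^^ c) (\<beta> * x) = \<beta> * y" by blast
  then have "(Rop (u UC) ^^ Suc c) (\<beta> * x) = \<beta> * (E (1/2) *\<^sub>C Rop (u UC) y)"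
    by (simp add: Rop_simps mult_scaleC_left mult_scaleC_right)
  then show ?case by blast
qed auto

lemma detect_\<beta>_high: "b0 < b \<Longrightarrow> detect b0 c r (\<beta> ^ b * \<eta>) = 0"
proof -
  assume "b0 < b"
  then obtain m where m: "b = b0 + Suc m" using less_imp_Suc_add by auto
  obtain x where "(lop UB ^^ b0) (\<beta> ^ b * \<eta>) = \<beta> ^ Suc m * x"
    using skew_triple.LB_funpow_divisible[OF skew_left] m by blast
  then have "(lop UB ^^ b0) (\<beta> ^ b * \<eta>) = \<beta> * (\<beta> ^ m * x)" by (simp add: mult.assoc)
  then show ?thesis
    using Rop_C_funpow_\<beta>[of c "\<beta> ^ m * x"] by (auto simp: detect_def pr_A_power_vanish)
qed

lemma clinear_detect: "clinear_map (detect b c r)"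
  unfolding detect_eq[abs_def] by (rule clinear_pr)

lemma \<alpha>_\<gamma>_power: "\<alpha> ^ n * \<gamma> ^ c = E (real n * real c) *\<^sub>C (\<gamma> ^ c * \<alpha> ^ n)"
proof (induction n)
  case (Suc n)
  have "\<alpha> ^ Suc n * \<gamma> ^ c = \<alpha> * (\<alpha> ^ n * \<gamma> ^ c)" by (simp add: mult.assoc)
  also have "\<dots> = E (real n * real c) *\<^sub>C ((\<alpha> * \<gamma> ^ c) * \<alpha> ^ n)"
    by (simp add: Suc mult_scaleC_right mult.assoc)
  also have "\<dots> = E (real (Suc n) * real c) *\<^sub>C (\<gamma> ^ c * \<alpha> ^ Suc n)"
    by (simp add: skew_triple.\<alpha>_b_power[OF skew_right] mult_scaleC_left scaleC_scaleC E_mult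
        mult.assoc algebra_simps)
  finally show ?case .
qed (simp add: scaleC_one)

text \<open>Since \<open>lop UB\<close> lowers the \<open>\<beta>\<close>-degree and the right action of \<open>C\<close> lowers the \<open>\<gamma>\<close>-degree, modulo
  terms divisible by \<open>\<beta>\<close> or \<open>\<gamma>\<close>, only monomials of the exact degrees are detected.\<close>

lemma detect_leading:
  "\<exists>k. k \<noteq> 0 \<and> (\<forall>r. detect b0 c0 r (\<beta> ^ b0 * (\<gamma> ^ c * alz s)) =
     k * pr (u UA ^ r) ((Rop (u UC) ^^ c0) (\<gamma> ^ c * (\<alpha> ^ b0 * alz s))))"
proof -
  obtain k where k: "k \<noteq> 0"
    "\<exists>x. (lop UB ^^ b0) (\<beta> ^ b0 * (\<gamma> ^ c * alz s))
      = k *\<^sub>C (\<alpha> ^ b0 * (lop UD ^^ b0) (\<gamma> ^ c * alz s)) + \<beta> * x"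
    using skew_triple.LB_funpow_leading[OF skew_left, of b0] by blast
  have "scales (lop UD ^^ b0) (\<gamma> ^ c * alz s)"
    by (intro scales_funpow clinear_lop scales_mult scales_alz scales_power lop_scales lop_mult lop_one)
  then obtain z where z: "z \<noteq> 0" "(lop UD ^^ b0) (\<gamma> ^ c * alz s) = z *\<^sub>C (\<gamma> ^ c * alz s)"
    by (auto simp: scales_def)
  obtain x where x: "(lop UB ^^ b0) (\<beta> ^ b0 * (\<gamma> ^ c * alz s))
      = (k * z * E (real b0 * real c)) *\<^sub>C (\<gamma> ^ c * (\<alpha> ^ b0 * alz s)) + \<beta> * x"
    using k(2) by (auto simp: z mult_scaleC_right mult_scaleC_left scaleC_scaleC
        \<alpha>_\<gamma>_power[THEN mult_left_eq] mult.assoc)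
  have lin: "clinear_map (Rop (u UC) ^^ c0)"
    by (rule skew_triple.clinear_funpow[OF skew_right clinear_Rop])
  obtain y where "(Rop (u UC) ^^ c0) (\<beta> * x) = \<beta> * y" using Rop_C_funpow_\<beta> by blast
  then have "detect b0 c0 r (\<beta> ^ b0 * (\<gamma> ^ c * alz s)) = (k * z * E (real b0 * real c)) *
      pr (u UA ^ r) ((Rop (u UC) ^^ c0) (\<gamma> ^ c * (\<alpha> ^ b0 * alz s)))" for r
    by (simp add: detect_def x clinear_simps[OF lin] pr_linear pr_A_power_vanish scaleC_complex_def)
  then show ?thesis using k z by (intro exI[of _ "k * z * E (real b0 * real c)"]) simp
qed

lemma detect_\<gamma>_high: "c0 < c \<Longrightarrow> detect b0 c0 r (\<beta> ^ b0 * (\<gamma> ^ c * alz s)) = 0"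
proof -
  assume "c0 < c"
  then obtain m where m: "c = c0 + Suc m" using less_imp_Suc_add by auto
  obtain x where "(Rop (u UC) ^^ c0) (\<gamma> ^ c * (\<alpha> ^ b0 * alz s)) = \<gamma> ^ Suc m * x"
    using skew_triple.LB_funpow_divisible[OF skew_right] m by blast
  then have "(Rop (u UC) ^^ c0) (\<gamma> ^ c * (\<alpha> ^ b0 * alz s)) = \<gamma> * (\<gamma> ^ m * x)"
    by (simp add: mult.assoc)
  then show ?thesis
    using detect_leading[of b0 c0 c s] by (auto simp: pr_A_power_vanish)
qed

text \<open>On its own degrees a monomial yields, as a function of \<open>r\<close>, a geometric
  progression whose ratio identifies the exponent \<open>s\<close>. The constant is independent of
  \<open>r\<close>, as the Vandermonde argument requires.\<close>

lemma detect_mon: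
  "\<exists>k. k \<noteq> 0 \<and> (\<forall>r. detect b c r (\<beta> ^ b * (\<gamma> ^ c * alz s))
      = k * E (real b / 2 + real c / 2 + real_of_int s / 2) ^ r)"
proof -
  obtain k where k: "k \<noteq> 0" "\<And>r. detect b c r (\<beta> ^ b * (\<gamma> ^ c * alz s)) =
     k * pr (u UA ^ r) ((Rop (u UC) ^^ c) (\<gamma> ^ c * (\<alpha> ^ b * alz s)))"
    using detect_leading by blast
  obtain k' x where k': "k' \<noteq> 0" "(Rop (u UC) ^^ c) (\<gamma> ^ c * (\<alpha> ^ b * alz s))
      = k' *\<^sub>C (\<alpha> ^ c * (Rop (u UD) ^^ c) (\<alpha> ^ b * alz s)) + \<gamma> * x"
    using skew_triple.LB_funpow_leading[OF skew_right, of c] by blast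
  have "scales (Rop (u UD) ^^ c) (\<alpha> ^ b * alz s)"
    by (intro scales_funpow clinear_Rop scales_mult scales_alz scales_power Rop_scales Rop_mult Rop_one)
  then obtain z where z: "z \<noteq> 0" "(Rop (u UD) ^^ c) (\<alpha> ^ b * alz s) = z *\<^sub>C (\<alpha> ^ b * alz s)"
    by (auto simp: scales_def)
  have \<alpha>: "pr (u UA ^ r) (\<alpha> ^ n) = E (real n / 2) ^ r" for n r
    using pr_A_power_alz[of r "int n"] by (simp add: alz_def)
  have "detect b c r (\<beta> ^ b * (\<gamma> ^ c * alz s))
      = (k * k' * z) * E (real b / 2 + real c / 2 + real_of_int s / 2) ^ r" for r
    by (simp add: k k' z pr_linear pr_A_power_vanish pr_A_power_mult pr_A_power_gen cou_gen
        pr_A_power_alz \<alpha> scaleC_complex_def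
        E_mult[symmetric] power_mult_distrib mult_scaleC_right)
  then show ?thesis using k(1) k'(1) z(1) by (intro exI[of _ "k * k' * z"]) simp
qed

lemma E_inj: "E x = E y \<longleftrightarrow> x = y"
  using q_pos q_less_1 by (simp add: E_def powr_inj)

theorem pairing_nondegenerate:
  assumes "\<And>X. pr X \<xi> = 0"
  shows "\<xi> = 0"
proof (rule ccontr)
  assume "\<xi> \<noteq> 0"
  obtain f where f: "finite {v. f v \<noteq> 0}" "\<And>v. f v \<noteq> 0 \<Longrightarrow> v \<in> range mon"
    and \<xi>: "\<xi> = (\<Sum>v | f v \<noteq> 0. f v *\<^sub>C v)"
    using mon_span[of \<xi>] unfolding cvec.span_explicit' by blast
  \<comment> \<open>One index triple is chosen for each vector of the expansion, so distinct indices
    carry distinct monomials.\<close>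
  define S where "S = inv_into UNIV mon ` {v. f v \<noteq> 0}"
  have fin: "finite S" using f(1) by (simp add: S_def)
  have inj: "inj_on (inv_into UNIV mon) {v. f v \<noteq> 0}"
    using f(2) by (intro inj_on_inv_into) auto
  have nz: "f (mon t) \<noteq> 0" if "t \<in> S" for t
    using that f(2) by (auto simp: S_def f_inv_into_f)
  have \<xi>S: "\<xi> = (\<Sum>t\<in>S. f (mon t) *\<^sub>C mon t)"
    unfolding \<xi> S_def sum.reindex[OF inj] comp_def
    by (rule sum.cong) (use f(2) in \<open>auto simp: f_inv_into_f\<close>)
  then have "S \<noteq> {}" using \<open>\<xi> \<noteq> 0\<close> by auto
  \<comment> \<open>The lexicographically least pair of degrees is sought: terms with a larger
    degree in \<beta>, or the same one and a larger degree in \<gamma>, are invisible to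
    \<open>detect b0 c0\<close>.\<close>
  define b0 where "b0 = (LEAST b. \<exists>c s. (b, c, s) \<in> S)"
  have b0: "\<exists>c s. (b0, c, s) \<in> S"
    unfolding b0_def by (rule LeastI_ex) (use \<open>S \<noteq> {}\<close> in \<open>auto simp: ex_in_conv[symmetric]\<close>)
  have b0_le: "b0 \<le> b" if "(b, c, s) \<in> S" for b c s
    unfolding b0_def by (rule Least_le) (use that in blast)
  define c0 where "c0 = (LEAST c. \<exists>s. (b0, c, s) \<in> S)"
  have c0: "\<exists>s. (b0, c0, s) \<in> S"
    unfolding c0_def by (rule LeastI_ex) (use b0 in blast)
  have c0_le: "c0 \<le> c" if "(b0, c, s) \<in> S" for c s
    unfolding c0_def by (rule Least_le) (use that in blast)
  define T where "T = {s. (b0, c0, s) \<in> S}"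
  have T: "(\<lambda>s. (b0, c0, s)) ` T \<subseteq> S" by (auto simp: T_def)
  have finT: "finite T"
    using finite_subset[OF T fin] by (rule finite_imageD) (simp add: inj_on_def)
  obtain k where k: "\<And>s. k s \<noteq> 0"
    "\<And>s r. detect b0 c0 r (mon (b0, c0, s))
        = k s * E (real b0 / 2 + real c0 / 2 + real_of_int s / 2) ^ r"
    using detect_mon[of b0 c0] unfolding mon_def prod.case by metis
  have "(\<Sum>s\<in>T. (f (mon (b0, c0, s)) * k s) * E (real b0 / 2 + real c0 / 2 + real_of_int s / 2) ^ r)
      = 0" for r
  proof -
    have other: "detect b0 c0 r (mon t) = 0" if "t \<in> S - (\<lambda>s. (b0, c0, s)) ` T" for t
    proof -
      obtain b c s where t: "t = (b, c, s)" by (cases t)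
      have "b0 < b \<or> (b = b0 \<and> c0 < c)"
        using that b0_le[of b c s] c0_le[of c s] by (auto simp: t T_def order.order_iff_strict)
      then show ?thesis by (auto simp: t mon_def detect_\<beta>_high detect_\<gamma>_high)
    qed
    have "0 = detect b0 c0 r \<xi>" by (simp add: detect_eq assms)
    also have "\<dots> = (\<Sum>t\<in>S. f (mon t) * detect b0 c0 r (mon t))"
      unfolding \<xi>S by (simp add: clinear_simps[OF clinear_detect] scaleC_complex_def)
    also have "\<dots> = (\<Sum>t\<in>(\<lambda>s. (b0, c0, s)) ` T. f (mon t) * detect b0 c0 r (mon t))"
      by (rule sum.mono_neutral_right[OF fin T]) (use other in auto)
    also have "\<dots> = (\<Sum>s\<in>T. (f (mon (b0, c0, s)) * k s) * E (real b0 / 2 + real c0 / 2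
        + real_of_int s / 2) ^ r)"
      by (subst sum.reindex) (auto simp: inj_on_def k(2) mult.assoc)
    finally show ?thesis by simp
  qed
  then have "f (mon (b0, c0, s)) * k s = 0" if "s \<in> T" for s
    by (rule power_sums_zero[OF finT _ _ that, rotated]) (simp add: inj_on_def E_inj)
  then show False using c0 k(1) nz by (auto simp: T_def)
qed

end

section \<open>The spin representations inside \<A>\<close>

context quantum_pair begin

text \<open>The vectors \<open>fv N k\<close>, \<open>k \<le> N\<close>, span a copy of the spin \<open>N / 2\<close> representation inside \<open>\<A>\<close>; \<open>fv N k\<close>
  plays the role of \<open>e\<^sub>n\<close> with \<open>n = k - N / 2\<close>.\<close>

definition wv :: "nat \<Rightarrow> nat \<Rightarrow> 'a" where "wv N k = \<alpha> ^ (N - k) * \<beta> ^ k"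

text \<open>Its square is the q-binomial coefficient of N over k in base q^(-2). These factors
  replace the different coefficients of B and C between neighbours by their geometric mean
  \<open>stp\<close>, as an orthonormal weight basis requires.\<close>

definition nrm :: "nat \<Rightarrow> nat \<Rightarrow> real" where "nrm N k = (\<Prod>i<k. sqrt (qs (N - i) / qs (Suc i)))"

definition fv :: "nat \<Rightarrow> nat \<Rightarrow> 'a" where "fv N k = complex_of_real (nrm N k) *\<^sub>C wv N k"

definition stp :: "nat \<Rightarrow> nat \<Rightarrow> real" where
  "stp N k = q powr ((real N - 1) / 2) * sqrt (qs (N - k) * qs (Suc k))"

lemma nrm_pos: "k \<le> N \<Longrightarrow> nrm N k > 0"
  unfolding nrm_def by (intro prod_pos) (auto intro!: divide_pos_pos qs_pos)

text \<open>Mirror image of \<open>LB_b_power\<close>. Here peeling from the left splits off the top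
  term of the sum in \<open>kap\<close>: the term in which C hits the first \<alpha> collects a
  power of q from D and another from \<beta> passing the remaining powers.\<close>

lemma lop_C_\<alpha>_power: "lop UC (\<alpha> ^ Suc n) = complex_of_real (kap (Suc n)) *\<^sub>C (\<alpha> ^ n * \<beta>)"
proof (induction n)
  case 0
  show ?case using q_pos by (simp add: kap_def qs_def lop_simps scaleC_one)
next
  case (Suc n)
  have kap: "complex_of_real (kap (Suc (Suc n))) =
    E (1/2) * complex_of_real (kap (Suc n)) + E (- (3 * real (Suc n) / 2))"
  proof -
    have "q powr ((real (Suc (Suc n)) - 1) / 2) = q powr (1/2) * q powr ((real (Suc n) - 1) / 2)"
      by (simp add: add_divide_distrib flip: powr_add)
    moreover have "q powr ((real (Suc (Suc n)) - 1) / 2) * q powr (- 2 * real (Suc n))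
        = q powr (- (3 * real (Suc n) / 2))"
      by (simp flip: powr_add) (auto intro!: arg_cong[of _ _ "\<lambda>x. q powr x"] simp: field_simps)
    ultimately have "kap (Suc (Suc n)) = q powr (1/2) * kap (Suc n) + q powr (- (3 * real (Suc n) / 2))"
      unfolding kap_def qs_def by (subst sum.lessThan_Suc) (simp only: distrib_left mult.assoc)
    then show ?thesis by (simp add: E_def)
  qed
  have D: "lop UD (\<alpha> ^ n) = E (- (real n / 2)) *\<^sub>C \<alpha> ^ n" for n
    by (induction n) (simp_all add: lop_simps lin_nf wt_def add_divide_distrib, auto intro!: arg_cong[of
        _ _ E])
  have comm: "\<beta> * \<alpha> ^ n = E (- real n) *\<^sub>C (\<alpha> ^ n * \<beta>)" for n
    using commute_power[of \<beta> \<alpha> "E (-1)" n] by (simp add: A_rels E_power)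
  have "lop UC (\<alpha> ^ Suc (Suc n)) = lop UA \<alpha> * lop UC (\<alpha> ^ Suc n) + lop UC \<alpha> * lop UD (\<alpha> ^ Suc n)"
    by (subst power_Suc, subst lop_mult(4)) simp
  also have "\<dots> = (E (1/2) * complex_of_real (kap (Suc n))) *\<^sub>C (\<alpha> ^ Suc n * \<beta>)
      + (E (- (real (Suc n) / 2)) * E (- real (Suc n))) *\<^sub>C (\<alpha> ^ Suc n * \<beta>)"
    unfolding Suc D by (simp add: lop_gen wt_def mult_scaleC_left mult_scaleC_right scaleC_scaleC
        mult.assoc comm[of "Suc n", simplified])
  also have "E (- (real (Suc n) / 2)) * E (- real (Suc n)) = E (- (3 * real (Suc n) / 2))"
    by (simp add: E_mult) (auto intro!: arg_cong[of _ _ E] simp: field_simps)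
  finally show ?case by (simp only: kap scaleC_add_left)
qed

lemma lop_A_power: "lop UA (\<alpha> ^ n) = E (real n / 2) *\<^sub>C \<alpha> ^ n" "lop UA (\<beta> ^ n)
    = E (- (real n / 2)) *\<^sub>C \<beta> ^ n"
  by (induction n; simp add: lop_simps lin_nf wt_def add_divide_distrib scaleC_one;
      auto intro!: arg_cong[of _ _ E])+

lemma lop_D_power: "lop UD (\<alpha> ^ n) = E (- (real n / 2)) *\<^sub>C \<alpha> ^ n" "lop UD (\<beta> ^ n)
    = E (real n / 2) *\<^sub>C \<beta> ^ n"
  by (induction n; simp add: lop_simps lin_nf wt_def add_divide_distrib scaleC_one;
      auto intro!: arg_cong[of _ _ E])+

lemma lop_B_\<alpha>_power: "lop UB (\<alpha> ^ n) = 0" and lop_C_\<beta>_power: "lop UC (\<beta> ^ n) = 0"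
  by (induction n) (simp_all add: lop_simps)

lemma lop_A_wv: "k \<le> N \<Longrightarrow> lop UA (wv N k) = E (real N / 2 - real k) *\<^sub>C wv N k"
  and lop_D_wv: "k \<le> N \<Longrightarrow> lop UD (wv N k) = E (real k - real N / 2) *\<^sub>C wv N k"
  by (simp_all add: wv_def lop_mult lop_A_power lop_D_power lin_nf of_nat_diff)
    (auto intro!: arg_cong[of _ _ E] simp: field_simps)

text \<open>B kills powers of \<alpha>, so only the \<beta> part contributes; the exponents k/2 and
  (N - 1 - k)/2 add up to a prefactor independent of \<open>k\<close>.\<close>

lemma lop_B_wv:
  assumes "k < N"
  shows "lop UB (wv N (Suc k)) = (E ((real N - 1) / 2) * complex_of_real (qs (Suc k))) *\<^sub>C wv N k"
proof -
  define m where "m = N - Suc k"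
  have m: "N - k = Suc m" "real N = real m + real k + 1" using assms by (auto simp: m_def of_nat_diff)
  have "lop UB (wv N (Suc k)) = (complex_of_real (kap (Suc k)) * E (real m / 2)) *\<^sub>C (\<alpha> ^ m * (\<alpha>
      * \<beta> ^ k))"
    unfolding wv_def m_def[symmetric]
    by (subst lop_mult(3))
      (simp only: lop_A_power skew_triple.LB_b_power[OF skew_left] lop_B_\<alpha>_power mult_zero_left
          add_0_right
        mult_scaleC_left mult_scaleC_right scaleC_scaleC)
  also have "\<alpha> ^ m * (\<alpha> * \<beta> ^ k) = wv N k" by (simp add: wv_def m power_mult_left del: power_Suc)
  also have "complex_of_real (kap (Suc k)) * E (real m / 2)
      = E ((real N - 1) / 2) * complex_of_real (qs (Suc k))"
    by (simp add: kap_def m(2) E_def add_divide_distrib powr_add)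
  finally show ?thesis .
qed

lemma lop_C_wv:
  assumes "k < N"
  shows "lop UC (wv N k) = (E ((real N - 1) / 2) * complex_of_real (qs (N - k))) *\<^sub>C wv N (Suc k)"
proof -
  define m where "m = N - Suc k"
  have m: "N - k = Suc m" "real N = real m + real k + 1" using assms by (auto simp: m_def of_nat_diff)
  have "lop UC (wv N k) = (complex_of_real (kap (Suc m)) * E (real k / 2)) *\<^sub>C (\<alpha> ^ m * \<beta> * \<beta> ^ k)"
    unfolding wv_def m(1)
    by (subst lop_mult(4))
      (simp only: lop_D_power lop_C_\<alpha>_power lop_C_\<beta>_power mult_zero_right add_0_left
        mult_scaleC_left mult_scaleC_right scaleC_scaleC mult.commute)
  also have "\<alpha> ^ m * \<beta> * \<beta> ^ k = wv N (Suc k)" by (simp add: wv_def m_def mult.assoc)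
  also have "complex_of_real (kap (Suc m)) * E (real k / 2)
      = E ((real N - 1) / 2) * complex_of_real (qs (N - k))"
    by (simp add: kap_def m E_def add_divide_distrib powr_add)
  finally show ?thesis .
qed

lemma lop_fv:
  "k \<le> N \<Longrightarrow> lop UA (fv N k) = E (real N / 2 - real k) *\<^sub>C fv N k"
  "k \<le> N \<Longrightarrow> lop UD (fv N k) = E (real k - real N / 2) *\<^sub>C fv N k"
  "lop UB (fv N 0) = 0"
  "lop UC (fv N N) = 0"
  "k < N \<Longrightarrow> lop UB (fv N (Suc k)) = complex_of_real (stp N k) *\<^sub>C fv N k"
  "k < N \<Longrightarrow> lop UC (fv N k) = complex_of_real (stp N k) *\<^sub>C fv N (Suc k)"
proof -
  show "k \<le> N \<Longrightarrow> lop UA (fv N k) = E (real N / 2 - real k) *\<^sub>C fv N k"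
    "k \<le> N \<Longrightarrow> lop UD (fv N k) = E (real k - real N / 2) *\<^sub>C fv N k"
    by (simp_all add: fv_def lop_linear lop_A_wv lop_D_wv scaleC_scaleC mult.commute)
  show "lop UB (fv N 0) = 0" "lop UC (fv N N) = 0"
    by (simp_all add: fv_def wv_def lop_linear lop_B_\<alpha>_power lop_C_\<beta>_power)
  assume k: "k < N"
  define x y where "x = qs (N - k)" and "y = qs (Suc k)"
  have xy: "x > 0" "y > 0" using k qs_pos by (auto simp: x_def y_def)
  have nrm: "nrm N (Suc k) = nrm N k * sqrt (x / y)" by (simp add: nrm_def x_def y_def)
  have s1: "sqrt (x / y) * y = sqrt (x * y)" and s2: "sqrt (x * y) * sqrt (x / y) = x"
    using xy by (simp_all add: real_sqrt_mult real_sqrt_divide field_simps)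
  show "lop UB (fv N (Suc k)) = complex_of_real (stp N k) *\<^sub>C fv N k"
  proof -
    have "nrm N (Suc k) * (q powr ((real N - 1) / 2) * y) = stp N k * nrm N k"
      using s1 by (simp add: nrm stp_def flip: x_def y_def)
    then have "complex_of_real (nrm N (Suc k)) * (E ((real N - 1) / 2) * complex_of_real y)
        = complex_of_real (stp N k) * complex_of_real (nrm N k)"
      unfolding E_def of_real_mult[symmetric] by (rule arg_cong)
    then show ?thesis by (simp add: fv_def lop_linear lop_B_wv[OF k] scaleC_scaleC flip: y_def)
  qed
  show "lop UC (fv N k) = complex_of_real (stp N k) *\<^sub>C fv N (Suc k)"
  proof -
    have "nrm N k * (q powr ((real N - 1) / 2) * x) = stp N k * nrm N (Suc k)"
      using s2 by (simp add: nrm stp_def flip: x_def y_def)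
    then have "complex_of_real (nrm N k) * (E ((real N - 1) / 2) * complex_of_real x)
        = complex_of_real (stp N k) * complex_of_real (nrm N (Suc k))"
      unfolding E_def of_real_mult[symmetric] by (rule arg_cong)
    then show ?thesis by (simp add: fv_def lop_linear lop_C_wv[OF k] scaleC_scaleC flip: x_def)
  qed
qed

text \<open>Multiplied by 1/q - q the geometric sum telescopes. The result is in the form in which
  \<open>spin_gen\<close> is written.\<close>

lemma qs_closed: "qs n = q powr (1 - real n) * (q powr (- real n) - q powr (real n)) / (inverse q - q)"
proof -
  have nz: "inverse q - q \<noteq> 0"
    using q_pos q_less_1 one_less_inverse[of q] by linarith
  have inv: "inverse q = q powr (-1)" "q powr 1 = q"
    using q_pos by (simp_all add: powr_minus)
  have "qs n * (inverse q - q) = q powr (1 - 2 * real n) - q"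
  proof (induction n)
    case (Suc n)
    have "q powr (- 2 * real n) * inverse q = q powr (- 2 * real n + (-1))"
      unfolding inv(1) powr_add ..
    also have "- 2 * real n + (-1) = 1 - 2 * real (Suc n)" by simp
    finally have 1: "q powr (- 2 * real n) * inverse q = q powr (1 - 2 * real (Suc n))" .
    have "q powr (- 2 * real n) * q = q powr (- 2 * real n + 1)"
      unfolding powr_add inv(2) ..
    also have "- 2 * real n + 1 = 1 - 2 * real n" by simp
    finally have "q powr (- 2 * real n) * q = q powr (1 - 2 * real n)" .
    with 1 have "q powr (- 2 * real n) * (inverse q - q)
        = q powr (1 - 2 * real (Suc n)) - q powr (1 - 2 * real n)"
      by (simp only: right_diff_distrib)
    moreover have "qs (Suc n) = qs n + q powr (- 2 * real n)" by (simp add: qs_def)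
    ultimately show ?case by (simp only: distrib_right Suc)
  qed (use q_pos in \<open>simp add: qs_def\<close>)
  also have "\<dots> = q powr (1 - real n + - real n) - q powr (1 - real n + real n)"
    by (simp only: inv(2) diff_add_cancel) simp
  also have "\<dots> = q powr (1 - real n) * (q powr (- real n) - q powr (real n))"
    by (simp only: powr_add right_diff_distrib)
  finally show ?thesis using nz by (simp add: eq_divide_eq)
qed

lemma stp_eq:
  assumes "k < N"
  shows "stp N k = sqrt ((q powr (- real (N - k)) - q powr (real (N - k))) *
    (q powr (- real (Suc k)) - q powr (real (Suc k)))) / (inverse q - q)"
proof -
  have pos: "inverse q - q > 0"
    using q_pos q_less_1 one_less_inverse[of q] by linarith
  let ?X = "q powr (- real (N - k)) - q powr (real (N - k))"
  let ?Y = "q powr (- real (Suc k)) - q powr (real (Suc k))"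
  have "qs (N - k) * qs (Suc k) = q powr (1 - real (N - k)) * q powr (1 - real (Suc k)) * (?X * ?Y) /
      (inverse q - q) ^ 2"
    unfolding qs_closed by (simp add: power2_eq_square)
  also have "q powr (1 - real (N - k)) * q powr (1 - real (Suc k)) = q powr (1 - real N)"
    using assms by (simp add: of_nat_diff flip: powr_add)
  also have "sqrt (q powr (1 - real N) * (?X * ?Y) / (inverse q - q) ^ 2)
    = q powr ((1 - real N) / 2) * sqrt (?X * ?Y) / (inverse q - q)"
    using pos by (simp only: real_sqrt_mult real_sqrt_divide real_sqrt_abs abs_of_pos)
        (simp add: powr_half_sqrt[symmetric] powr_powr)
  finally have "stp N k = (q powr ((real N - 1) / 2) * q powr ((1 - real N) / 2)) * sqrt (?X * ?Y) /
      (inverse q - q)"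
    by (simp add: stp_def)
  also have "q powr ((real N - 1) / 2) * q powr ((1 - real N) / 2) = 1"
    using q_pos by (simp add: diff_divide_distrib flip: powr_add)
  finally show ?thesis by simp
qed

section \<open>Homogeneous polynomials as a comodule, and its coefficients\<close>

lemma comult_step:
  "\<exists>Y. (\<alpha> \<otimes> x + \<beta> \<otimes> y) * (\<Sum>k\<le>N. wv N k \<otimes> X k) = (\<Sum>k\<le>Suc N. wv (Suc N) k \<otimes> (Y k :: 'a))"
proof -
  define Y1 where "Y1 k = (if k \<le> N then x * X k else 0)" for k
  \<comment> \<open>Index shift: \<beta> times monomial k is a multiple of monomial k + 1, the
    scalar coming from \<beta> passing \<alpha>^(N - k).\<close>
  define Y2 where "Y2 k = (case k of 0 \<Rightarrow> 0 | Suc i \<Rightarrow> E (- real (N - i)) *\<^sub>C (y * X i))" for k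
  have \<alpha>: "\<alpha> * wv N k = wv (Suc N) k" if "k \<le> N" for k
    using that by (simp add: wv_def Suc_diff_le mult.assoc)
  have \<beta>: "\<beta> * wv N k = E (- real (N - k)) *\<^sub>C wv (Suc N) (Suc k)" for k
    using commute_power[of \<beta> \<alpha> "E (-1)" "N - k"]
    by (simp add: A_rels E_power wv_def mult.assoc[symmetric] mult_scaleC_left)
  have "(\<Sum>k\<le>Suc N. wv (Suc N) k \<otimes> (Y1 k + Y2 k)) =
    (\<Sum>k\<le>N. wv (Suc N) k \<otimes> (x * X k)) + (\<Sum>k\<le>N. wv (Suc N) (Suc k) \<otimes> (E (- real (N - k)) *\<^sub>C (y * X k)))"
  proof -
    have "(\<Sum>k\<le>Suc N. wv (Suc N) k \<otimes> Y1 k) = (\<Sum>k\<le>N. wv (Suc N) k \<otimes> (x * X k))"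
      by (simp add: Y1_def)
    moreover have "(\<Sum>k\<le>Suc N. wv (Suc N) k \<otimes> Y2 k) =
        (\<Sum>k\<le>N. wv (Suc N) (Suc k) \<otimes> (E (- real (N - k)) *\<^sub>C (y * X k)))"
      by (subst sum.atMost_Suc_shift) (simp add: Y2_def)
    ultimately show ?thesis by (simp only: tens_add_right sum.distrib)
  qed
  also have "\<dots> = (\<alpha> \<otimes> x + \<beta> \<otimes> y) * (\<Sum>k\<le>N. wv N k \<otimes> X k)"
    by (simp add: distrib_right sum_distrib_left sum.distrib tens_mult \<alpha> \<beta> tens_scaleC_left
        tens_scaleC_right)
  finally show ?thesis by (intro exI[of _ "\<lambda>k. Y1 k + Y2 k"]) simp
qed

text \<open>By \<open>comult_step\<close>, each further generator raises the degree of the first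
  legs by one. The second legs stay unspecified: only their pairings are used, and these are found
  later by comparing coefficients.\<close>

lemma cop_monomial: "\<exists>X. cop (\<alpha> ^ m * \<beta> ^ k) = (\<Sum>i\<le>m + k. wv (m + k) i \<otimes> X i)"
proof (induction m)
  case 0
  show ?case
  proof (induction k)
    case 0
    show ?case by (intro exI[of _ "\<lambda>_. 1"]) (simp add: wv_def cop_simps tens_one)
  next
    case (Suc k)
    then obtain X where "cop (\<beta> ^ k) = (\<Sum>i\<le>k. wv k i \<otimes> X i)" by auto
    then show ?case using comult_step[of \<beta> \<delta> k X] by (simp add: cop_simps del: sum.atMost_Suc)
  qed
next
  case (Suc m)
  then obtain X where "cop (\<alpha> ^ m * \<beta> ^ k) = (\<Sum>i\<le>m + k. wv (m + k) i \<otimes> X i)" by auto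
  then show ?case
    using comult_step[of \<alpha> \<gamma> "m + k" X] by (simp add: cop_simps mult.assoc del: sum.atMost_Suc)
qed

lemma cop_fv: "k \<le> N \<Longrightarrow> \<exists>X. cop (fv N k) = (\<Sum>i\<le>N. fv N i \<otimes> X i)"
proof -
  assume k: "k \<le> N"
  obtain X where X: "cop (wv N k) = (\<Sum>i\<le>N. wv N i \<otimes> X i)"
    using cop_monomial[of "N - k" k] k by (auto simp: wv_def)
  have "cop (fv N k) = (\<Sum>i\<le>N. fv N i \<otimes> (complex_of_real (nrm N k / nrm N i) *\<^sub>C X i))"
    using nrm_pos[of _ N]
    by (auto simp: fv_def cop_simps X cvec.scale_sum_right tens_scaleC_left tens_scaleC_right
        scaleC_scaleC less_imp_neq[symmetric] intro!: sum.cong)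
  then show ?thesis by (intro exI[of _ "\<lambda>i. complex_of_real (nrm N k / nrm N i) *\<^sub>C X i"])
qed

text \<open>After shifting both indices by N/2, these are the basis matrix elements of spin N/2; see
  \<open>spin_rep_eq\<close>.\<close>

definition spinX :: "nat \<Rightarrow> nat \<Rightarrow> nat \<Rightarrow> 'a" where
  "spinX N n m = (SOME X. cop (fv N m) = (\<Sum>i\<le>N. fv N i \<otimes> X i)) n"

lemma cop_spinX: "m \<le> N \<Longrightarrow> cop (fv N m) = (\<Sum>n\<le>N. fv N n \<otimes> spinX N n m)"
  using someI_ex[OF cop_fv] unfolding spinX_def .

lemma Lop_fv: "m \<le> N \<Longrightarrow> Lop X (fv N m) = (\<Sum>n\<le>N. pr X (spinX N n m) *\<^sub>C fv N n)"
  by (simp add: Lop_eq cop_spinX tensor_lift_simps[OF cbilinear_scaleC(1)[OF clinear_pr(1)]])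

text \<open>Triangularity: \<open>detect j 0 0\<close> vanishes on \<open>fv N k\<close> for k > j
  but not on \<open>fv N j\<close>, while smaller indices are settled by the induction
  hypothesis.\<close>

lemma fv_independent:
  assumes "(\<Sum>k\<le>N. x k *\<^sub>C fv N k) = 0" "j \<le> N"
  shows "x j = 0"
  using assms(2)
proof (induction j rule: less_induct)
  case (less j)
  have wv: "wv N k = E (real (N - k) * real k) *\<^sub>C (\<beta> ^ k * (\<gamma> ^ 0 * alz (int (N - k))))" for k
  proof -
    have "\<alpha> ^ n * \<beta> ^ k = E (real n * real k) *\<^sub>C (\<beta> ^ k * \<alpha> ^ n)" for n
    proof (induction n)
      case (Suc n)
      have "\<alpha> ^ Suc n * \<beta> ^ k = \<alpha> * (\<alpha> ^ n * \<beta> ^ k)" by (simp add: mult.assoc)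
      also have "\<dots> = E (real n * real k) *\<^sub>C ((\<alpha> * \<beta> ^ k) * \<alpha> ^ n)"
        by (simp add: Suc mult_scaleC_right mult.assoc)
      also have "\<dots> = E (real (Suc n) * real k) *\<^sub>C (\<beta> ^ k * \<alpha> ^ Suc n)"
        by (simp add: skew_triple.\<alpha>_b_power[OF skew_left] mult_scaleC_left scaleC_scaleC E_mult
            mult.assoc algebra_simps)
      finally show ?case .
    qed (simp add: scaleC_one)
    then show ?thesis by (simp add: wv_def alz_def)
  qed
  have high: "detect j 0 0 (fv N k) = 0" if "j < k" for k
    using that by (simp add: fv_def wv clinear_simps[OF clinear_detect] detect_\<beta>_high scaleC_complex_def
        del: power_0)
  have diag: "detect j 0 0 (fv N j) \<noteq> 0"
    using detect_mon[of j 0 "int (N - j)"] nrm_pos[OF less.prems]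
    by (auto simp: fv_def wv clinear_simps[OF clinear_detect] scaleC_complex_def)
  have "0 = detect j 0 0 (\<Sum>k\<le>N. x k *\<^sub>C fv N k)"
    by (simp add: assms(1) clinear_simps[OF clinear_detect])
  also have "\<dots> = (\<Sum>k\<le>N. x k * detect j 0 0 (fv N k))"
    by (simp add: clinear_simps[OF clinear_detect] scaleC_complex_def)
  also have "\<dots> = (\<Sum>k\<in>{j}. x k * detect j 0 0 (fv N k))"
  proof (rule sum.mono_neutral_right)
    show "\<forall>k\<in>{..N} - {j}. x k * detect j 0 0 (fv N k) = 0"
      using high less by (auto simp: nat_neq_iff)
  qed (use less.prems in auto)
  finally show ?case using diag by simp
qed

lemma fv_coeff_eq:
  assumes "(\<Sum>k\<le>N. x k *\<^sub>C fv N k) = (\<Sum>k\<le>N. y k *\<^sub>C fv N k)" "j \<le> N"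
  shows "x j = y j"
  using fv_independent[of "\<lambda>k. x k - y k" N j] assms
  by (simp add: cvec.scale_left_diff_distrib sum_subtractf)

text \<open>Matrix multiplication is inherited from composing the actions of Y and X on the
  independent family \<open>fv\<close>.\<close>

lemma pr_spinX_mult:
  assumes "n \<le> N" "m \<le> N"
  shows "pr (X * Y) (spinX N n m) = (\<Sum>k\<le>N. pr X (spinX N n k) * pr Y (spinX N k m))"
proof (rule fv_coeff_eq[OF _ assms(1)])
  have "(\<Sum>n\<le>N. pr (X * Y) (spinX N n m) *\<^sub>C fv N n) = Lop X (Lop Y (fv N m))"
    using assms(2) by (simp add: Lop_simps flip: Lop_fv)
  also have "\<dots> = (\<Sum>k\<le>N. \<Sum>n\<le>N. (pr Y (spinX N k m) * pr X (spinX N n k)) *\<^sub>C fv N n)"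
    using assms(2) by (simp add: Lop_fv Lop_linear cvec.scale_sum_right scaleC_scaleC)
  also have "\<dots> = (\<Sum>n\<le>N. (\<Sum>k\<le>N. pr X (spinX N n k) * pr Y (spinX N k m)) *\<^sub>C fv N n)"
    by (subst sum.swap) (simp add: cvec.scale_sum_left mult.commute)
  finally show "(\<Sum>n\<le>N. pr (X * Y) (spinX N n m) *\<^sub>C fv N n) =
    (\<Sum>n\<le>N. (\<Sum>k\<le>N. pr X (spinX N n k) * pr Y (spinX N k m)) *\<^sub>C fv N n)" .
qed

lemma pr_spinX_one:
  assumes "n \<le> N" "m \<le> N"
  shows "pr 1 (spinX N n m) = (if n = m then 1 else 0)"
proof (rule fv_coeff_eq[OF _ assms(1)])
  show "(\<Sum>n\<le>N. pr 1 (spinX N n m) *\<^sub>C fv N n) = (\<Sum>n\<le>N. (if n = m then 1 else 0) *\<^sub>C fv N n)"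
    by (simp add: Lop_simps scaleC_one if_distrib[of "\<lambda>c. c *\<^sub>C _"] assms(2) cong: if_cong flip: Lop_fv)
qed

lemma pr_spinX_gen:
  assumes "n \<le> N" "m \<le> N"
  shows "pr (u x) (spinX N n m) =
    complex_of_real (spin_gen q (real N / 2) x (real n - real N / 2) (real m - real N / 2))"
proof (rule fv_coeff_eq[OF _ assms(1)])
  let ?c = "\<lambda>n. complex_of_real (spin_gen q (real N / 2) x (real n - real N / 2) (real m - real N / 2))"
  have eq: "real n - real N / 2 = real m - real N / 2 - 1 \<longleftrightarrow> m = Suc n"
    "real n - real N / 2 = real m - real N / 2 + 1 \<longleftrightarrow> n = Suc m" for n by auto
  have one: "(\<Sum>n\<le>N. ?c n *\<^sub>C fv N n) = ?c k *\<^sub>C fv N k"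
    if "k \<le> N" "\<And>n. n \<noteq> k \<Longrightarrow> ?c n = 0" for k
    using that by (subst sum.mono_neutral_right[of "{..N}" "{k}"]) auto
  have "lop x (fv N m) = (\<Sum>n\<le>N. ?c n *\<^sub>C fv N n)"
  proof (cases x)
    case UA
    then show ?thesis using assms one[of m] by (simp add: lop_fv E_def)
  next
    case UD
    then show ?thesis using assms one[of m] by (simp add: lop_fv E_def)
  next
    case UB
    show ?thesis
    proof (cases m)
      case 0
      then show ?thesis using UB by (simp add: lop_fv eq[simplified 0] del: of_nat_eq_iff) 
    next
      case (Suc k)
      have "k < N" using Suc assms by simp
      have "?c k = complex_of_real (stp N k)"
        unfolding stp_eq[OF \<open>k < N\<close>] using \<open>k < N\<close>
        by (simp add: UB Suc of_nat_diff algebra_simps)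
      moreover have "?c n = 0" if "n \<noteq> k" for n
        using that by (simp add: UB eq Suc del: of_nat_Suc)
      ultimately show ?thesis using one[of k] \<open>k < N\<close> by (simp add: UB Suc lop_fv)
    qed
  next
    case UC
    show ?thesis
    proof (cases "m = N")
      case True
      have "?c n = 0" if "n \<le> N" for n using that by (simp add: UC eq True)
      then show ?thesis using True UC by (simp add: lop_fv)
    next
      case False
      then have "m < N" using assms by simp
      have "?c (Suc m) = complex_of_real (stp N m)"
      proof -
        have ex: "- (real N / 2) + (real m - real N / 2) = - real (N - m)"
          "real N / 2 - (real m - real N / 2) = real (N - m)"
          "- (real N / 2) - (real m - real N / 2) - 1 = - real (Suc m)"
          "real N / 2 + (real m - real N / 2) + 1 = real (Suc m)"
          using \<open>m < N\<close> by (simp_all add: of_nat_diff)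
        show ?thesis
          by (simp only: stp_eq[OF \<open>m < N\<close>] UC spin_gen.simps eq ex if_True refl)
      qed
      moreover have "?c n = 0" if "n \<noteq> Suc m" for n
        using that by (simp add: UC eq)
      ultimately show ?thesis using one[of "Suc m"] \<open>m < N\<close> by (simp add: UC lop_fv)
    qed
  qed
  then show "(\<Sum>n\<le>N. pr (u x) (spinX N n m) *\<^sub>C fv N n) = (\<Sum>n\<le>N. ?c n *\<^sub>C fv N n)"
    using assms(2) by (simp add: Lop_simps flip: Lop_fv)
qed

end

subsection \<open>The eigenvectors\<close>

lemma qpoch_0: "qpoch x p 0 = 1"
  by (simp add: qpoch_def)

lemma qpoch_Suc: "qpoch x p (Suc k) = qpoch x p k * (1 - x * p ^ k)"
  by (simp add: qpoch_def)

lemma qpoch_Suc_shift: "qpoch x p (Suc k) = (1 - x) * qpoch (x * p) p k"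
  unfolding qpoch_def by (subst prod.lessThan_Suc_shift) (simp add: mult.assoc)

text \<open>A difference equation in the upper parameter \<open>a\<close>. With XY held fixed,
  multiplication by X + Y is bidiagonal in the basis \<open>\<phi>\<close>: it sends
  \<open>\<phi> k\<close> to a combination of \<open>\<phi> k\<close> and
  \<open>\<phi> (Suc k)\<close>. The factor on the left contains X + Y, so both sides can be
  compared coefficient by coefficient.\<close>

lemma dual_q_Krawtchouk_recurrence:
  fixes p M X Y a :: real and N :: nat
  defines "f \<equiv> \<lambda>a::real. \<Sum>k\<le>N. qpoch a p k * (qpoch X p k * qpoch Y p k) / (qpoch M p k * qpoch p p k)
      * p ^ k"
  assumes p: "p \<noteq> 0" "\<And>i. i < N \<Longrightarrow> p ^ Suc i \<noteq> 1" and M: "\<And>i. i < N \<Longrightarrow> M * p ^ i \<noteq> 1"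
    and a: "a \<noteq> 0" and X: "qpoch X p (Suc N) = 0"
  shows "- ((1 - X) * (1 - Y)) * f a =
    (1 - M / a) * (f (a / p) - f a) + X * Y * (1 - 1 / a) * (f (a * p) - f a)"
proof -
  define D where "D k = qpoch M p k * qpoch p p k" for k
  define d where "d a k = qpoch a p k / D k * p ^ k" for a k
  define \<phi> where "\<phi> k = qpoch X p k * qpoch Y p k" for k
  \<comment> \<open>The coefficient that \<open>\<phi> k\<close> receives from index k - 1 through
    this shift.\<close>
  define g where "g k = (case k of 0 \<Rightarrow> 0 | Suc i \<Rightarrow> d a i / p ^ i)" for k
  have f: "f a = (\<Sum>k\<le>N. d a k * \<phi> k)" for a
    by (simp add: f_def d_def \<phi>_def D_def mult_ac)
  have D: "D k \<noteq> 0" if "k \<le> N" for k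
    using that
  proof (induction k)
    case (Suc k)
    then show ?case using p(2)[of k] M[of k] by (simp add: D_def qpoch_Suc mult_ac)
  qed (simp add: D_def qpoch_0)
  have \<phi>_Suc: "\<phi> (Suc k) = \<phi> k * (1 - (X + Y) * p ^ k + X * Y * (p ^ k * p ^ k))" for k
    by (simp add: \<phi>_def qpoch_Suc algebra_simps)
  \<comment> \<open>The identity splits by powers of XY: the part with XY belongs to the shift from
    a to a p, the part without it to the shift to a / p together with \<open>g\<close>.\<close>
  have coeff: "d a k * ((1 / p ^ k - 1) + X * Y * (p ^ k - 1)) - g k =
      (1 - M / a) * (d (a / p) k - d a k) + X * Y * (1 - 1 / a) * (d (a * p) k - d a k)"
    if k: "k \<le> N" for k
  proof -
    have "(1 - 1 / a) * qpoch (a * p) p k = (p ^ k - 1 / a) * qpoch a p k"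
    proof -
      have "(1 - a) * qpoch (a * p) p k = (1 - a * p ^ k) * qpoch a p k"
        using qpoch_Suc[of a p k] qpoch_Suc_shift[of a p k] by (simp add: mult.commute)
      then have "(1 - a) / a * qpoch (a * p) p k = (1 - a * p ^ k) / a * qpoch a p k"
        by simp
      moreover have "(1 - a) / a = - (1 - 1 / a)" "(1 - a * p ^ k) / a = - (p ^ k - 1 / a)"
        using a by (simp_all add: field_simps)
      ultimately have "- ((1 - 1 / a) * qpoch (a * p) p k) = - ((p ^ k - 1 / a) * qpoch a p k)"
        by (simp only: mult_minus_left)
      then show ?thesis by (simp only: neg_equal_iff_equal)
    qed
    then have "(1 - 1 / a) * d (a * p) k = (p ^ k - 1 / a) * d a k"
      by (simp add: d_def)
    then have 1: "(1 - 1 / a) * (d (a * p) k - d a k) = (p ^ k - 1) * d a k"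
      by (simp add: algebra_simps)
    have 2: "d a k * (1 / p ^ k - 1) - g k = (1 - M / a) * (d (a / p) k - d a k)"
    proof (cases k)
      case 0
      then show ?thesis by (simp add: g_def d_def qpoch_0)
    next
      case (Suc i)
      define t where "t = p ^ i"
      have nz: "t \<noteq> 0" "1 - M * t \<noteq> 0" "1 - p * t \<noteq> 0" "D i \<noteq> 0"
        using p(1) p(2)[of i] M[of i] D[of i] k Suc by (auto simp: t_def)
      have DS: "D (Suc i) = D i * (1 - M * t) * (1 - p * t)"
        by (simp add: D_def qpoch_Suc t_def)
      have e1: "d a k = qpoch a p i * (1 - a * t) / (D i * (1 - M * t) * (1 - p * t)) * (p * t)"
        by (simp add: d_def Suc DS) (simp add: qpoch_Suc t_def)
      have e2: "d (a / p) k = qpoch a p i * (1 - a / p) / (D i * (1 - M * t) * (1 - p * t)) * (p * t)"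
        using p(1) by (simp add: d_def Suc DS qpoch_Suc_shift) (simp add: t_def)
      have e3: "g k = qpoch a p i / D i"
        using nz by (simp add: g_def d_def Suc t_def)
      have "d a k * (1 / p ^ k - 1) - g k = qpoch a p i / D i * ((M - a) * t / (1 - M * t))"
      proof -
        have "(p * t) * (1 / p ^ k - 1) = 1 - p * t"
          using p(1) nz by (simp add: Suc t_def field_simps)
        then have "d a k * (1 / p ^ k - 1) = qpoch a p i * (1 - a * t) / (D i * (1 - M * t) * (1 - p
            * t)) * (1 - p * t)"
          unfolding e1 by (simp only: mult.assoc)
        also have "\<dots> = qpoch a p i / D i * ((1 - a * t) / (1 - M * t))"
          using nz by simp
        finally have "d a k * (1 / p ^ k - 1) - g k
            = qpoch a p i / D i * ((1 - a * t) / (1 - M * t) - 1)"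
          unfolding e3 by (simp only: right_diff_distrib mult_1_right)
        also have "(1 - a * t) / (1 - M * t) - 1 = (M - a) * t / (1 - M * t)"
          using nz by (simp add: field_simps)
        finally show ?thesis .
      qed
      also have "\<dots> = (1 - M / a) * (d (a / p) k - d a k)"
      proof -
        have "d (a / p) k - d a k = qpoch a p i / D i * ((((1 - a / p) - (1 - a * t)) * (p * t)) / ((1
            - M * t) * (1 - p * t)))"
        proof -
          have "Q * y / (E * u * v) * w - Q * x / (E * u * v) * w = Q / E * ((y - x) * w / (u * v))"
            for Q E u v w x y :: real
            by (simp add: diff_divide_distrib left_diff_distrib right_diff_distrib mult_ac)
          then show ?thesis unfolding e1 e2 .
        qed
        also have "((1 - a / p) - (1 - a * t)) * (p * t) = - (a * t) * (1 - p * t)"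
          using p(1) by (simp add: field_simps)
        finally have "d (a / p) k - d a k = qpoch a p i / D i * (- (a * t) / (1 - M * t))"
          using nz by simp
        moreover have "(1 - M / a) * - (a * t) = (M - a) * t"
          using a by (simp add: field_simps)
        moreover have "x * (y * (z / w)) = y * (x * z / w)" for x y z w :: real by simp
        ultimately show ?thesis by (simp only:)
      qed
      finally show ?thesis .
    qed
    have "d a k * ((1 / p ^ k - 1) + X * Y * (p ^ k - 1)) - g k
      = (d a k * (1 / p ^ k - 1) - g k) + X * Y * ((p ^ k - 1) * d a k)"
      by (simp add: algebra_simps)
    then show ?thesis unfolding 2 1[symmetric] by (simp add: mult.assoc)
  qed
  have "- ((1 - X) * (1 - Y)) * (d a k * \<phi> k) =
      d a k * ((1 / p ^ k - 1) + X * Y * (p ^ k - 1)) * \<phi> k - g (Suc k) * \<phi> (Suc k)" for k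
    using p(1) by (simp add: g_def \<phi>_Suc field_simps)
  then have "- ((1 - X) * (1 - Y)) * f a =
      (\<Sum>k\<le>N. d a k * ((1 / p ^ k - 1) + X * Y * (p ^ k - 1)) * \<phi> k) - (\<Sum>k\<le>N. g (Suc k) * \<phi> (Suc k))"
    by (simp add: f sum_distrib_left flip: sum_subtractf)
  also have "(\<Sum>k\<le>N. g (Suc k) * \<phi> (Suc k)) = (\<Sum>k\<le>Suc N. g k * \<phi> k)"
    by (subst sum.atMost_Suc_shift) (simp add: g_def)
  \<comment> \<open>The boundary term at N + 1 vanishes because X is a terminating
    parameter.\<close>
  also have "\<dots> = (\<Sum>k\<le>N. g k * \<phi> k)"
    using X by (simp add: \<phi>_def)
  also have "(\<Sum>k\<le>N. d a k * ((1 / p ^ k - 1) + X * Y * (p ^ k - 1)) * \<phi> k) - (\<Sum>k\<le>N. g k * \<phi> k) =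
      (\<Sum>k\<le>N. (d a k * ((1 / p ^ k - 1) + X * Y * (p ^ k - 1)) - g k) * \<phi> k)"
    by (simp add: left_diff_distrib sum_subtractf)
  also have "\<dots> = (\<Sum>k\<le>N. ((1 - M / a) * (d (a / p) k - d a k) + X * Y * (1 - 1 / a) * (d (a * p) k
      - d a k)) * \<phi> k)"
    by (rule sum.cong) (simp_all add: coeff)
  also have "\<dots> = (1 - M / a) * (f (a / p) - f a) + X * Y * (1 - 1 / a) * (f (a * p) - f a)"
    by (simp add: f distrib_right left_diff_distrib right_diff_distrib sum.distrib sum_subtractf
        sum_distrib_left mult.assoc)
  finally show ?thesis .
qed

text \<open>Beyond \<open>N\<close> the lower parameter makes the denominator 0, so the summand is 0
  by the convention for division, whatever \<open>a\<close> is. The finite form thus also covers the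
  out-of-range argument q^(-2(N + 1)).\<close>

lemma phi32_terminating:
  assumes "qpoch M p (Suc N) = 0"
  shows "phi32 a X Y M 0 p p =
    (\<Sum>k\<le>N. qpoch a p k * (qpoch X p k * qpoch Y p k) / (qpoch M p k * qpoch p p k) * p ^ k)"
proof -
  have "qpoch M p k = 0" if "k \<notin> {..N}" for k
  proof -
    have "Suc N \<le> k" using that by simp
    then show ?thesis using assms by (induction k rule: dec_induct) (simp_all add: qpoch_Suc)
  qed
  then have "phi32 a X Y M 0 p p = (\<Sum>k\<le>N. (qpoch a p k * qpoch X p k * qpoch Y p k) /
                  (qpoch M p k * qpoch 0 p k * qpoch p p k) * p ^ k)"
    unfolding phi32_def by (intro suminf_finite) auto
  then show ?thesis by (simp add: qpoch_def[of 0] mult.assoc)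
qed

section \<open>The recurrence at the parameters of the eigenvectors\<close>

context
  fixes q :: real
  assumes q: "0 < q" "q < 1"
begin

text \<open>Up to a constant and a power of \<open>- \<i>\<close>, the entry of \<open>eig_vec\<close> at \<open>n
    = l - k\<close> is \<open>kwt N \<sigma> k * kw N j \<sigma> k\<close>,
  where \<open>N = 2 l\<close>.\<close>

definition kw :: "nat \<Rightarrow> real \<Rightarrow> real \<Rightarrow> nat \<Rightarrow> real" where
  "kw N j \<sigma> k = phi32 (q powr (-2 * real k)) (q powr (-2 * (real N / 2 - j)))
     (- (q powr (- real N - 2 * j - 2 * \<sigma>))) (q powr (-2 * real N)) 0 (q\<^sup>2) (q\<^sup>2)"

text \<open>The case a = q^(-2k). At k = N and k = 0 the terms with \<open>Suc k\<close> and with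
  the truncated \<open>k - 1\<close> carry the coefficient 0, so the boundary is included.\<close>

lemma kw_recurrence:
  assumes x: "j = real N / 2 - real x" "x \<le> N" and k: "k \<le> N"
  shows "(1 - q powr (2 * real k - 2 * real N)) * kw N j \<sigma> (Suc k)
      - q powr (-2 * \<sigma> - 2 * real N) * (1 - q powr (2 * real k)) * kw N j \<sigma> (k - 1)
    = (- (q powr (2 * real k - 2 * real N)) + q powr (-2 * \<sigma> + 2 * real k - 2 * real N)
        - q powr (-2 * j - 2 * \<sigma> - real N) + q powr (2 * j - real N)) * kw N j \<sigma> k"
proof -
  define p where "p = q\<^sup>2"
  define M where "M = q powr (-2 * real N)"
  define X where "X = q powr (-2 * real x)"
  define Y where "Y = - (q powr (- real N - 2 * j - 2 * \<sigma>))"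
  define a where "a = q powr (-2 * real k)"
  define f where "f = (\<lambda>a. \<Sum>k\<le>N. qpoch a p k * (qpoch X p k * qpoch Y p k) / (qpoch M p k * qpoch p p k)
      * p ^ k)"
  have p2: "p = q powr 2" using q by (simp add: p_def)
  have pp: "p ^ i = q powr (2 * real i)" for i
    unfolding p2 using q by (subst powr_power) (simp_all add: mult.commute)
  have powr1: "q powr y = 1 \<longleftrightarrow> y = 0" for y
    using q powr_inj[of q y 0] by simp
  have van: "qpoch (q powr (-2 * real m)) p (Suc n) = 0" if "m \<le> n" for m n
  proof -
    have "q powr (-2 * real m) * p ^ m = q powr (-2 * real m + 2 * real m)"
      unfolding pp powr_add ..
    then have "1 - q powr (-2 * real m) * p ^ m = 0" using q by simp
    then show ?thesis unfolding qpoch_def using that by (intro prod_zero bexI[of _ m]) auto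
  qed
  have kw: "kw N j \<sigma> m = f (q powr (-2 * real m))" for m
    unfolding kw_def f_def using phi32_terminating[OF van[of N N]]
    by (simp add: p_def M_def X_def Y_def x(1))
  have rec: "- ((1 - X) * (1 - Y)) * f a =
    (1 - M / a) * (f (a / p) - f a) + X * Y * (1 - 1 / a) * (f (a * p) - f a)"
    unfolding f_def
  proof (rule dual_q_Krawtchouk_recurrence)
    show "p \<noteq> 0" "a \<noteq> 0" using q by (simp_all add: p_def a_def)
    show "p ^ Suc i \<noteq> 1" for i unfolding pp powr1 by simp
    show "M * p ^ i \<noteq> 1" if "i < N" for i
      using that unfolding M_def pp powr_add[symmetric] powr1 by simp
    show "qpoch X p (Suc N) = 0" unfolding X_def by (rule van[OF x(2)])
  qed
  have 1: "a / p = q powr (-2 * real (Suc k))" "M / a = q powr (2 * real k - 2 * real N)"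
    unfolding a_def p2 M_def powr_diff[symmetric]
    by (rule arg_cong[of _ _ "\<lambda>x. q powr x"], simp)+
  have inv: "1 / a = q powr (2 * real k)"
    unfolding a_def using powr_minus_divide[of q "2 * real k"] q by simp
  \<comment> \<open>The product is free of \<open>j\<close>, which enters through X + Y alone; hence
    \<open>j\<close> affects the eigenvalue but not the coefficients of the neighbours.\<close>
  have XY: "X * Y = - (q powr (-2 * \<sigma> - 2 * real N))"
    unfolding X_def Y_def mult_minus_right powr_add[symmetric]
    by (rule arg_cong[of _ _ "\<lambda>x. - (q powr x)"]) (simp add: x(1))
  have 2: "(1 - 1 / a) * f (a * p) = (1 - q powr (2 * real k)) * kw N j \<sigma> (k - 1)"
  proof (cases k)
    case 0
    then show ?thesis using q by (simp add: a_def)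
  next
    case (Suc i)
    have "a * p = q powr (-2 * real (k - 1))"
        by (simp add: a_def p2 Suc powr_add[symmetric] del: powr_numeral)
    then show ?thesis using inv by (simp only: kw)
  qed
  have "(1 - M / a) * f (a / p) + X * Y * ((1 - 1 / a) * f (a * p)) =
    ((1 - M / a) + X * Y * (1 - 1 / a) - (1 - X) * (1 - Y)) * f a"
    using rec by (simp add: algebra_simps)
  also have "(1 - M / a) + X * Y * (1 - 1 / a) - (1 - X) * (1 - Y) =
    - (M / a) - X * Y * (1 / a) + X + Y" by (simp add: algebra_simps)
  finally have "(1 - M / a) * f (a / p) + X * Y * ((1 - 1 / a) * f (a * p)) =
    (- (M / a) - X * Y * (1 / a) + X + Y) * f a" .
  moreover have "X * Y * (1 / a) = - (q powr (-2 * \<sigma> + 2 * real k - 2 * real N))"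
    unfolding XY inv mult_minus_left powr_add[symmetric] by (simp add: algebra_simps)
  moreover have "X = q powr (2 * j - real N)" using x by (simp add: X_def)
  moreover have "Y = - (q powr (-2 * j - 2 * \<sigma> - real N))"
    unfolding Y_def by (rule arg_cong[of _ _ "\<lambda>x. - (q powr x)"]) simp
  moreover have "f a = kw N j \<sigma> k" by (simp add: kw a_def)
  moreover have "f (a / p) = kw N j \<sigma> (Suc k)" by (simp add: kw 1)
  ultimately show ?thesis unfolding 2 1(2) XY by (simp add: mult.assoc)
qed


definition bn :: "real \<Rightarrow> real" where "bn x = q powr (- x) - q powr x"

text \<open>The entry of B and of C between positions k and k + 1 when the weights are listed
  downwards as l - k.\<close>

definition bcoef :: "nat \<Rightarrow> nat \<Rightarrow> real" where
  "bcoef N k = sqrt (bn (real (Suc k)) * bn (real N - real k)) / (inverse q - q)"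

definition kwt :: "nat \<Rightarrow> real \<Rightarrow> nat \<Rightarrow> real" where
  "kwt N \<sigma> k = q powr (\<sigma> * real k) * q powr (1/2 * real k * (real k - 1)) *
    sqrt (qpoch (q powr (2 * real N)) (q powr (-2)) k / qpoch (q\<^sup>2) (q\<^sup>2) k)"

lemma bn_pos: "0 < x \<Longrightarrow> 0 < bn x"
  using q mult_pos_neg[of x "ln q"] by (simp add: bn_def powr_def)

lemma one_minus_powr: "1 - q powr (2 * x) = q powr x * bn x"
proof -
  have "q powr x * q powr (- x) = q powr (x + - x)" "q powr x * q powr x = q powr (x + x)"
    unfolding powr_add by (rule refl)+
  then show ?thesis using q by (simp only: bn_def right_diff_distrib mult_2) simp
qed

lemma kwt_Suc:
  assumes "k < N"
  shows "kwt N \<sigma> (Suc k) = kwt N \<sigma> k * q powr (\<sigma> + (real N - 1) / 2) * sqrt (bn (real N - real k) / bn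
      (real (Suc k)))"
proof -
  have "q powr (2 * real N) * (q powr (-2)) ^ k = q powr (2 * real N) * q powr (-2 * real k)"
    using q by (subst powr_power) (simp_all add: mult.commute)
  then have 1: "1 - q powr (2 * real N) * (q powr (-2)) ^ k
      = q powr (real N - real k) * bn (real N - real k)"
    unfolding powr_add[symmetric] one_minus_powr[symmetric] by (simp only: right_diff_distrib) simp
  have "q\<^sup>2 * (q\<^sup>2) ^ k = q powr (2 * real (Suc k))"
    using powr_realpow[OF q(1), of "2 * Suc k"]
    by (simp only: of_nat_mult of_nat_numeral power_mult power_Suc)
  then have 2: "1 - q\<^sup>2 * (q\<^sup>2) ^ k = q powr (real (Suc k)) * bn (real (Suc k))"
    unfolding one_minus_powr[symmetric] by simp
  have "sqrt (q powr (real N - real k) * bn (real N - real k) / (q powr (real (Suc k)) * bn (real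
      (Suc k))))
    = sqrt (q powr (real N - 2 * real k - 1)) * sqrt (bn (real N - real k) / bn (real (Suc k)))"
  proof -
    have "q powr (real N - real k) = q powr (real N - 2 * real k - 1) * q powr (real (Suc k))"
      unfolding powr_add[symmetric] by simp
    then show ?thesis using q by (simp add: real_sqrt_mult[symmetric])
  qed
  also have "sqrt (q powr (real N - 2 * real k - 1)) = q powr ((real N - 2 * real k - 1) / 2)"
    using q by (simp add: powr_half_sqrt[symmetric] powr_powr)
  finally have 3: "sqrt (q powr (real N - real k) * bn (real N - real k) / (q powr (real (Suc k)) * bn
      (real (Suc k))))
    = q powr ((real N - 2 * real k - 1) / 2) * sqrt (bn (real N - real k) / bn (real (Suc k)))" .
  have 4: "q powr (\<sigma> * real (Suc k)) * q powr (1/2 * real (Suc k) * (real (Suc k) - 1)) * q powr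
      ((real N - 2 * real k - 1) / 2)
    = q powr (\<sigma> * real k) * q powr (1/2 * real k * (real k - 1)) * q powr (\<sigma> + (real N - 1) / 2)"
    unfolding powr_add[symmetric] by (rule arg_cong[of _ _ "\<lambda>x. q powr x"]) (simp add: field_simps)
  have "kwt N \<sigma> (Suc k) = q powr (\<sigma> * real (Suc k)) * q powr (1/2 * real (Suc k) * (real (Suc k) - 1)) *
    (sqrt (qpoch (q powr (2 * real N)) (q powr (-2)) k / qpoch (q\<^sup>2) (q\<^sup>2) k) *
     sqrt (q powr (real N - real k) * bn (real N - real k) / (q powr (real (Suc k)) * bn (real
         (Suc k)))))"
    unfolding kwt_def qpoch_Suc 1 2 real_sqrt_mult[symmetric] times_divide_times_eq ..
  also have "\<dots> = (q powr (\<sigma> * real (Suc k)) * q powr (1/2 * real (Suc k) * (real (Suc k) - 1)) * q powr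
      ((real N - 2 * real k - 1) / 2)) *
     sqrt (qpoch (q powr (2 * real N)) (q powr (-2)) k / qpoch (q\<^sup>2) (q\<^sup>2) k) * sqrt (bn (real N
         - real k) / bn (real (Suc k)))"
    unfolding 3 by (simp only: mult_ac)
  also have "\<dots> = kwt N \<sigma> k * q powr (\<sigma> + (real N - 1) / 2) * sqrt (bn (real N - real k) / bn (real
      (Suc k)))"
    unfolding 4 kwt_def by (simp only: mult_ac)
  finally show ?thesis .
qed

text \<open>The square roots in the matrix entry and in the ratio of neighbouring weights combine to
  a single \<open>bn\<close>, so that the matrix equation turns into the root-free recurrence for
  \<open>kw\<close>.\<close>

lemma bcoef_kwt:
  assumes "k < N"
  shows "bcoef N k * kwt N \<sigma> (Suc k) = kwt N \<sigma> k * q powr (\<sigma> + (real N - 1) / 2) * bn (real N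
      - real k) / (inverse q - q)"
    and "bcoef N k * kwt N \<sigma> k = kwt N \<sigma> (Suc k) * q powr (- \<sigma> - (real N - 1) / 2) * bn (real (Suc k)) /
        (inverse q - q)"
proof -
  define x y where "x = bn (real N - real k)" and "y = bn (real (Suc k))"
  have xy: "x > 0" "y > 0" using assms by (auto simp: x_def y_def intro!: bn_pos)
  have s1: "sqrt (y * x) * sqrt (x / y) = x" and s2: "sqrt (x / y) * y = sqrt (y * x)"
    using xy by (simp_all add: real_sqrt_mult real_sqrt_divide field_simps)
  have W: "kwt N \<sigma> (Suc k) = kwt N \<sigma> k * q powr (\<sigma> + (real N - 1) / 2) * sqrt (x / y)"
    unfolding x_def y_def by (rule kwt_Suc[OF assms])
  have b: "bcoef N k = sqrt (y * x) / (inverse q - q)" by (simp add: bcoef_def x_def y_def)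
  have "bcoef N k * kwt N \<sigma> (Suc k) = kwt N \<sigma> k * q powr (\<sigma> + (real N - 1) / 2) * (sqrt (y * x) * sqrt
      (x / y)) / (inverse q - q)"
    unfolding b W by simp
  then show "bcoef N k * kwt N \<sigma> (Suc k) = kwt N \<sigma> k * q powr (\<sigma> + (real N - 1) / 2) * bn (real N
      - real k) / (inverse q - q)"
    unfolding s1 unfolding x_def .
  have "q powr (\<sigma> + (real N - 1) / 2) * q powr (- \<sigma> - (real N - 1) / 2) = 1"
    unfolding powr_add[symmetric] using q by simp
  then have "kwt N \<sigma> k * (sqrt (x / y) * y) =
    kwt N \<sigma> k * (q powr (\<sigma> + (real N - 1) / 2) * q powr (- \<sigma> - (real N - 1) / 2)) * (sqrt (x / y) * y)"
    by simp
  also have "\<dots> = kwt N \<sigma> (Suc k) * q powr (- \<sigma> - (real N - 1) / 2) * y"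
    unfolding W by (simp only: mult_ac)
  finally show "bcoef N k * kwt N \<sigma> k = kwt N \<sigma> (Suc k) * q powr (- \<sigma> - (real N - 1) / 2) * bn (real
      (Suc k)) / (inverse q - q)"
    unfolding b s2 y_def[symmetric] by (simp add: mult.commute)
qed

text \<open>Multiply \<open>kw_recurrence\<close> by q^(\<sigma> + N) and by the weight. The left
  side is the negative of row k of the eigenvector equation after the phases have been
  removed.\<close>

lemma weighted_recurrence:
  fixes j \<sigma> :: real and N k x :: nat
  assumes x: "j = real N / 2 - real x" "x \<le> N" and k: "k \<le> N"
  defines "F \<equiv> \<lambda>k. kwt N \<sigma> k * kw N j \<sigma> k"
  shows "(if k = 0 then 0 else q powr (- (real N / 2 - real k) - 1/2) * (bcoef N (k - 1) * F (k - 1)))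
      + (if k < N then q powr (- (real N / 2 - real k) + 1/2) * (bcoef N k * F (Suc k)) else 0)
      + (q powr \<sigma> - q powr (-\<sigma>)) / (q - inverse q) * (q powr (2 * real k - real N) - 1) * F k
    = - eig_val q j \<sigma> * F k"
proof -
  define d where "d = inverse q - q"
  have d: "q - inverse q = - d" by (simp add: d_def)
  have T1: "(if k = 0 then 0 else q powr (- (real N / 2 - real k) - 1/2) * (bcoef N (k - 1) * F
      (k - 1)))
    = kwt N \<sigma> k * (q powr (- \<sigma> - real N) * (1 - q powr (2 * real k))) * kw N j \<sigma> (k - 1) / d"
  proof (cases k)
    case 0
    then show ?thesis using q by simp
  next
    case (Suc i)
    have "q powr (- (real N / 2 - real k) - 1/2) * q powr (- \<sigma> - (real N - 1) / 2)
        = q powr (- \<sigma> - real N) * q powr (real k)"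
      unfolding powr_add[symmetric] by (rule arg_cong[of _ _ "\<lambda>x. q powr x"]) (simp add: field_simps)
    then have "q powr (- (real N / 2 - real k) - 1/2) * (kwt N \<sigma> k * q powr (- \<sigma> - (real N - 1) / 2)
        * bn (real k) / d)
      = kwt N \<sigma> k * (q powr (- \<sigma> - real N) * (1 - q powr (2 * real k))) / d"
      unfolding one_minus_powr by (simp add: mult_ac)
    then have "q powr (- (real N / 2 - real k) - 1/2) * (bcoef N i * kwt N \<sigma> i)
      = kwt N \<sigma> k * (q powr (- \<sigma> - real N) * (1 - q powr (2 * real k))) / d"
      using bcoef_kwt(2)[of i N \<sigma>] k Suc by (simp add: d_def)
    then show ?thesis by (simp add: Suc F_def mult.assoc[symmetric])
  qed
  have T2: "(if k < N then q powr (- (real N / 2 - real k) + 1/2) * (bcoef N k * F (Suc k)) else 0)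
    = - (kwt N \<sigma> k * (q powr (\<sigma> + real N) * (1 - q powr (2 * real k - 2 * real N))) * kw N j \<sigma>
        (Suc k) / d)"
  proof (cases "k < N")
    case False
    then show ?thesis using q k by simp
  next
    case True
    have bnm: "bn (real N - real k) = - bn (real k - real N)" by (simp add: bn_def)
    have "q powr (- (real N / 2 - real k) + 1/2) * q powr (\<sigma> + (real N - 1) / 2)
        = q powr (\<sigma> + real N) * q powr (real k - real N)"
      unfolding powr_add[symmetric] by (rule arg_cong[of _ _ "\<lambda>x. q powr x"]) (simp add: field_simps)
    then have "q powr (- (real N / 2 - real k) + 1/2) * (kwt N \<sigma> k * q powr (\<sigma> + (real N - 1) / 2) * bn
        (real N - real k) / d)
      = - (kwt N \<sigma> k * (q powr (\<sigma> + real N) * (1 - q powr (2 * (real k - real N)))) / d)"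
      unfolding one_minus_powr bnm by (simp add: mult_ac)
    then have "q powr (- (real N / 2 - real k) + 1/2) * (bcoef N k * kwt N \<sigma> (Suc k))
      = - (kwt N \<sigma> k * (q powr (\<sigma> + real N) * (1 - q powr (2 * real k - 2 * real N))) / d)"
      using bcoef_kwt(1)[OF True, of \<sigma>] by (simp add: d_def right_diff_distrib)
    then show ?thesis using True by (simp add: F_def mult.assoc[symmetric])
  qed
  let ?R = "- (q powr (2 * real k - 2 * real N)) + q powr (-2 * \<sigma> + 2 * real k - 2 * real N)
        - q powr (-2 * j - 2 * \<sigma> - real N) + q powr (2 * j - real N)"
  have R: "q powr (\<sigma> + real N) * ?R = - (q powr (\<sigma> + (2 * real k - real N))) + q powr (- \<sigma> + (2 * real k
      - real N))
        - q powr (-2 * j - \<sigma>) + q powr (\<sigma> + 2 * j)"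
  proof -
    have "\<sigma> + real N + (2 * real k - 2 * real N) = \<sigma> + (2 * real k - real N)"
      "\<sigma> + real N + (-2 * \<sigma> + 2 * real k - 2 * real N) = - \<sigma> + (2 * real k - real N)"
      "\<sigma> + real N + (-2 * j - 2 * \<sigma> - real N) = -2 * j - \<sigma>"
      "\<sigma> + real N + (2 * j - real N) = \<sigma> + 2 * j" by simp_all
    then show ?thesis
      by (simp only: distrib_left right_diff_distrib mult_minus_right powr_add[symmetric])
  qed
  have "q powr (\<sigma> + real N) * q powr (-2 * \<sigma> - 2 * real N) = q powr (- \<sigma> - real N)"
    unfolding powr_add[symmetric] by (rule arg_cong[of _ _ "\<lambda>x. q powr x"]) simp
  then have "q powr (- \<sigma> - real N) * (1 - q powr (2 * real k)) * kw N j \<sigma> (k - 1)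
      - q powr (\<sigma> + real N) * (1 - q powr (2 * real k - 2 * real N)) * kw N j \<sigma> (Suc k)
    = - (q powr (\<sigma> + real N) * ((1 - q powr (2 * real k - 2 * real N)) * kw N j \<sigma> (Suc k)
      - q powr (-2 * \<sigma> - 2 * real N) * (1 - q powr (2 * real k)) * kw N j \<sigma> (k - 1)))"
    by (simp only: right_diff_distrib mult.assoc[symmetric] minus_diff_eq)
  also have "\<dots> = - ((q powr (\<sigma> + real N) * ?R) * kw N j \<sigma> k)"
    unfolding kw_recurrence[OF x k] by (simp only: mult.assoc)
  finally have rec: "q powr (- \<sigma> - real N) * (1 - q powr (2 * real k)) * kw N j \<sigma> (k - 1)
      - q powr (\<sigma> + real N) * (1 - q powr (2 * real k - 2 * real N)) * kw N j \<sigma> (Suc k)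
    = - ((q powr (\<sigma> + real N) * ?R) * kw N j \<sigma> k)" .
  have ev: "eig_val q j \<sigma> = - ((q powr (-2 * j - \<sigma>) - q powr (\<sigma> + 2 * j) + q powr \<sigma> - q powr (-\<sigma>)) / d)"
    by (simp add: eig_val_def d)
  define P where "P = q powr (2 * real k - real N)"
  have S: "kwt N \<sigma> k * (q powr (- \<sigma> - real N) * (1 - q powr (2 * real k))) * kw N j \<sigma> (k - 1) / d
     + - (kwt N \<sigma> k * (q powr (\<sigma> + real N) * (1 - q powr (2 * real k - 2 * real N))) * kw N j \<sigma>
         (Suc k) / d)
     = kwt N \<sigma> k * (- ((q powr (\<sigma> + real N) * ?R) * kw N j \<sigma> k)) / d"
  proof -
    have "W * a * x / d + - (W * b * y / d) = W * (a * x - b * y) / d" for W a b x y :: real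
      by (simp add: right_diff_distrib diff_divide_distrib mult.assoc)
    then show ?thesis unfolding rec[symmetric] by (simp only:)
  qed
  have alg: "W * (- ((- (s * P) + s' * P - u + v) * K)) / d + (s - s') / - d * (P - 1) * (W * K)
      = - (- ((u - v + s - s') / d)) * (W * K)" for W s s' u v K :: real
    by (simp add: algebra_simps add_divide_distrib diff_divide_distrib)
  show ?thesis
    unfolding T1 T2 unfolding S R d ev F_def powr_add[of q _ "2 * real k - real N"] P_def[symmetric]
    by (rule alg)
qed

end

section \<open>The matrix of \<open>X_elt q u \<sigma> * u UA\<close> in the weight basis\<close>

lemma weights_eq: "weights (real N / 2) = (\<lambda>k. real N / 2 - real k) ` {..N}"
proof -
  have "n \<in> weights (real N / 2) \<longleftrightarrow> n \<in> (\<lambda>k. real N / 2 - real k) ` {..N}" for n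
  proof
    assume "n \<in> weights (real N / 2)"
    then obtain k where k: "n = - (real N / 2) + real k" "n \<le> real N / 2"
      by (auto simp: weights_def)
    then have "real k \<le> real N" by simp
    then have "k \<le> N" by simp
    then show "n \<in> (\<lambda>k. real N / 2 - real k) ` {..N}"
      using k by (intro image_eqI[of _ _ "N - k"]) (auto simp: of_nat_diff)
  next
    assume "n \<in> (\<lambda>k. real N / 2 - real k) ` {..N}"
    then obtain k where "k \<le> N" "n = real N / 2 - real k" by auto
    then show "n \<in> weights (real N / 2)"
      unfolding weights_def by (auto intro!: exI[of _ "N - k"] simp: of_nat_diff)
  qed
  then show ?thesis by blast
qed

text \<open>Upward enumeration, matching the index n + l of \<open>fv\<close>; the eigenvectors use
  the downward one, with index l - n.\<close>

lemma weights_eq': "weights (real N / 2) = (\<lambda>k. real k - real N / 2) ` {..N}"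
proof -
  have "(\<lambda>k. real N / 2 - real k) ` {..N} = (\<lambda>k. real N / 2 - real k) ` ((\<lambda>k. N - k) ` {..N})"
  proof -
    have "(\<lambda>k. N - k) ` {..N} = {..N}"
      by (auto simp: image_iff) (metis atMost_iff diff_diff_cancel diff_le_self)
    then show ?thesis by simp
  qed
  also have "\<dots> = (\<lambda>k. real k - real N / 2) ` {..N}"
    unfolding image_image by (rule image_cong) (auto simp: of_nat_diff)
  finally show ?thesis by (simp add: weights_eq)
qed

lemma finite_weights: "finite (weights (real N / 2))"
  by (simp add: weights_eq)

text \<open>The matrix of \<open>t\<^sup>l(X\<^sub>\<sigma> A)\<close>.\<close>

definition X_mat :: "real \<Rightarrow> real \<Rightarrow> real \<Rightarrow> real \<Rightarrow> real \<Rightarrow> complex" where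
  "X_mat q l \<sigma> n m =
    ((\<i> * complex_of_real (q powr (1/2))) * complex_of_real (spin_gen q l UB n m)
     - (\<i> * complex_of_real (q powr (-1/2))) * complex_of_real (spin_gen q l UC n m)
     - complex_of_real ((q powr \<sigma> - q powr (-\<sigma>)) / (q - inverse q)) *
       (complex_of_real (spin_gen q l UA n m) - complex_of_real (spin_gen q l UD n m))) *
    complex_of_real (q powr (- m))"

text \<open>The column factor q^(-m) from A alone would break the symmetry; the coefficients q^(1/2)
  of B and q^(-1/2) of C compensate it exactly, and \<i> against -\<i> supplies the
  conjugation.\<close>

lemma X_mat_hermitian: "X_mat q l \<sigma> n m = cnj (X_mat q l \<sigma> m n)"
proof -
  consider "n = m" | "n = m - 1" | "n = m + 1" | "n \<noteq> m" "n \<noteq> m - 1" "n \<noteq> m + 1" by blast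
  then show ?thesis
  proof cases
    case 2
    have "q powr (1/2) * q powr (- m) = q powr (-1/2) * q powr (1 - m)"
      unfolding powr_add[symmetric] by simp
    then have "complex_of_real (q powr (1/2)) * complex_of_real (q powr (- m)) =
        complex_of_real (q powr (-1/2)) * complex_of_real (q powr (1 - m))"
      unfolding of_real_mult[symmetric] by (rule arg_cong)
    then show ?thesis
      by (simp add: 2 X_mat_def algebra_simps)
  next
    case 3
    have "q powr (1/2) * q powr (- 1 - m) = q powr (-1/2) * q powr (- m)"
      unfolding powr_add[symmetric] by simp
    then have "complex_of_real (q powr (1/2)) * complex_of_real (q powr (- 1 - m)) =
        complex_of_real (q powr (-1/2)) * complex_of_real (q powr (- m))"
      unfolding of_real_mult[symmetric] by (rule arg_cong)
    then show ?thesis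
      by (simp add: 3 X_mat_def algebra_simps)
  qed (auto simp: X_mat_def)
qed

lemma sum_tridiagonal:
  fixes A B D :: "nat \<Rightarrow> 'z::comm_monoid_add"
  assumes "k \<le> N"
  shows "(\<Sum>m\<le>N. (if Suc m = k then A m else 0) + (if m = Suc k then B m else 0) + (if m
      = k then D m else 0))
    = (if k = 0 then 0 else A (k - 1)) + (if k < N then B (Suc k) else 0) + D k"
proof -
  have "(\<Sum>m\<le>N. if Suc m = k then A m else 0) = (if k = 0 then 0 else A (k - 1))"
    using assms by (cases k) auto
  then show ?thesis using assms by (simp add: sum.distrib Suc_le_eq)
qed

lemma eig_vec_eq:
  assumes "0 < q" "q < 1"
  shows "eig_vec q (real N / 2) j \<sigma> (real N / 2 - real k) =
    complex_of_real (eig_const q (real N / 2) j \<sigma>) * (- \<i>) ^ k * complex_of_real (kwt q N \<sigma> k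
        * kw q N j \<sigma> k)"
proof -
  have "\<i> powi \<lfloor>real N / 2 - real k - real N / 2\<rfloor> = (- \<i>) ^ k"
  proof -
    have "\<lfloor>real N / 2 - real k - real N / 2\<rfloor> = \<lfloor>real_of_int (- int k)\<rfloor>"
      by (rule arg_cong[of _ _ floor]) simp
    then have "\<lfloor>real N / 2 - real k - real N / 2\<rfloor> = - int k" by (simp only: floor_of_int)
    then show ?thesis by (simp add: power_int_minus power_inverse[symmetric])
  qed
  then show ?thesis
    using assms by (simp add: eig_vec_def kwt_def kw_def nat_of_def)
qed

lemma eig_vec_eigenvector:
  assumes q: "0 < q" "q < 1" and j: "j \<in> weights (real N / 2)" and n: "n \<in> weights (real N / 2)"
  shows "mat_vec (real N / 2) (X_mat q (real N / 2) \<sigma>) (eig_vec q (real N / 2) j \<sigma>) n =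
    complex_of_real (eig_val q j \<sigma>) * eig_vec q (real N / 2) j \<sigma> n"
proof -
  let ?l = "real N / 2"
  obtain x where x: "j = ?l - real x" "x \<le> N" using j by (auto simp: weights_eq)
  obtain k where k: "n = ?l - real k" "k \<le> N" using n by (auto simp: weights_eq)
  define F where "F k = kwt q N \<sigma> k * kw q N j \<sigma> k" for k
  define C where "C = complex_of_real (eig_const q ?l j \<sigma>)"
  define S where "S = (q powr \<sigma> - q powr (-\<sigma>)) / (q - inverse q)"
  define v where "v k = C * (- \<i>) ^ k * complex_of_real (F k)" for k
  have v: "eig_vec q ?l j \<sigma> (?l - real k) = v k" for k
    unfolding v_def C_def F_def by (rule eig_vec_eq[OF q])
  have up: "q powr (1/2) * q powr (- (?l - real m)) = q powr (- (?l - real (Suc m)) - 1/2)" for m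
    unfolding powr_add[symmetric] by (rule arg_cong[of _ _ "\<lambda>x. q powr x"]) simp
  have down: "q powr (-1/2) * q powr (- (?l - real (Suc k))) = q powr (- (?l - real k) + 1/2)"
    unfolding powr_add[symmetric] by (rule arg_cong[of _ _ "\<lambda>x. q powr x"]) simp
  have entry: "X_mat q ?l \<sigma> (?l - real k) (?l - real m) * v m =
      (if Suc m = k then \<i> * complex_of_real (q powr (- (?l - real k) - 1/2) * bcoef q N m)
          * v m else 0)
    + (if m = Suc k then - (\<i> * complex_of_real (q powr (- (?l - real k) + 1/2) * bcoef q N k))
        * v m else 0)
    + (if m = k then - complex_of_real (S * (q powr (2 * real k - real N) - 1)) * v m else 0)"
    if m: "m \<le> N" for m
  proof -
    have eq: "?l - real k = ?l - real m - 1 \<longleftrightarrow> Suc m = k" "?l - real k = ?l - real m + 1 \<longleftrightarrow> m = Suc k"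
      "?l - real k = ?l - real m \<longleftrightarrow> m = k"
      by auto
    have B: "spin_gen q ?l UB (?l - real k) (?l - real m) = (if Suc m = k then bcoef q N m else 0)"
    proof -
      have "- ?l + (?l - real m) - 1 = - real (Suc m)" "?l - (?l - real m) + 1 = real (Suc m)"
        "- ?l - (?l - real m) = - (real N - real m)" "?l + (?l - real m) = real N - real m" by simp_all
      then show ?thesis by (simp only: spin_gen.simps eq bcoef_def[OF q] bn_def[OF q])
    qed
    have Cc: "spin_gen q ?l UC (?l - real k) (?l - real m) = (if m = Suc k then bcoef q N k else 0)"
    proof (cases "m = Suc k")
      case True
      have "- ?l + (?l - real m) = - real (Suc k)" "?l - (?l - real m) = real (Suc k)"
        "- ?l - (?l - real m) - 1 = - (real N - real k)" "?l + (?l - real m) + 1 = real N - real k"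
        using True by simp_all
      then show ?thesis by (simp only: spin_gen.simps eq bcoef_def[OF q] bn_def[OF q])
    qed (simp only: spin_gen.simps eq if_False)
    \<comment> \<open>On the diagonal (A - D)A = A^2 - 1, since DA = 1.\<close>
    have AD: "(spin_gen q ?l UA (?l - real k) (?l - real m) - spin_gen q ?l UD (?l - real k) (?l
        - real m)) * q powr (- (?l - real m))
      = (if m = k then q powr (2 * real k - real N) - 1 else 0)"
    proof (cases "m = k")
      case True
      have "q powr (- (?l - real k)) * q powr (- (?l - real k)) = q powr (2 * real k - real N)"
        "q powr (?l - real k) * q powr (- (?l - real k)) = 1"
        unfolding powr_add[symmetric] using q by simp_all
      then show ?thesis unfolding True by (simp add: left_diff_distrib del: minus_diff_eq)
    qed (simp only: spin_gen.simps eq if_False, simp)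
    have "X_mat q ?l \<sigma> (?l - real k) (?l - real m) =
       \<i> * complex_of_real (q powr (1/2) * q powr (- (?l - real m)) * spin_gen q ?l UB (?l - real k) (?l
           - real m))
     - \<i> * complex_of_real (q powr (-1/2) * q powr (- (?l - real m)) * spin_gen q ?l UC (?l - real k)
         (?l - real m))
     - complex_of_real (S * ((spin_gen q ?l UA (?l - real k) (?l - real m) - spin_gen q ?l UD (?l
         - real k) (?l - real m)) * q powr (- (?l - real m))))"
    proof -
      have "((\<i> * c) * b - (\<i> * c') * b' - s * (d - d')) * w
        = \<i> * (c * w * b) - \<i> * (c' * w * b') - s * ((d - d') * w)" for c c' b b' s d d' w :: complex
        by (simp add: algebra_simps)
      then show ?thesis
        unfolding X_mat_def S_def[symmetric] unfolding of_real_mult of_real_diff .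
    qed
    also have "\<dots> = (if Suc m = k then \<i> * complex_of_real (q powr (- (?l - real k) - 1/2)
        * bcoef q N m) else 0)
    + (if m = Suc k then - (\<i> * complex_of_real (q powr (- (?l - real k) + 1/2) * bcoef q N k)) else 0)
    + (if m = k then - complex_of_real (S * (q powr (2 * real k - real N) - 1)) else 0)"
    proof -
      have "q powr (-1/2) * q powr (- (?l - real m)) * (if m = Suc k then bcoef q N k else 0)
        = (if m = Suc k then q powr (- (?l - real k) + 1/2) * bcoef q N k else 0)"
      proof (cases "m = Suc k")
        case True
        show ?thesis unfolding True down by (simp only: if_True refl)
      qed simp
      then show ?thesis unfolding B Cc AD up by auto
    qed
    finally show ?thesis by auto
  qed
  have inj: "inj_on (\<lambda>k. ?l - real k) {..N}" by (simp add: inj_on_def)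
  have "mat_vec ?l (X_mat q ?l \<sigma>) (eig_vec q ?l j \<sigma>) n
      = (\<Sum>m\<le>N. X_mat q ?l \<sigma> (?l - real k) (?l - real m) * v m)"
    unfolding mat_vec_def weights_eq sum.reindex[OF inj] comp_def k(1) v ..
  also have "\<dots> = (\<Sum>m\<le>N.
      (if Suc m = k then \<i> * complex_of_real (q powr (- (?l - real k) - 1/2) * bcoef q N m)
          * v m else 0)
    + (if m = Suc k then - (\<i> * complex_of_real (q powr (- (?l - real k) + 1/2) * bcoef q N k))
        * v m else 0)
    + (if m = k then - complex_of_real (S * (q powr (2 * real k - real N) - 1)) * v m else 0))"
    by (rule sum.cong) (simp_all only: entry atMost_iff)
  also have "\<dots> = (if k = 0 then 0 else \<i> * complex_of_real (q powr (- (?l - real k) - 1/2) * bcoef q N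
      (k - 1)) * v (k - 1))
    + (if k < N then - (\<i> * complex_of_real (q powr (- (?l - real k) + 1/2) * bcoef q N k)) * v
        (Suc k) else 0)
    + - complex_of_real (S * (q powr (2 * real k - real N) - 1)) * v k"
    by (rule sum_tridiagonal[OF k(2)])
  \<comment> \<open>The powers of -\<i> in the vector turn the entries with \<i> and -\<i> into the
    common phase -(-\<i>)^k and leave a real combination.\<close>
  also have "\<dots> = - (C * (- \<i>) ^ k) * complex_of_real (
      (if k = 0 then 0 else q powr (- (?l - real k) - 1/2) * (bcoef q N (k - 1) * F (k - 1)))
      + (if k < N then q powr (- (?l - real k) + 1/2) * (bcoef q N k * F (Suc k)) else 0)
      + S * (q powr (2 * real k - real N) - 1) * F k)"
  proof -
    have "\<i> * complex_of_real (r * b) * v (k - 1)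
        = - (C * (- \<i>) ^ k) * complex_of_real (r * (b * F (k - 1)))" if "k \<noteq> 0" for r b
    proof -
      have "(- \<i>) ^ k = - \<i> * (- \<i>) ^ (k - 1)" using that by (metis power_eq_if)
      then show ?thesis by (simp add: v_def)
    qed
    moreover have "- (\<i> * complex_of_real (r * b)) * v (Suc k)
        = - (C * (- \<i>) ^ k) * complex_of_real (r * (b * F (Suc k)))" for r b
    proof -
      have "- (\<i> * x) * (C * (- \<i> * y) * z) = (\<i> * \<i>) * (C * y * (x * z))" for x y z
        by (simp only: mult_minus_left mult_minus_right minus_minus mult_ac)
      from this[of "complex_of_real r * complex_of_real b" "(- \<i>) ^ k" "complex_of_real (F (Suc k))"]
      show ?thesis by (simp add: v_def mult.assoc)
    qed
    moreover have "- complex_of_real r * v k = - (C * (- \<i>) ^ k) * complex_of_real (r * F k)" for r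
      by (simp add: v_def)
    ultimately show ?thesis
      by (simp only: of_real_add distrib_left split: if_split) simp
  qed
  also have "\<dots> = - (C * (- \<i>) ^ k) * complex_of_real (- eig_val q j \<sigma> * F k)"
    unfolding S_def F_def by (subst weighted_recurrence[OF q x k(2)]) (rule refl)
  also have "\<dots> = complex_of_real (eig_val q j \<sigma>) * v k" by (simp add: v_def)
  finally show ?thesis unfolding k(1) v .
qed

section \<open>Well-definedness of \<open>spin_rep\<close> and \<open>matrix_elt\<close>, and the
  eigenvalue equations\<close>

context quantum_pair begin

lemma is_spin_rep_ex:
  "is_spin_rep q u (real N / 2) (\<lambda>X n m. if n \<in> weights (real N / 2) \<and> m \<in> weights (real N / 2)
     then pr X (spinX N (nat_of (n + real N / 2)) (nat_of (m + real N / 2))) else 0)"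
proof -
  let ?W = "weights (real N / 2)"
  have mem: "real k - real N / 2 \<in> ?W \<longleftrightarrow> k \<le> N" for k
    by (auto simp: weights_eq')
  have idx: "nat_of (real k - real N / 2 + real N / 2) = k" for k
    by (simp add: nat_of_def)
  have idx': "nat_of (real k) = k" for k
    by (simp add: nat_of_def)
  have inj: "inj_on (\<lambda>k. real k - real N / 2) {..N}" by (simp add: inj_on_def)
  have sum: "(\<Sum>m\<in>?W. f m) = (\<Sum>k\<le>N. f (real k - real N / 2))" for f :: "real \<Rightarrow> complex"
    unfolding weights_eq' sum.reindex[OF inj] comp_def ..
  have ball: "(\<forall>n\<in>?W. P n) \<longleftrightarrow> (\<forall>k\<le>N. P (real k - real N / 2))" for P
    unfolding weights_eq' by auto
  show ?thesis
    unfolding is_spin_rep_def ball sum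
    by (auto simp: mem idx idx' pr_spinX_one pr_spinX_mult pr_spinX_gen pr_linear intro!: clinear_mapI)
qed

lemma is_spin_rep_unique:
  assumes "is_spin_rep q u (real N / 2) s" "is_spin_rep q u (real N / 2) t"
  shows "s X n m = t X n m"
proof (cases "n \<in> weights (real N / 2) \<and> m \<in> weights (real N / 2)")
  case False
  then show ?thesis using assms by (auto simp: is_spin_rep_def)
next
  case True
  have lin: "clinear_map (\<lambda>X. s X n m)" "clinear_map (\<lambda>X. t X n m)" for n m
    using assms by (auto simp: is_spin_rep_def)
  have "\<forall>n\<in>weights (real N / 2). \<forall>m\<in>weights (real N / 2). s X n m = t X n m"
  proof (induction X rule: U_induct)
    case one
    show ?case using assms by (simp add: is_spin_rep_def)
  next
    case (gen x X)
    then show ?case using assms by (simp add: is_spin_rep_def)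
  qed (simp_all add: clinear_simps[OF lin(1)] clinear_simps[OF lin(2)])
  then show ?thesis using True by blast
qed

lemma is_spin_rep_spin_rep: "is_spin_rep q u (real N / 2) (spin_rep q u (real N / 2))"
  unfolding spin_rep_def
proof (rule theI[of "is_spin_rep q u (real N / 2)", OF is_spin_rep_ex])
  show "t = (\<lambda>X n m. if n \<in> weights (real N / 2) \<and> m \<in> weights (real N / 2)
     then pr X (spinX N (nat_of (n + real N / 2)) (nat_of (m + real N / 2))) else 0)"
    if "is_spin_rep q u (real N / 2) t" for t
    by (intro ext is_spin_rep_unique[OF that is_spin_rep_ex])
qed

lemma spin_rep_eq:
  assumes "n \<in> weights (real N / 2)" "m \<in> weights (real N / 2)"
  shows "spin_rep q u (real N / 2) X n m = pr X (spinX N (nat_of (n + real N / 2)) (nat_of (m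
      + real N / 2)))"
  using is_spin_rep_unique[OF is_spin_rep_spin_rep is_spin_rep_ex, of N X n m] assms by simp

text \<open>Existence: combine the \<open>spinX\<close> with the coordinates of \<open>v\<close> and
  the conjugate coordinates of \<open>w\<close>. Uniqueness: non-degeneracy.\<close>

lemma pr_matrix_elt:
  "pr X (matrix_elt q u a (real N / 2) v w) =
    spin_inner (real N / 2) (mat_vec (real N / 2) (spin_rep q u (real N / 2) X) v) w"
proof -
  let ?W = "weights (real N / 2)"
  let ?\<xi> = "\<Sum>n\<in>?W. \<Sum>m\<in>?W. (v m * cnj (w n)) *\<^sub>C spinX N (nat_of (n + real N / 2)) (nat_of (m
      + real N / 2))"
  have ex: "\<forall>X. pr X ?\<xi> = spin_inner (real N / 2) (mat_vec (real N / 2) (spin_rep q u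
      (real N / 2) X) v) w"
    by (auto simp: spin_inner_def mat_vec_def pr_linear sum_distrib_left sum_distrib_right
        scaleC_complex_def spin_rep_eq         mult_ac intro!: sum.cong)
  have "\<forall>X. pr X (matrix_elt q u a (real N / 2) v w) =
    spin_inner (real N / 2) (mat_vec (real N / 2) (spin_rep q u (real N / 2) X) v) w"
    unfolding matrix_elt_def pairing_eq
  proof (rule theI[of _ ?\<xi>])
    show "\<forall>X. pr X ?\<xi> = spin_inner (real N / 2) (mat_vec (real N / 2) (spin_rep q u
        (real N / 2) X) v) w"
      by (rule ex)
    fix \<xi>
    assume "\<forall>X. pr X \<xi> = spin_inner (real N / 2) (mat_vec (real N / 2) (spin_rep q u
        (real N / 2) X) v) w"
    then have "pr X (\<xi> - ?\<xi>) = 0" for X using ex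
      by (simp only: clinear_map_diff[OF clinear_pr(1)] diff_self)
    then show "\<xi> = ?\<xi>" using pairing_nondegenerate[of "\<xi> - ?\<xi>"] by simp
  qed
  then show ?thesis by blast
qed

lemma pr_eqI: "(\<And>X. pr X \<xi> = pr X \<eta>) \<Longrightarrow> \<xi> = \<eta>"
  using pairing_nondegenerate[of "\<xi> - \<eta>"] by (simp add: pr_linear)

text \<open>A is diagonal, so multiplying by it on the right scales each column.\<close>

lemma spin_rep_X_elt:
  assumes "n \<in> weights (real N / 2)" "m \<in> weights (real N / 2)"
  shows "spin_rep q u (real N / 2) (X_elt q u \<sigma> * u UA) n m = X_mat q (real N / 2) \<sigma> n m"
proof -
  let ?t = "spin_rep q u (real N / 2)"
  note rep = is_spin_rep_spin_rep[of N, unfolded is_spin_rep_def]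
  have lin: "clinear_map (\<lambda>X. ?t X n m)" for n m using rep by blast
  have gen: "?t (u x) n m = complex_of_real (spin_gen q (real N / 2) x n m)"
    if "n \<in> weights (real N / 2)" "m \<in> weights (real N / 2)" for x n m using rep that by blast
  have "?t (X_elt q u \<sigma> * u UA) n m = (\<Sum>k\<in>weights (real N / 2). ?t (X_elt q u \<sigma>) n k * ?t (u UA) k m)"
    using rep assms by blast
  also have "\<dots> = (\<Sum>k\<in>weights (real N / 2). if k
      = m then ?t (X_elt q u \<sigma>) n m * complex_of_real (q powr (- m)) else 0)"
    using assms by (intro sum.cong) (auto simp: gen)
  also have "\<dots> = ?t (X_elt q u \<sigma>) n m * complex_of_real (q powr (- m))"
    using assms by (simp add: finite_weights)
  also have "\<dots> = X_mat q (real N / 2) \<sigma> n m"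
    unfolding X_elt_def X_mat_def clinear_simps[OF lin] gen[OF assms] scaleC_complex_def ..
  finally show ?thesis .
qed

lemma mat_vec_spin_rep_mult:
  assumes "n \<in> weights (real N / 2)"
  shows "mat_vec (real N / 2) (spin_rep q u (real N / 2) (X * Y)) v n =
    mat_vec (real N / 2) (spin_rep q u (real N / 2) X) (mat_vec (real N / 2) (spin_rep q u
        (real N / 2) Y) v) n"
proof -
  let ?t = "spin_rep q u (real N / 2)" and ?W = "weights (real N / 2)"
  have "?t (X * Y) n m = (\<Sum>k\<in>?W. ?t X n k * ?t Y k m)" if "m \<in> ?W" for m
    using is_spin_rep_spin_rep[of N] assms that by (simp add: is_spin_rep_def)
  then have "mat_vec (real N / 2) (?t (X * Y)) v n = (\<Sum>m\<in>?W. \<Sum>k\<in>?W. ?t X n k * (?t Y k m * v m))"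
    by (simp add: mat_vec_def sum_distrib_right mult.assoc)
  then show ?thesis
    by (subst (asm) sum.swap) (simp add: mat_vec_def sum_distrib_left)
qed

lemma mat_vec_eigenvector:
  assumes "j \<in> weights (real N / 2)" "n \<in> weights (real N / 2)"
  shows "mat_vec (real N / 2) (spin_rep q u (real N / 2) (X_elt q u \<sigma> * u UA)) (eig_vec q
      (real N / 2) j \<sigma>) n =
    complex_of_real (eig_val q j \<sigma>) * eig_vec q (real N / 2) j \<sigma> n"
proof -
  have "mat_vec (real N / 2) (spin_rep q u (real N / 2) (X_elt q u \<sigma> * u UA)) (eig_vec q
      (real N / 2) j \<sigma>) n =
    mat_vec (real N / 2) (X_mat q (real N / 2) \<sigma>) (eig_vec q (real N / 2) j \<sigma>) n"
    unfolding mat_vec_def using assms(2) by (intro sum.cong) (auto simp: spin_rep_X_elt)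
  then show ?thesis using eig_vec_eigenvector[OF q_pos q_less_1 assms] by simp
qed

text \<open>Paired with Y, the left action puts the operator next to the first vector, on which it
  acts by its eigenvalue; \<open>w\<close> is arbitrary.\<close>

lemma act_left_eigen:
  assumes j: "j \<in> weights (real N / 2)"
  shows "act_left q u a (X_elt q u \<sigma> * u UA) (matrix_elt q u a (real N / 2) (eig_vec q
      (real N / 2) j \<sigma>) w) =
    complex_of_real (eig_val q j \<sigma>) *\<^sub>C matrix_elt q u a (real N / 2) (eig_vec q (real N / 2) j \<sigma>) w"
proof (rule pr_eqI)
  fix Y
  let ?l = "real N / 2" and ?v = "eig_vec q (real N / 2) j \<sigma>" and ?X = "X_elt q u \<sigma> * u UA"
  let ?t = "spin_rep q u ?l"
  have "mat_vec ?l (?t (Y * ?X)) ?v n = complex_of_real (eig_val q j \<sigma>) * mat_vec ?l (?t Y) ?v n"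
    if n: "n \<in> weights ?l" for n
  proof -
    have "mat_vec ?l (?t (Y * ?X)) ?v n = (\<Sum>m\<in>weights ?l. ?t Y n m * mat_vec ?l (?t ?X) ?v m)"
      unfolding mat_vec_spin_rep_mult[OF n] by (simp add: mat_vec_def)
    also have "\<dots> = (\<Sum>m\<in>weights ?l. ?t Y n m * (complex_of_real (eig_val q j \<sigma>) * ?v m))"
      by (rule sum.cong) (simp_all add: mat_vec_eigenvector[OF j])
    finally show ?thesis by (simp add: mat_vec_def sum_distrib_left mult.left_commute)
  qed
  then have "spin_inner ?l (mat_vec ?l (?t (Y * ?X)) ?v) w =
      complex_of_real (eig_val q j \<sigma>) * spin_inner ?l (mat_vec ?l (?t Y) ?v) w"
    by (simp add: spin_inner_def sum_distrib_left mult.assoc)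
  then show "pr Y (act_left q u a ?X (matrix_elt q u a ?l ?v w)) =
    pr Y (complex_of_real (eig_val q j \<sigma>) *\<^sub>C matrix_elt q u a ?l ?v w)"
    by (simp add: act_left_eq pr_Lop pr_matrix_elt clinear_map_scaleC[OF clinear_pr(1)]
        scaleC_complex_def)
qed

text \<open>Here the operator stands leftmost, next to the inner product, and has to be moved to the
  second vector. Its eigenvalue there is real, so conjugation leaves it unchanged.\<close>

lemma act_right_eigen:
  assumes i: "i \<in> weights (real N / 2)"
  shows "act_right q u a (matrix_elt q u a (real N / 2) v (eig_vec q (real N / 2) i \<tau>)) (X_elt q u \<tau>
      * u UA) =
    complex_of_real (eig_val q i \<tau>) *\<^sub>C matrix_elt q u a (real N / 2) v (eig_vec q (real N / 2) i \<tau>)"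
proof (rule pr_eqI)
  fix Y
  let ?l = "real N / 2" and ?w = "eig_vec q (real N / 2) i \<tau>" and ?X = "X_elt q u \<tau> * u UA"
  let ?t = "spin_rep q u ?l" and ?W = "weights (real N / 2)"
  let ?z = "mat_vec ?l (?t Y) v"
  have "spin_inner ?l (mat_vec ?l (?t (?X * Y)) v) ?w = (\<Sum>n\<in>?W. mat_vec ?l (?t ?X) ?z n * cnj (?w n))"
    unfolding spin_inner_def by (rule sum.cong) (simp_all add: mat_vec_spin_rep_mult)
  also have "\<dots> = (\<Sum>n\<in>?W. \<Sum>m\<in>?W. ?z m * (X_mat q ?l \<tau> n m * cnj (?w n)))"
    unfolding mat_vec_def[of _ "?t ?X"] sum_distrib_right
    by (intro sum.cong refl) (simp add: spin_rep_X_elt mult_ac)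
  \<comment> \<open>Self-adjointness carries the operator over to \<open>?w\<close>.\<close>
  also have "\<dots> = (\<Sum>m\<in>?W. ?z m * cnj (mat_vec ?l (X_mat q ?l \<tau>) ?w m))"
    by (subst sum.swap) (simp add: mat_vec_def sum_distrib_left X_mat_hermitian[symmetric])
  also have "\<dots> = (\<Sum>m\<in>?W. ?z m * cnj (complex_of_real (eig_val q i \<tau>) * ?w m))"
    by (rule sum.cong) (simp_all only: eig_vec_eigenvector[OF q_pos q_less_1 i])
  also have "\<dots> = complex_of_real (eig_val q i \<tau>) * spin_inner ?l ?z ?w"
    by (simp add: spin_inner_def sum_distrib_left mult.left_commute)
  finally show "pr Y (act_right q u a (matrix_elt q u a ?l v ?w) ?X) =
    pr Y (complex_of_real (eig_val q i \<tau>) *\<^sub>C matrix_elt q u a ?l v ?w)"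
    by (simp add: pr_Rop pr_matrix_elt clinear_map_scaleC[OF clinear_pr(1)] scaleC_complex_def flip:
        Rop_def)
qed

end

theorem lemma6p3:
  fixes q \<sigma> \<tau> l i j :: real
    and u :: "ugen \<Rightarrow> 'u::complex_algebra_1"
    and a :: "agen \<Rightarrow> 'a::complex_algebra_1"
  assumes "0 < q" and "q < 1"
    and "is_Uq_su2 q u" and "is_Aq_SU2 q a"
    and "l \<in> spins" and "i \<in> weights l" and "j \<in> weights l"
  shows "act_left q u a (X_elt q u \<sigma> * u UA) (gen_matrix_elt q u a l i j \<tau> \<sigma>)
           = complex_of_real (eig_val q j \<sigma>) *\<^sub>C gen_matrix_elt q u a l i j \<tau> \<sigma>
         \<and> act_right q u a (gen_matrix_elt q u a l i j \<tau> \<sigma>) (X_elt q u \<tau> * u UA)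
           = complex_of_real (eig_val q i \<tau>) *\<^sub>C gen_matrix_elt q u a l i j \<tau> \<sigma>"
proof -
  interpret quantum_pair q a u
    using assms by unfold_locales (simp_all add: is_Uq_su2_def is_Aq_SU2_def)
  obtain N where N: "l = real N / 2"
    using \<open>l \<in> spins\<close> by (auto simp: spins_def)
  show ?thesis
    using assms unfolding gen_matrix_elt_def N by (simp add: act_left_eigen act_right_eigen)
qed

end
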